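(* Let $f$ be a homeomorphism of a compact metric space $X$ satisfying the closing property, let $\mathcal A$ be a H\"older $GL(m,\mathbb R)$ cocycle over $f$, and let $\mu$ be an ergodic invariant measure for $f$. Let $\chi_1\le\dots\le\chi_m$ be the Lyapunov exponents (listed with multiplicities) of $\mathcal A$ with respect to $\mu$. Then for any $\varepsilon>0$ there exists a periodic point $p\in X$ of $f$ for which the Lyapunov exponents $\chi_1^{(p)}\le\dots\le\chi_m^{(p)}$ (listed with multiplicities) of $\mathcal A$ at $p$ satisfy $$|\chi_i-\chi_i^{(p)}|<\varepsilon\qquad\text{for } i=1,\dots,m.$$
   Context: For $\lambda>0$, orbit segments $x,fx,\dots,f^nx$ and $p,fp,\dots,f^np$ are called exponentially $\delta$ close with exponent $\lambda$ if $\mathrm{dist}(f^ix,f^ip)\le\delta\exp(-\lambda\min\{i,n-i\})$ for every $i=0,\dots,n$. A homeomorphism $f$ of a metric space $X$ satisfies the closing property if there exist $c,\lambda,\delta_0>0$ such that for any $x\in X$ and $n>0$ with $\mathrm{dist}(x,f^nx)<\delta_0$ there exists $p\in X$ with $f^np=p$ such that, with $\delta=c\,\mathrm{dist}(x,f^nx)$, the orbit segments $x,fx,\dots,f^nx$ and $p,fp,\dots,f^np$ are exponentially $\delta$ close with exponent $\lambda$, and there exists $y\in X$ such that for every $i=0,\dots,n$ $$\mathrm{dist}(f^ip,f^iy)\le\delta e^{-\lambda i}\quad\text{and}\quad \mathrm{dist}(f^iy,f^ix)\le\delta e^{-\lambda(n-i)}.$$ A $GL(m,\mathbb R)$ cocycle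 over $f$ is a function $\mathcal A:X\times\mathbb Z\to GL(m,\mathbb R)$ with $\mathcal A(x,0)=\mathrm{Id}$ and $\mathcal A(x,n+k)=\mathcal A(f^kx,n)\mathcal A(x,k)$ for all $x\in X$, $n,k\in\mathbb Z$. Its generator is $A(x)=\mathcal A(x,1)$, so $\mathcal A(x,n)=A(f^{n-1}x)\cdots A(fx)A(x)$ for $n>0$. The cocycle is H\"older if its generator is H\"older continuous (with some positive exponent $\alpha$), i.e., as $X$ is compact, $\|A(x)-A(y)\|\le c\,\mathrm{dist}(x,y)^\alpha$ for some constant $c$ and all $x,y\in X$, with $\|\cdot\|$ the operator norm. Measures are Borel probability measures. By the Oseledec Multiplicative Ergodic Theorem there are numbers $\bar\chi_1<\dots<\bar\chi_s$ (the Lyapunov exponents of $\mathcal A$ with respect to $\mu$), multiplicities $m_1,\dots,m_s$ with $\sum m_i=m$, and, for $\mu$-a.e. $x$, an $\mathcal A$-invariant splitting $\mathbb R^m=E_{\bar\chi_1}(x)\oplus\dots\oplus E_{\bar\chi_s}(x)$ with $\dim E_{\bar\chi_i}(x)=m_i$ and $\lim_{n\to\pm\infty}n^{-1}\log\|\mathcal A(x,n)v\|=\bar\chi_i$ for $0\ne v\in E_{\bar\chi_i}(x)$. "Listed with multiplicities" means each $\bar\chi_i$ is repeated $m_i$ times. The Lyapunov exponents at a periodic point $p$ with $f^np=p$, $n\geq 1$, are those with respect to the uniform measure on the orbit of $p$; listed with multiplicities they are the numbers $\frac1n\log|\rho|$ for the complex eigenvalues $\rho$ of $\mathcal A(p,n)$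 counted with algebraic multiplicity. *)

theory Defs
  imports "HOL-Probability.Probability" "HOL-Combinatorics.Orbits"
begin

definition iterate :: "('a \<Rightarrow> 'a) \<Rightarrow> int \<Rightarrow> 'a \<Rightarrow> 'a" where
  "iterate f n = (if 0 \<le> n then f ^^ nat n else inv f ^^ nat (- n))"

definition exponentially_close ::
    "('a::metric_space \<Rightarrow> 'a) \<Rightarrow> real \<Rightarrow> real \<Rightarrow> nat \<Rightarrow> 'a \<Rightarrow> 'a \<Rightarrow> bool" where
  "exponentially_close f \<delta> \<kappa> n x p \<longleftrightarrow>
     (\<forall>i\<le>n. dist ((f ^^ i) x) ((f ^^ i) p) \<le> \<delta> * exp (- \<kappa> * real (min i (n - i))))"

definition closing_property :: "('a::metric_space \<Rightarrow> 'a) \<Rightarrow> bool" where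
  "closing_property f \<longleftrightarrow>
     (\<exists>c>0. \<exists>\<kappa>>0. \<exists>\<delta>\<^sub>0>0. \<forall>x. \<forall>n>0. dist x ((f ^^ n) x) < \<delta>\<^sub>0 \<longrightarrow>
        (let \<delta> = c * dist x ((f ^^ n) x) in
         \<exists>p. (f ^^ n) p = p \<and> exponentially_close f \<delta> \<kappa> n x p \<and>
           (\<exists>y. \<forall>i\<le>n.
              dist ((f ^^ i) p) ((f ^^ i) y) \<le> \<delta> * exp (- \<kappa> * real i) \<and>
              dist ((f ^^ i) y) ((f ^^ i) x) \<le> \<delta> * exp (- \<kappa> * real (n - i)))))"

definition GL_cocycle :: "('a \<Rightarrow> 'a) \<Rightarrow> ('a \<Rightarrow> int \<Rightarrow> real^'m^'m) \<Rightarrow> bool" where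
  "GL_cocycle f \<A> \<longleftrightarrow>
     (\<forall>x n. invertible (\<A> x n)) \<and>
     (\<forall>x. \<A> x 0 = mat 1) \<and>
     (\<forall>x n k. \<A> x (n + k) = \<A> (iterate f k x) n ** \<A> x k)"

text \<open>The operator norm is written with \<^const>\<open>onorm\<close>, since \<^const>\<open>norm\<close> on
  \<^typ>\<open>real^'m^'m\<close> is the Frobenius norm. In the case \<open>x = y\<close> note that \<open>0 powr \<alpha> = 0\<close>.\<close>

definition Holder_cocycle :: "('a::metric_space \<Rightarrow> int \<Rightarrow> real^'m^'m) \<Rightarrow> bool" where
  "Holder_cocycle \<A> \<longleftrightarrow>
     (\<exists>\<alpha>>0. \<exists>c. \<forall>x y. onorm ((*v) (\<A> x 1 - \<A> y 1)) \<le> c * dist x y powr \<alpha>)"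

definition invariant_measure :: "('a::topological_space \<Rightarrow> 'a) \<Rightarrow> 'a measure \<Rightarrow> bool" where
  "invariant_measure f M \<longleftrightarrow>
     prob_space M \<and> sets M = sets borel \<and> f \<in> measurable M M \<and> distr M M f = M"

definition ergodic_measure :: "('a::topological_space \<Rightarrow> 'a) \<Rightarrow> 'a measure \<Rightarrow> bool" where
  "ergodic_measure f M \<longleftrightarrow> invariant_measure f M \<and>
     (\<forall>B\<in>sets M. f -` B = B \<longrightarrow> measure M B = 0 \<or> measure M B = 1)"

definition direct_sum_decomposition ::
    "'i set \<Rightarrow> ('i \<Rightarrow> 'v::euclidean_space set) \<Rightarrow> bool" where
  "direct_sum_decomposition I E \<longleftrightarrow>
     (\<forall>i\<in>I. subspace (E i)) \<and> (\<forall>v. \<exists>!w. w \<in> Pi\<^sub>E I E \<and> v = (\<Sum>i\<in>I. w i))"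

text \<open>\<open>chis\<close> is the nondecreasing list of the Lyapunov exponents of \<open>\<A>\<close> with respect to \<open>M\<close>,
  each repeated according to its multiplicity: the distinct exponents are the elements \<open>chi\<close> of
  \<open>set chis\<close>, the multiplicity of \<open>chi\<close> is \<open>count_list chis chi\<close>, and \<open>E chi x\<close> is its Oseledec
  subspace at \<open>x\<close>.\<close>

definition Lyapunov_exponents ::
    "('a \<Rightarrow> 'a) \<Rightarrow> ('a \<Rightarrow> int \<Rightarrow> real^'m^'m) \<Rightarrow> 'a measure \<Rightarrow> real list \<Rightarrow> bool" where
  "Lyapunov_exponents f \<A> M chis \<longleftrightarrow>
     sorted chis \<and> length chis = CARD('m) \<and>
     (\<exists>E :: real \<Rightarrow> 'a \<Rightarrow> (real^'m) set. AE x in M.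
        direct_sum_decomposition (set chis) (\<lambda>chi. E chi x) \<and>
        (\<forall>chi\<in>set chis.
           dim (E chi x) = count_list chis chi \<and>
           (\<forall>n. (*v) (\<A> x n) ` E chi x = E chi (iterate f n x)) \<and>
           (\<forall>v\<in>E chi x. v \<noteq> 0 \<longrightarrow>
              ((\<lambda>n. ln (norm (\<A> x n *v v)) / real_of_int n) \<longlongrightarrow> chi) at_top \<and>
              ((\<lambda>n. ln (norm (\<A> x n *v v)) / real_of_int n) \<longlongrightarrow> chi) at_bot)))"

definition periodic_point :: "('a \<Rightarrow> 'a) \<Rightarrow> 'a \<Rightarrow> bool" where
  "periodic_point f p \<longleftrightarrow> (\<exists>n>0. (f ^^ n) p = p)"

text \<open>The uniform probability measure on the (finite) orbit of a periodic point, as a Borel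
  measure on the whole space; \<open>orbit f p\<close> consists of the points \<open>(f ^^ k) p\<close> with \<open>k > 0\<close>
  and contains \<open>p\<close> when \<open>p\<close> is periodic.\<close>

definition orbit_measure :: "('a::topological_space \<Rightarrow> 'a) \<Rightarrow> 'a \<Rightarrow> 'a measure" where
  "orbit_measure f p = distr (uniform_count_measure (orbit f p)) borel (\<lambda>x. x)"

end

theory Submission
  imports Defs "HOL-Computational_Algebra.Fundamental_Theorem_Algebra"
begin

text \<open>
  Fix a number \<open>t\<close> that is not an exponent of \<open>\<mu>\<close>. At a typical point \<open>x\<close> the space splits into
  the vectors that grow more slowly than \<open>exp (t n)\<close> in forward time and the vectors that shrink
  faster than \<open>exp (- t n)\<close> in backward time; the dimensions of the two parts count the exponents below
  and above \<open>t\<close>. If the orbit of \<open>x\<close> comes back after a large number \<open>n\<close> of steps so close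
  to \<open>x\<close> that the splittings at both ends nearly agree, then the cone of vectors dominated by their fast part is mapped into
  itself by \<open>A(x, n)\<close> and expanded by at least \<open>exp (t n)\<close>. This survives the passage to the orbit of
  the periodic point \<open>p\<close> given by the closing property. Hence all vectors of the fast space at \<open>x\<close> grow
  at least like \<open>exp (t k)\<close> along the orbit of \<open>p\<close>, so this space meets the sum of the Oseledets spaces of
  \<open>p\<close> with exponents below \<open>t\<close> only in \<open>0\<close>, and by a count of dimensions \<open>p\<close> has at most as many
  exponents below \<open>t\<close> as \<open>\<mu>\<close>. The same statement for the inverse map and the reversed cocycle bounds the
  number of exponents above \<open>t\<close>. With thresholds \<open>t\<close> just below and just above every exponent of \<open>\<mu>\<close>,
  treated simultaneously, this puts the \<open>i\<close>-th exponent of \<open>p\<close> next to the \<open>i\<close>-th exponent of \<open>\<mu>\<close>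
  (\<open>sorted_lists_close\<close>).

  The cone survives for the following reason. The matrices along the two orbits differ by at most
  a constant times \<open>\<delta> powr \<alpha> * exp (- \<alpha> \<kappa> min i (n - i))\<close> at step \<open>i\<close>. In norms adapted to the splitting, in which one
  step expands and contracts without any loss, this error is multiplied by the constant that
  compares the adapted norm with the Euclidean one. Such constants are not bounded, but for a set of
  points of positive measure they grow along the orbit, in both time directions, at most like
  \<open>exp (\<tau> n)\<close> with \<open>\<tau>\<close> as small as desired (\<open>tempered_dichotomies\<close>, from the maximal inequality of
  ergodic theory). With \<open>\<tau> = \<alpha> \<kappa>\<close> and both end points of the orbit segment in this set, the
  error in adapted norms is uniformly small (\<open>growth_along_shadowing_orbit\<close>, \<open>shadowing_exponent_counts\<close>).

  The Oseledets spaces are not given as measurable functions of the point. But the sets of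
  points that admit some splitting with given constants are closed, because they are projections of
  closed sets along a compact set of matrices (\<open>closed_good_set\<close>); at typical points this splitting is
  unique, hence equivariant.

  That a periodic point has exponents, with a splitting of the whole space, is proved from growth
  rates alone (\<open>periodic_oseledets\<close>): over the complex numbers every vector is killed by
  a product of factors \<open>B - \<rho>\<close>, and it is written as a sum of vectors with exact growth
  rates by undoing these factors one at a time.
\<close>

section \<open>Cocycles\<close>

lemma iterate_0 [simp]: "iterate f 0 x = x"
  by (simp add: iterate_def)

lemma iterate_of_nat: "iterate f (int n) x = (f ^^ n) x"
  by (simp add: iterate_def)

lemma iterate_neg_of_nat: "iterate f (- int n) x = (inv f ^^ n) x"
  by (cases n) (simp_all add: iterate_def nat_add_distrib)

lemma iterate_plus_1:
  assumes "bij f"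
  shows "iterate f (n + 1) x = f (iterate f n x)"
proof (cases "n \<ge> 0")
  case True
  then show ?thesis by (simp add: iterate_def nat_add_distrib)
next
  case False
  then obtain k where k: "n = - int (Suc k)"
    by (metis int_cases of_nat_0_le_iff)
  have "n + 1 = - int k" using k by simp
  then show ?thesis
    using assms by (simp only: k iterate_neg_of_nat) (simp add: bij_is_surj surj_f_inv_f)
qed

lemma iterate_add:
  assumes "bij f"
  shows "iterate f (m + n) x = iterate f m (iterate f n x)"
proof (induction m rule: int_induct [where k = 0])
  case base
  then show ?case by simp
next
  case (step1 i)
  then show ?case
    using iterate_plus_1 [OF assms, of "i + n" x] iterate_plus_1 [OF assms, of i]
    by (simp add: algebra_simps)
next
  case (step2 i)
  have "f (iterate f (i - 1 + n) x) = f (iterate f (i - 1) (iterate f n x))"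
    using iterate_plus_1 [OF assms, of "i - 1 + n" x] step2
      iterate_plus_1 [OF assms, of "i - 1" "iterate f n x"]
    by (simp add: algebra_simps)
  then show ?case using assms by (simp add: bij_is_inj inj_eq)
qed

lemma iterate_inv:
  assumes "bij f"
  shows "iterate (inv f) n x = iterate f (- n) x"
  using assms by (auto simp: iterate_def inv_inv_eq)

definition reverse_cocycle :: "('a \<Rightarrow> int \<Rightarrow> real^'m^'m) \<Rightarrow> 'a \<Rightarrow> int \<Rightarrow> real^'m^'m" where
  "reverse_cocycle A x n = A x (- n)"

locale cocycle =
  fixes f :: "'a \<Rightarrow> 'a" and A :: "'a \<Rightarrow> int \<Rightarrow> real^'m^'m"
  assumes bij: "bij f" and GL: "GL_cocycle f A"
begin

lemma at_0 [simp]: "A x 0 = mat 1"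
  using GL by (auto simp: GL_cocycle_def)

lemma at_add: "A x (n + k) *v v = A (iterate f k x) n *v (A x k *v v)"
  using GL by (auto simp: GL_cocycle_def matrix_vector_mul_assoc)

lemma inverse_left [simp]: "A (iterate f k x) (- k) *v (A x k *v v) = v"
  using at_add [of x "-k" k v] by simp

lemma inverse_right [simp]: "A x k *v (A (iterate f k x) (- k) *v v) = v"
  using inverse_left [of "-k" "iterate f k x" v] iterate_add [OF bij, of "-k" k x] by simp

lemma at_nonzero: "v \<noteq> 0 \<Longrightarrow> A x n *v v \<noteq> 0"
  by (metis inverse_left matrix_vector_mult_0_right)

lemma cocycle_reverse: "cocycle (inv f) (reverse_cocycle A)"
proof
  show "bij (inv f)" by (rule bij_imp_bij_inv [OF bij])
  have "A x (- (n + k)) = A (iterate f (- k) x) (- n) ** A x (- k)" for x n k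
  proof -
    have "A x (- n + - k) = A (iterate f (- k) x) (- n) ** A x (- k)"
      using GL unfolding GL_cocycle_def by blast
    then show ?thesis by simp
  qed
  then show "GL_cocycle (inv f) (reverse_cocycle A)"
    using GL unfolding GL_cocycle_def reverse_cocycle_def iterate_inv [OF bij] by simp
qed

end

lemma reverse_reverse [simp]: "reverse_cocycle (reverse_cocycle A) = A"
  by (intro ext) (simp add: reverse_cocycle_def)

section \<open>Exponential growth of vectors\<close>

text \<open>It suffices to bound the vectors of an orthonormal basis. This is where finite dimension
  turns growth rates of single vectors into growth rates of operator norms on subspaces.\<close>

lemma pointwise_bounds_uniform_on_subspace:
  fixes T :: "'i \<Rightarrow> 'v::euclidean_space \<Rightarrow> 'w::real_normed_vector"
  assumes W: "subspace W" and lin: "\<And>n. linear (T n)" and g: "\<And>n. 0 \<le> g n"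
    and bound: "\<And>v. v \<in> W \<Longrightarrow> \<exists>C. \<forall>n. norm (T n v) \<le> C * g n"
  obtains C where "C > 0" "\<And>n v. v \<in> W \<Longrightarrow> norm (T n v) \<le> C * g n * norm v"
proof -
  obtain B where B: "B \<subseteq> W" "pairwise orthogonal B" "\<And>x. x \<in> B \<Longrightarrow> norm x = 1"
    "independent B" "card B = dim W" "span B = W"
    using orthonormal_basis_subspace [OF W] by blast
  have fin: "finite B" using B(4) by (rule independent_imp_finite)
  obtain C where C: "\<And>b n. b \<in> B \<Longrightarrow> norm (T n b) \<le> C b * g n"
    using bound B(1) by (metis subsetD)
  define D where "D = (\<Sum>b\<in>B. \<bar>C b\<bar>) + 1"
  have D: "D > 0" unfolding D_def by (simp add: add_nonneg_pos sum_nonneg)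
  have "norm (T n v) \<le> D * g n * norm v" if v: "v \<in> W" for n v
  proof -
    have "v = (\<Sum>b\<in>B. (v \<bullet> b) *\<^sub>R b)"
      using orthonormal_basis_expand [OF B(2,3) _ fin, of v] v B(6) by simp
    then have "T n v = (\<Sum>b\<in>B. (v \<bullet> b) *\<^sub>R T n b)"
      by (metis (no_types, lifting) lin linear_sum linear_cmul sum.cong)
    also have "norm \<dots> \<le> (\<Sum>b\<in>B. norm v * (\<bar>C b\<bar> * g n))"
    proof (rule sum_norm_le)
      fix b assume b: "b \<in> B"
      have "\<bar>v \<bullet> b\<bar> \<le> norm v"
        using Cauchy_Schwarz_ineq2 [of v b] B(3) [OF b] by simp
      moreover have "norm (T n b) \<le> \<bar>C b\<bar> * g n"
        using C [OF b, of n] g [of n] by (meson abs_ge_self mult_right_mono order_trans)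
      ultimately show "norm ((v \<bullet> b) *\<^sub>R T n b) \<le> norm v * (\<bar>C b\<bar> * g n)"
        by (simp add: mult_mono')
    qed
    also have "\<dots> = norm v * g n * (\<Sum>b\<in>B. \<bar>C b\<bar>)"
      by (simp add: sum_distrib_left mult_ac)
    also have "\<dots> \<le> norm v * g n * D"
      unfolding D_def using g by (intro mult_left_mono) auto
    finally show ?thesis by (simp add: mult_ac)
  qed
  with D that show ?thesis by blast
qed

lemma subspace_bounded_growth:
  fixes T :: "'i \<Rightarrow> 'v::real_vector \<Rightarrow> 'w::real_normed_vector"
  assumes lin: "\<And>i. linear (T i)"
  shows "subspace {v. \<exists>C. \<forall>i. norm (T i v) \<le> C * g i}"
proof (unfold subspace_def, intro conjI ballI allI, goal_cases)
  case 1
  show ?case by (auto simp: linear_0 [OF lin] intro!: exI [of _ 0])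
next
  case (2 v w)
  then obtain C D where "\<And>i. norm (T i v) \<le> C * g i" "\<And>i. norm (T i w) \<le> D * g i" by blast
  then have "norm (T i (v + w)) \<le> (C + D) * g i" for i
    by (simp add: linear_add [OF lin] distrib_right norm_triangle_le add_mono)
  then show ?case by blast
next
  case (3 c v)
  then obtain C where "\<And>i. norm (T i v) \<le> C * g i" by blast
  then have "norm (T i (c *\<^sub>R v)) \<le> (\<bar>c\<bar> * C) * g i" for i
    by (simp add: linear_cmul [OF lin] mult.assoc mult_left_mono)
  then show ?case by blast
qed

lemma exp_linear_at_top:
  assumes "r > 0"
  shows "filterlim (\<lambda>n. exp (r * real n)) at_top sequentially"
  using assms by (intro filterlim_compose [OF exp_at_top]
      filterlim_tendsto_pos_mult_at_top [OF tendsto_const] filterlim_real_sequentially)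

definition slow_space :: "('a \<Rightarrow> int \<Rightarrow> real^'m^'m) \<Rightarrow> 'a \<Rightarrow> real \<Rightarrow> (real^'m) set" where
  "slow_space A x a = {v. \<exists>C. \<forall>n::nat. norm (A x (int n) *v v) \<le> C * exp (a * real n)}"

lemma subspace_slow_space: "subspace (slow_space A x a)"
  unfolding slow_space_def
  by (rule subspace_bounded_growth [where T = "\<lambda>n v. A x (int n) *v v"]) (rule matrix_vector_mul_linear)

section \<open>Sums of vectors with different exponents\<close>

lemma exponent_bounds:
  fixes u :: "nat \<Rightarrow> 'v::real_normed_vector"
  assumes lim: "(\<lambda>n. ln (norm (u n)) / real n) \<longlonglongrightarrow> c" and nz: "\<And>n. u n \<noteq> 0" and e: "e > 0"
  shows "\<forall>\<^sub>F n in sequentially.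
    exp ((c - e) * real n) \<le> norm (u n) \<and> norm (u n) \<le> exp ((c + e) * real n)"
proof -
  have "\<forall>\<^sub>F n in sequentially. dist (ln (norm (u n)) / real n) c < e"
    using tendstoD [OF lim e] .
  then show ?thesis
    using eventually_gt_at_top [of 0]
  proof eventually_elim
    case (elim n)
    then have n: "real n > 0" by simp
    have "\<bar>ln (norm (u n)) / real n - c\<bar> < e" using elim by (simp add: dist_real_def)
    then have "(c - e) * real n \<le> ln (norm (u n))" "ln (norm (u n)) \<le> (c + e) * real n"
      using n by (auto simp: abs_less_iff field_simps)
    then show ?case
      using nz [of n] by (metis exp_le_cancel_iff exp_ln zero_less_norm_iff)
  qed
qed

lemma exp_rate_le:
  assumes "\<forall>\<^sub>F n in sequentially. exp (x * real n) \<le> C * exp (y * real n)"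
  shows "x \<le> y"
proof (rule ccontr)
  assume "\<not> x \<le> y"
  then have "filterlim (\<lambda>n. exp ((x - y) * real n)) at_top sequentially"
    by (intro exp_linear_at_top) simp
  then have "\<forall>\<^sub>F n in sequentially. exp ((x - y) * real n) > C"
    by (simp add: filterlim_at_top_dense)
  with assms have "\<forall>\<^sub>F n::nat in sequentially. False"
  proof eventually_elim
    case (elim n)
    have "exp (x * real n) = exp ((x - y) * real n) * exp (y * real n)"
      by (simp add: exp_add [symmetric] algebra_simps)
    with elim show ?case by simp
  qed
  then show False by simp
qed

text \<open>The summand with the largest exponent beats the sum of all others by a factor \<open>exp (d n)\<close>, which
  eventually exceeds the number of summands.\<close>

lemma largest_exponent_dominates:
  fixes w :: "'i \<Rightarrow> nat \<Rightarrow> 'v::real_normed_vector"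
  assumes fin: "finite I" and k: "k \<in> I"
    and lim: "\<And>i. i \<in> I \<Longrightarrow> (\<lambda>n. ln (norm (w i n)) / real n) \<longlonglongrightarrow> c i"
    and nz: "\<And>i n. i \<in> I \<Longrightarrow> w i n \<noteq> 0"
    and max: "\<And>i. i \<in> I - {k} \<Longrightarrow> c i < c k" and e: "e > 0"
  shows "\<forall>\<^sub>F n in sequentially. exp ((c k - e) * real n) \<le> norm (\<Sum>i\<in>I. w i n)"
proof -
  define M where "M = Max (insert (c k - 1) (c ` (I - {k})))"
  have M: "M < c k" unfolding M_def using fin max by (subst Max_less_iff) auto
  have M': "c i \<le> M" if "i \<in> I - {k}" for i
    unfolding M_def using fin that by (intro Max_ge) auto
  \<comment> \<open>\<open>M\<close> bounds the other exponents; a gap of \<open>3 * d\<close> leaves \<open>d\<close> to spare after errors \<open>d\<close> in both rates.\<close>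
  define d where "d = min (e/2) ((c k - M) / 3)"
  have "d \<le> e/2" "d \<le> (c k - M) / 3" unfolding d_def by (rule min.cobounded1, rule min.cobounded2)
  moreover have "d > 0" using M e by (simp add: d_def)
  ultimately have d: "d > 0" "2 * d \<le> e" "M + 3 * d \<le> c k" by auto
  have 1: "\<forall>\<^sub>F n in sequentially. exp ((c k - d) * real n) \<le> norm (w k n)"
    using exponent_bounds [OF lim [OF k] nz [OF k] d(1)] by (rule eventually_mono) simp
  have 2: "\<forall>\<^sub>F n in sequentially. \<forall>i\<in>I - {k}. norm (w i n) \<le> exp ((c k - 2 * d) * real n)"
  proof (rule eventually_ball_finite)
    show "finite (I - {k})" using fin by simp
    show "\<forall>i\<in>I - {k}. \<forall>\<^sub>F n in sequentially. norm (w i n) \<le> exp ((c k - 2 * d) * real n)"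
    proof
      fix i assume i: "i \<in> I - {k}"
      have le: "c i + d \<le> c k - 2 * d" using M' [OF i] d by simp
      have "\<forall>\<^sub>F n in sequentially. norm (w i n) \<le> exp ((c i + d) * real n)"
        using exponent_bounds [OF lim nz d(1), of i] i by (auto elim: eventually_mono)
      then show "\<forall>\<^sub>F n in sequentially. norm (w i n) \<le> exp ((c k - 2 * d) * real n)"
      proof eventually_elim
        case (elim n)
        also have "exp ((c i + d) * real n) \<le> exp ((c k - 2 * d) * real n)"
          using le by (simp add: mult_right_mono)
        finally show ?case .
      qed
    qed
  qed
  have 3: "\<forall>\<^sub>F n in sequentially. exp (d * real n) \<ge> 1 + real (card I)"
    using exp_linear_at_top [OF d(1)] by (simp add: filterlim_at_top)
  from 1 2 3 show ?thesis
  proof eventually_elim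
    case (elim n)
    have "norm (\<Sum>i\<in>I - {k}. w i n) \<le> real (card (I - {k})) * exp ((c k - 2 * d) * real n)"
      using elim(2) by (intro sum_norm_bound) auto
    also have "\<dots> \<le> real (card I) * exp ((c k - 2 * d) * real n)"
      using fin by (intro mult_right_mono) (auto intro: card_mono)
    finally have *: "norm (\<Sum>i\<in>I - {k}. w i n) \<le> real (card I) * exp ((c k - 2 * d) * real n)" .
    have "exp ((c k - e) * real n) \<le> exp ((c k - 2 * d) * real n)"
      using d by (simp add: mult_right_mono)
    also have "\<dots> = (1 + real (card I)) * exp ((c k - 2 * d) * real n)
        - real (card I) * exp ((c k - 2 * d) * real n)" by (simp add: algebra_simps)
    also have "\<dots> \<le> exp (d * real n) * exp ((c k - 2 * d) * real n)
        - real (card I) * exp ((c k - 2 * d) * real n)"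
      using elim(3) by (intro diff_right_mono mult_right_mono) auto
    also have "exp (d * real n) * exp ((c k - 2 * d) * real n) = exp ((c k - d) * real n)"
      by (simp add: exp_add [symmetric] algebra_simps)
    also have "exp ((c k - d) * real n) - real (card I) * exp ((c k - 2 * d) * real n)
        \<le> norm (w k n) - norm (\<Sum>i\<in>I - {k}. w i n)" using elim(1) * by simp
    also have "\<dots> \<le> norm (w k n + (\<Sum>i\<in>I - {k}. w i n))"
      by (metis norm_diff_ineq)
    also have "w k n + (\<Sum>i\<in>I - {k}. w i n) = (\<Sum>i\<in>I. w i n)"
      using fin k by (simp add: sum.remove)
    finally show ?case .
  qed
qed

lemma eventual_exp_bound_imp_bound:
  fixes u :: "nat \<Rightarrow> 'v::real_normed_vector"
  assumes "\<forall>\<^sub>F n in sequentially. norm (u n) \<le> exp (a * real n)"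
  shows "\<exists>C. \<forall>n. norm (u n) \<le> C * exp (a * real n)"
proof -
  obtain N where N: "\<And>n. n \<ge> N \<Longrightarrow> norm (u n) \<le> exp (a * real n)"
    using assms by (auto simp: eventually_sequentially)
  define C where "C = 1 + (\<Sum>n<N. norm (u n) / exp (a * real n))"
  have "norm (u n) \<le> C * exp (a * real n)" for n
  proof (cases "n < N")
    case True
    then have "norm (u n) / exp (a * real n) \<le> (\<Sum>n<N. norm (u n) / exp (a * real n))"
      by (intro member_le_sum) auto
    then have "norm (u n) / exp (a * real n) \<le> C" unfolding C_def by simp
    then show ?thesis by (simp add: field_simps)
  next
    case False
    have "C \<ge> 1" unfolding C_def by (simp add: sum_nonneg)
    then have "exp (a * real n) \<le> C * exp (a * real n)" by simp
    with N [of n] False show ?thesis by linarith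
  qed
  then show ?thesis by blast
qed

section \<open>Direct sums of subspaces\<close>

definition independent_subspaces :: "'i set \<Rightarrow> ('i \<Rightarrow> 'v::euclidean_space set) \<Rightarrow> bool" where
  "independent_subspaces I E \<longleftrightarrow> (\<forall>i\<in>I. subspace (E i)) \<and>
     (\<forall>w. (\<forall>i\<in>I. w i \<in> E i) \<longrightarrow> (\<Sum>i\<in>I. w i) = 0 \<longrightarrow> (\<forall>i\<in>I. w i = 0))"

lemma in_span_Union_imp_sum:
  assumes fin: "finite I" and sub: "\<And>i. i \<in> I \<Longrightarrow> subspace (E i)"
    and x: "x \<in> span (\<Union>i\<in>I. E i)"
  shows "\<exists>w. (\<forall>i\<in>I. w i \<in> E i) \<and> x = (\<Sum>i\<in>I. w i)"
  using x
proof (induction rule: span_induct_alt)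
  case base
  then show ?case using sub by (intro exI [of _ "\<lambda>_. 0"]) (auto intro: subspace_0)
next
  case (step c x y)
  then obtain w where w: "\<forall>i\<in>I. w i \<in> E i" "y = (\<Sum>i\<in>I. w i)" by blast
  from step obtain k where k: "k \<in> I" "x \<in> E k" by blast
  define w' where "w' = w(k := c *\<^sub>R x + w k)"
  have "\<forall>i\<in>I. w' i \<in> E i"
    using w k sub by (auto simp: w'_def intro: subspace_add subspace_scale)
  moreover have "(\<Sum>i\<in>I. w' i) = c *\<^sub>R x + y"
    using w k fin by (simp add: w'_def sum.remove [of I k])
  ultimately show ?case by metis
qed

lemma independent_subspaces_subset:
  assumes "independent_subspaces I E" "J \<subseteq> I" "finite I"
  shows "independent_subspaces J E"
proof (unfold independent_subspaces_def, intro conjI allI impI)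
  show "\<forall>i\<in>J. subspace (E i)" using assms by (auto simp: independent_subspaces_def)
  have sub: "\<And>i. i \<in> I \<Longrightarrow> subspace (E i)" using assms by (auto simp: independent_subspaces_def)
  fix w assume w: "\<forall>i\<in>J. w i \<in> E i" "(\<Sum>i\<in>J. w i) = 0"
  define w' where "w' i = (if i \<in> J then w i else 0)" for i
  have "\<forall>i\<in>I. w' i \<in> E i" using w sub by (auto simp: w'_def subspace_0)
  moreover have "(\<Sum>i\<in>I. w' i) = 0"
    using w assms(2,3) by (simp add: w'_def sum.If_cases Int_absorb1)
  ultimately have "\<forall>i\<in>I. w' i = 0" using assms(1) unfolding independent_subspaces_def by blast
  then show "\<forall>i\<in>J. w i = 0" using assms(2) by (auto simp: w'_def split: if_splits)
qed

lemma dim_independent_subspaces: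
  assumes "finite I" "independent_subspaces I E"
  shows "dim (span (\<Union>i\<in>I. E i)) = (\<Sum>i\<in>I. dim (E i))"
  using assms
proof (induction I rule: finite_induct)
  case empty
  then show ?case by simp
next
  case (insert k I)
  have ind: "independent_subspaces I E"
    using independent_subspaces_subset [OF insert.prems] insert.hyps by blast
  have sub: "\<And>i. i \<in> insert k I \<Longrightarrow> subspace (E i)"
    using insert.prems by (auto simp: independent_subspaces_def)
  let ?U = "span (\<Union>i\<in>I. E i)"
  have "E k \<inter> ?U = {0}"
  proof (intro equalityI subsetI)
    fix x assume x: "x \<in> E k \<inter> ?U"
    obtain w where w: "\<forall>i\<in>I. w i \<in> E i" "x = (\<Sum>i\<in>I. w i)"
      using in_span_Union_imp_sum [OF insert.hyps(1), of E x] sub x by auto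
    define w' where "w' i = (if i = k then - x else w i)" for i
    have "\<forall>i\<in>insert k I. w' i \<in> E i"
      using w x sub by (auto simp: w'_def subspace_neg)
    moreover have "(\<Sum>i\<in>I. w' i) = (\<Sum>i\<in>I. w i)"
      using insert.hyps by (intro sum.cong) (auto simp: w'_def)
    then have "(\<Sum>i\<in>insert k I. w' i) = 0"
      using insert.hyps w(2) by (simp add: w'_def)
    ultimately have "w' k = 0"
      using insert.prems unfolding independent_subspaces_def by blast
    then show "x \<in> {0}" by (simp add: w'_def)
  next
    fix x assume "x \<in> {0::'b}"
    then show "x \<in> E k \<inter> ?U" using sub by (auto simp: subspace_0 span_zero)
  qed
  moreover have "span (\<Union>i\<in>insert k I. E i) = {x + y |x y. x \<in> E k \<and> y \<in> ?U}"
    using sub by (simp add: span_Un span_eq_iff [THEN iffD2])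
  ultimately show ?case
    using dim_sums_Int [of "E k" ?U] sub insert by (simp add: ind)
qed

lemma direct_sum_decomposition_iff:
  assumes fin: "finite I"
  shows "direct_sum_decomposition I E \<longleftrightarrow>
    independent_subspaces I E \<and> span (\<Union>i\<in>I. E i) = UNIV"
proof
  assume D: "direct_sum_decomposition I E"
  then have sub: "\<And>i. i \<in> I \<Longrightarrow> subspace (E i)" by (auto simp: direct_sum_decomposition_def)
  have "\<forall>i\<in>I. w i = 0" if w: "\<forall>i\<in>I. w i \<in> E i" "(\<Sum>i\<in>I. w i) = 0" for w
  proof -
    have "restrict w I \<in> Pi\<^sub>E I E" "0 = (\<Sum>i\<in>I. restrict w I i)" using w by auto
    moreover have "restrict (\<lambda>_. 0) I \<in> Pi\<^sub>E I E" "0 = (\<Sum>i\<in>I. restrict (\<lambda>_. 0) I i)"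
      using sub by (auto simp: subspace_0)
    ultimately have "restrict w I = restrict (\<lambda>_. 0) I"
      using D unfolding direct_sum_decomposition_def by blast
    then show ?thesis by (metis restrict_apply')
  qed
  moreover have "v \<in> span (\<Union>i\<in>I. E i)" for v
  proof -
    obtain w where w: "w \<in> Pi\<^sub>E I E" "v = (\<Sum>i\<in>I. w i)"
      using D unfolding direct_sum_decomposition_def by blast
    have "w i \<in> span (\<Union>i\<in>I. E i)" if "i \<in> I" for i
      using w that by (intro span_base) auto
    then show ?thesis unfolding w(2) by (rule span_sum)
  qed
  ultimately show "independent_subspaces I E \<and> span (\<Union>i\<in>I. E i) = UNIV"
    using sub unfolding independent_subspaces_def by blast
next
  assume R: "independent_subspaces I E \<and> span (\<Union>i\<in>I. E i) = UNIV"
  then have sub: "\<And>i. i \<in> I \<Longrightarrow> subspace (E i)" by (auto simp: independent_subspaces_def)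
  show "direct_sum_decomposition I E"
  proof (unfold direct_sum_decomposition_def, intro conjI ballI allI)
    fix v
    have "v \<in> span (\<Union>i\<in>I. E i)" using R by simp
    from in_span_Union_imp_sum [OF fin sub this]
    obtain w where w: "\<forall>i\<in>I. w i \<in> E i" "v = (\<Sum>i\<in>I. w i)" by blast
    show "\<exists>!w. w \<in> Pi\<^sub>E I E \<and> v = (\<Sum>i\<in>I. w i)"
    proof (rule ex1I [of _ "restrict w I"])
      show "restrict w I \<in> Pi\<^sub>E I E \<and> v = (\<Sum>i\<in>I. restrict w I i)" using w by auto
      fix w' assume w': "w' \<in> Pi\<^sub>E I E \<and> v = (\<Sum>i\<in>I. w' i)"
      have "\<forall>i\<in>I. w' i - w i \<in> E i" using w w' sub by (auto intro: subspace_diff)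
      moreover have "(\<Sum>i\<in>I. w' i - w i) = 0" using w w' by (simp add: sum_subtractf)
      ultimately have "\<forall>i\<in>I. w' i - w i = 0"
        using R [unfolded independent_subspaces_def, THEN conjunct1, THEN conjunct2,
            THEN spec, of "\<lambda>i. w' i - w i"] by blast
      then show "w' = restrict w I" using w' by (auto simp: fun_eq_iff PiE_def extensional_def)
    qed
  qed (use sub in blast)
qed

section \<open>Slow subspaces at a point with an Oseledets splitting\<close>

text \<open>A slow vector has no component with a larger exponent, because that component would dominate the
  sum. The map \<open>\<phi>\<close> allows to treat the forward exponents \<open>c\<close> and the backward exponents \<open>- c\<close> of one
  splitting with the same lemma.\<close>

lemma components_of_slow_vector:
  fixes T :: "nat \<Rightarrow> 'v::euclidean_space \<Rightarrow> 'w::real_normed_vector"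
  assumes fin: "finite I" and inj: "inj_on \<phi> I"
    and lin: "\<And>n. linear (T n)" and nz: "\<And>n v. v \<noteq> 0 \<Longrightarrow> T n v \<noteq> 0"
    and lim: "\<And>i v. i \<in> I \<Longrightarrow> v \<in> E i \<Longrightarrow> v \<noteq> 0 \<Longrightarrow> (\<lambda>n. ln (norm (T n v)) / real n) \<longlonglongrightarrow> \<phi> i"
    and w: "\<And>i. i \<in> I \<Longrightarrow> w i \<in> E i"
    and slow: "\<And>n. norm (T n (\<Sum>i\<in>I. w i)) \<le> C * exp (a * real n)"
    and k: "k \<in> I" "w k \<noteq> 0"
  shows "\<phi> k \<le> a"
proof -
  define J where "J = {i\<in>I. w i \<noteq> 0}"
  have J: "finite J" "k \<in> J" "J \<subseteq> I" using fin k by (auto simp: J_def)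
  then have ne: "\<phi> ` J \<noteq> {}" "finite (\<phi> ` J)" by auto
  obtain l where l: "l \<in> J" "\<phi> l = Max (\<phi> ` J)" using Max_in [OF ne(2,1)] by auto
  have lmax: "\<phi> i < \<phi> l" if "i \<in> J - {l}" for i
  proof -
    have "\<phi> i \<le> \<phi> l" using that l ne by auto
    moreover have "\<phi> i \<noteq> \<phi> l" using that l J inj by (metis DiffE inj_onD insertCI subsetD)
    ultimately show ?thesis by simp
  qed
  have sum: "(\<Sum>i\<in>J. T n (w i)) = T n (\<Sum>i\<in>I. w i)" for n
  proof -
    have "(\<Sum>i\<in>J. w i) = (\<Sum>i\<in>I. w i)"
      using fin by (intro sum.mono_neutral_left) (auto simp: J_def)
    then show ?thesis using lin linear_sum by metis
  qed
  have "\<phi> l - e \<le> a" if e: "e > 0" for e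
  proof (rule exp_rate_le [of _ C])
    have "\<forall>\<^sub>F n in sequentially. exp ((\<phi> l - e) * real n) \<le> norm (\<Sum>i\<in>J. T n (w i))"
      by (rule largest_exponent_dominates [OF J(1) l(1)]) (use J lim w nz lmax e in \<open>auto simp: J_def\<close>)
    then show "\<forall>\<^sub>F n in sequentially. exp ((\<phi> l - e) * real n) \<le> C * exp (a * real n)"
      by (rule eventually_mono) (use slow sum in \<open>metis order_trans\<close>)
  qed
  then have "\<phi> l \<le> a" by (meson diff_le_eq field_le_epsilon)
  moreover have "\<phi> k \<le> \<phi> l" using l J ne by auto
  ultimately show ?thesis by simp
qed

text \<open>The part of the definition of Lyapunov exponents that concerns a single point.\<close>

definition oseledets_at ::
    "('a \<Rightarrow> int \<Rightarrow> real^'m^'m) \<Rightarrow> 'a \<Rightarrow> real list \<Rightarrow> (real \<Rightarrow> (real^'m) set) \<Rightarrow> bool" where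
  "oseledets_at A x chis E \<longleftrightarrow> direct_sum_decomposition (set chis) E \<and>
     (\<forall>c\<in>set chis. dim (E c) = count_list chis c \<and>
        (\<forall>v\<in>E c. v \<noteq> 0 \<longrightarrow>
           ((\<lambda>n. ln (norm (A x n *v v)) / real_of_int n) \<longlongrightarrow> c) at_top \<and>
           ((\<lambda>n. ln (norm (A x n *v v)) / real_of_int n) \<longlongrightarrow> c) at_bot))"

lemma oseledets_at_limits:
  assumes "oseledets_at A x chis E" "c \<in> set chis" "v \<in> E c" "v \<noteq> 0"
  shows "(\<lambda>n. ln (norm (A x (int n) *v v)) / real n) \<longlonglongrightarrow> c"
    and "(\<lambda>n. ln (norm (reverse_cocycle A x (int n) *v v)) / real n) \<longlonglongrightarrow> - c"
proof -
  have top: "((\<lambda>n. ln (norm (A x n *v v)) / real_of_int n) \<longlongrightarrow> c) at_top"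
    and bot: "((\<lambda>n. ln (norm (A x n *v v)) / real_of_int n) \<longlongrightarrow> c) at_bot"
    using assms unfolding oseledets_at_def by blast+
  show "(\<lambda>n. ln (norm (A x (int n) *v v)) / real n) \<longlonglongrightarrow> c"
    using filterlim_compose [OF top filterlim_int_sequentially] by simp
  have "filterlim (\<lambda>n. - int n) at_bot sequentially"
  proof (unfold filterlim_at_bot, intro allI)
    fix Z :: int
    show "\<forall>\<^sub>F n in sequentially. - int n \<le> Z"
      using eventually_ge_at_top [of "nat (- Z)"] by eventually_elim linarith
  qed
  from tendsto_minus [OF filterlim_compose [OF bot this]]
  show "(\<lambda>n. ln (norm (reverse_cocycle A x (int n) *v v)) / real n) \<longlonglongrightarrow> - c"
    by (simp add: reverse_cocycle_def)
qed

lemma (in cocycle) dim_slow_space_ge: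
  assumes "oseledets_at A x chis E"
  shows "length (filter (\<lambda>c. c < a) chis) \<le> dim (slow_space A x a)"
    and "length (filter (\<lambda>c. - c < a) chis) \<le> dim (slow_space (reverse_cocycle A) x a)"
proof -
  have ind: "independent_subspaces (set chis) E"
    using assms by (simp add: oseledets_at_def direct_sum_decomposition_iff)
  have *: "length (filter P chis) \<le> dim S"
    if S: "subspace S" "\<And>c. c \<in> set chis \<Longrightarrow> P c \<Longrightarrow> E c \<subseteq> S" for P S
  proof -
    let ?J = "set (filter P chis)"
    have "dim (span (\<Union>c\<in>?J. E c)) = (\<Sum>c\<in>?J. dim (E c))"
      using independent_subspaces_subset [OF ind, of ?J]
      by (intro dim_independent_subspaces) auto
    also have "\<dots> = (\<Sum>c\<in>?J. count_list (filter P chis) c)"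
    proof (rule sum.cong [OF refl])
      fix c assume "c \<in> ?J"
      then have "dim (E c) = count_list chis c" "P c" using assms by (auto simp: oseledets_at_def)
      moreover have "count_list (filter P xs) c = count_list xs c" if "P c" for xs
        using that by (induction xs) auto
      ultimately show "dim (E c) = count_list (filter P chis) c" by simp
    qed
    also have "\<dots> = length (filter P chis)" by (simp add: sum_count_set)
    finally have "length (filter P chis) = dim (span (\<Union>c\<in>?J. E c))" by simp
    also have "\<dots> \<le> dim S" using S by (intro dim_subset span_minimal) auto
    finally show ?thesis .
  qed
  have **: "v \<in> slow_space B x a"
    if "c < a" "v \<noteq> 0 \<Longrightarrow> (\<lambda>n. ln (norm (B x (int n) *v v)) / real n) \<longlonglongrightarrow> c"
      "\<And>n. v \<noteq> 0 \<Longrightarrow> B x (int n) *v v \<noteq> 0" for B v c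
  proof (cases "v = 0")
    case True
    then show ?thesis using subspace_0 [OF subspace_slow_space] by simp
  next
    case False
    have "\<forall>\<^sub>F n in sequentially. norm (B x (int n) *v v) \<le> exp ((c + (a - c)) * real n)"
      by (rule eventually_mono [OF exponent_bounds [OF that(2), where e = "a - c"]])
        (use that False in auto)
    then show ?thesis unfolding slow_space_def
      using eventual_exp_bound_imp_bound [of "\<lambda>n. B x (int n) *v v" a] by auto
  qed
  show "length (filter (\<lambda>c. c < a) chis) \<le> dim (slow_space A x a)"
    by (rule * [OF subspace_slow_space])
      (use ** oseledets_at_limits(1) [OF assms] at_nonzero in blast)
  show "length (filter (\<lambda>c. - c < a) chis) \<le> dim (slow_space (reverse_cocycle A) x a)"
    by (rule * [OF subspace_slow_space])
      (use ** oseledets_at_limits(2) [OF assms] cocycle.at_nonzero [OF cocycle_reverse] in blast)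
qed

text \<open>The forward rate of a vector is the largest exponent among its Oseledets components, the backward
  rate is minus the smallest one.\<close>

lemma (in cocycle) slow_spaces_transversal:
  assumes O: "oseledets_at A x chis E" and ab: "a < b"
  shows "slow_space A x a \<inter> slow_space (reverse_cocycle A) x (- b) = {0}"
proof (intro equalityI subsetI)
  fix v assume v: "v \<in> slow_space A x a \<inter> slow_space (reverse_cocycle A) x (- b)"
  have dec: "direct_sum_decomposition (set chis) E" using O by (simp add: oseledets_at_def)
  then obtain w where w: "w \<in> Pi\<^sub>E (set chis) E" "v = (\<Sum>c\<in>set chis. w c)"
    unfolding direct_sum_decomposition_def by blast
  have "w c = 0" if c: "c \<in> set chis" for c
  proof (rule ccontr)
    assume nz: "w c \<noteq> 0"
    obtain C D where C: "\<And>n. norm (A x (int n) *v v) \<le> C * exp (a * real n)"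
      and D: "\<And>n. norm (reverse_cocycle A x (int n) *v v) \<le> D * exp (- b * real n)"
      using v unfolding slow_space_def by blast
    have "c \<le> a"
      by (rule components_of_slow_vector [where T = "\<lambda>n v. A x (int n) *v v" and \<phi> = "\<lambda>c. c"
            and I = "set chis" and E = E and w = w and C = C])
        (use w c nz C at_nonzero oseledets_at_limits(1) [OF O] in auto)
    moreover have "- c \<le> - b"
      by (rule components_of_slow_vector [where T = "\<lambda>n v. reverse_cocycle A x (int n) *v v"
            and \<phi> = uminus and I = "set chis" and E = E and w = w and C = D])
        (use w c nz D cocycle.at_nonzero [OF cocycle_reverse] oseledets_at_limits(2) [OF O] in auto)
    ultimately show False using ab by simp
  qed
  then show "v \<in> {0}" using w by simp
qed (auto simp: subspace_0 subspace_slow_space)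

section \<open>Growth decomposition of a single matrix\<close>

text \<open>Here \<open>T'\<close> is meant to be the inverse of \<open>T\<close>; then the space consists of the vectors on which all
  powers of \<open>T\<close>, positive and negative, grow with exact rate \<open>c\<close>. For a complex matrix it is the sum of
  the generalized eigenspaces for the eigenvalues of modulus \<open>exp c\<close>.\<close>

definition growth_space ::
    "('v \<Rightarrow> 'v) \<Rightarrow> ('v \<Rightarrow> 'v) \<Rightarrow> real \<Rightarrow> 'v::real_normed_vector set" where
  "growth_space T T' c = {v. \<forall>e>0.
     (\<exists>C. \<forall>n. norm ((T ^^ n) v) \<le> C * exp ((c + e) * real n)) \<and>
     (\<exists>C. \<forall>n. norm ((T' ^^ n) v) \<le> C * exp ((- c + e) * real n))}"

lemma growth_spaceD:
  assumes "v \<in> growth_space T T' c" "e > 0"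
  obtains C where "C \<ge> 0" "\<And>n. norm ((T ^^ n) v) \<le> C * exp ((c + e) * real n)"
    "\<And>n. norm ((T' ^^ n) v) \<le> C * exp ((- c + e) * real n)"
proof -
  obtain C D where C: "\<And>n. norm ((T ^^ n) v) \<le> C * exp ((c + e) * real n)"
    and D: "\<And>n. norm ((T' ^^ n) v) \<le> D * exp ((- c + e) * real n)"
    using assms unfolding growth_space_def by blast
  have "0 \<le> C" using order_trans [OF norm_ge_zero C [of 0]] by simp
  then have "0 \<le> max C D" by simp
  moreover have "norm ((T ^^ n) v) \<le> max C D * exp ((c + e) * real n)"
    "norm ((T' ^^ n) v) \<le> max C D * exp ((- c + e) * real n)" for n
    by (rule order_trans [OF C] order_trans [OF D]; simp)+
  ultimately show ?thesis using that by blast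
qed

text \<open>The constant \<open>D\<close> is chosen such that \<open>exp y * D + C \<le> D * exp (y + e)\<close>, which makes the bound
  inductive.\<close>

lemma linear_recursion_bound:
  fixes a :: "nat \<Rightarrow> real"
  assumes rec: "\<And>n. a (Suc n) \<le> exp y * a n + C * exp ((y + e) * real n)" and e: "e > 0"
  shows "\<exists>D. \<forall>n. a n \<le> D * exp ((y + e) * real n)"
proof -
  define D where "D = max (a 0) (C / (exp (y + e) - exp y))"
  have pos: "exp (y + e) - exp y > 0" using e by simp
  have "C / (exp (y + e) - exp y) \<le> D" by (simp add: D_def)
  then have C: "C \<le> D * (exp (y + e) - exp y)" using pos by (simp add: pos_divide_le_eq)
  have "a n \<le> D * exp ((y + e) * real n)" for n
  proof (induction n)
    case 0
    then show ?case by (simp add: D_def)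
  next
    case (Suc n)
    have "a (Suc n) \<le> exp y * (D * exp ((y + e) * real n)) + C * exp ((y + e) * real n)"
      by (rule order_trans [OF rec add_right_mono]) (intro mult_left_mono Suc, simp)
    also have "\<dots> \<le> exp y * (D * exp ((y + e) * real n)) +
        D * (exp (y + e) - exp y) * exp ((y + e) * real n)"
      using C by (intro add_left_mono mult_right_mono) auto
    also have "\<dots> = D * (exp (y + e) * exp ((y + e) * real n))" by (simp add: algebra_simps)
    also have "exp (y + e) * exp ((y + e) * real n) = exp ((y + e) * real (Suc n))"
      by (simp add: exp_add [symmetric] algebra_simps)
    finally show ?case .
  qed
  then show ?thesis by blast
qed

lemma norm_vector_scalar_mult: "norm (c *s v) = norm c * norm (v :: complex^'m)"
  by (simp add: norm_vec_def norm_mult L2_set_right_distrib)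

locale complex_automorphism =
  fixes T T' :: "complex^'m \<Rightarrow> complex^'m"
  assumes lin: "linear T" and lin': "linear T'"
    and inv: "T (T' v) = v" and inv': "T' (T v) = v"
    and scale: "T (c *s v) = c *s T v"
begin

lemma scale': "T' (c *s v) = c *s T' v"
  by (metis inv inv' scale)

lemma linear_vector_scale: "linear (\<lambda>v::complex^'m. c *s v)"
  by (rule linearI) (auto simp: vec_eq_iff algebra_simps)

lemma linear_shift: "linear (\<lambda>v. T v - c *s v)"
  by (intro linear_compose_sub lin linear_vector_scale)

lemma linear_power: "linear (T ^^ n)" "linear (T' ^^ n)"
  by (induction n) (auto intro: linear_compose lin lin' simp: linear_id)

lemma scale_power: "(T ^^ n) (c *s v) = c *s (T ^^ n) v" "(T' ^^ n) (c *s v) = c *s (T' ^^ n) v"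
  by (induction n) (auto simp: scale scale')

lemma subspace_growth_space: "subspace (growth_space T T' c)"
proof -
  have "growth_space T T' c = (\<Inter>e\<in>{0<..}.
      {v. \<exists>C. \<forall>n. norm ((T ^^ n) v) \<le> C * exp ((c + e) * real n)} \<inter>
      {v. \<exists>C. \<forall>n. norm ((T' ^^ n) v) \<le> C * exp ((- c + e) * real n)})"
    unfolding growth_space_def by auto
  also have "subspace \<dots>"
    by (intro subspace_Inter subspace_inter, clarify)
      (intro subspace_inter subspace_bounded_growth linear_power)
  finally show ?thesis .
qed

lemma growth_space_commuting:
  assumes S: "linear S" "\<And>v. S (T v) = T (S v)" "\<And>v. S (T' v) = T' (S v)"
    and v: "v \<in> growth_space T T' c"
  shows "S v \<in> growth_space T T' c"
proof (unfold growth_space_def, intro CollectI allI impI)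
  fix e :: real assume e: "e > 0"
  obtain K where K: "\<And>v. norm (S v) \<le> norm v * K" "K \<ge> 0"
    using S(1) linear_bounded_pos [OF S(1)] by (metis less_imp_le mult.commute)
  obtain C where C: "\<And>n. norm ((T ^^ n) v) \<le> C * exp ((c + e) * real n)"
    "\<And>n. norm ((T' ^^ n) v) \<le> C * exp ((- c + e) * real n)" using growth_spaceD [OF v e] by metis
  have com: "(T ^^ n) (S v) = S ((T ^^ n) v)" "(T' ^^ n) (S v) = S ((T' ^^ n) v)" for n
    by (induction n) (auto simp: S)
  have "norm (S ((T ^^ n) v)) \<le> (C * K) * exp ((c + e) * real n)" for n
    using K(1) [of "(T ^^ n) v"] mult_right_mono [OF C(1) K(2), of n] by (simp add: algebra_simps)
  moreover have "norm (S ((T' ^^ n) v)) \<le> (C * K) * exp ((- c + e) * real n)" for n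
    using K(1) [of "(T' ^^ n) v"] mult_right_mono [OF C(2) K(2), of n] by (simp add: algebra_simps)
  ultimately show "(\<exists>C. \<forall>n. norm ((T ^^ n) (S v)) \<le> C * exp ((c + e) * real n)) \<and>
      (\<exists>C. \<forall>n. norm ((T' ^^ n) (S v)) \<le> C * exp ((- c + e) * real n))"
    unfolding com by blast
qed

lemma eigenvector_growth:
  assumes v: "v \<in> growth_space T T' c" "v \<noteq> 0" and eig: "T v = \<rho> *s v" and \<rho>: "\<rho> \<noteq> 0"
  shows "c = ln (cmod \<rho>)"
proof -
  have eig': "T' v = inverse \<rho> *s v"
  proof -
    have "\<rho> *s T' v = v" using eig inv' [of v] scale' by simp
    then have "inverse \<rho> *s (\<rho> *s T' v) = inverse \<rho> *s v" by simp
    then show ?thesis using \<rho> by (simp add: vector_smult_assoc)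
  qed
  have pow: "(T ^^ n) v = (\<rho> ^ n) *s v" "(T' ^^ n) v = (inverse \<rho> ^ n) *s v" for n
    by (induction n) (auto simp: eig eig' scale scale' vector_smult_assoc mult.commute)
  have nv: "norm v > 0" using v by simp
  have cm: "cmod \<rho> ^ n = exp (ln (cmod \<rho>) * real n)" for n
    using \<rho> by (simp add: exp_of_nat2_mult)
  have 1: "ln (cmod \<rho>) \<le> c + e" if e: "e > 0" for e
  proof -
    obtain C where C: "\<And>n. norm ((T ^^ n) v) \<le> C * exp ((c + e) * real n)"
      using growth_spaceD [OF v(1) e] by metis
    have "exp (ln (cmod \<rho>) * real n) \<le> (C / norm v) * exp ((c + e) * real n)" for n
      using C [of n] nv by (simp add: pow norm_vector_scalar_mult norm_power cm field_simps)
    then show ?thesis by (rule exp_rate_le [OF always_eventually [OF allI]])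
  qed
  have 2: "- ln (cmod \<rho>) \<le> - c + e" if e: "e > 0" for e
  proof -
    obtain C where C: "\<And>n. norm ((T' ^^ n) v) \<le> C * exp ((- c + e) * real n)"
      using growth_spaceD [OF v(1) e] by metis
    have "exp (- ln (cmod \<rho>) * real n) \<le> (C / norm v) * exp ((- c + e) * real n)" for n
    proof -
      have "norm ((T' ^^ n) v) = exp (- ln (cmod \<rho>) * real n) * norm v"
        by (simp add: pow norm_vector_scalar_mult norm_power norm_inverse power_inverse cm exp_minus)
      then show ?thesis using C [of n] nv by (simp add: field_simps)
    qed
    then show ?thesis by (rule exp_rate_le [OF always_eventually [OF allI]])
  qed
  have "ln (cmod \<rho>) \<le> c" using 1 by (rule field_le_epsilon)
  moreover have "- ln (cmod \<rho>) \<le> - c" using 2 by (rule field_le_epsilon)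
  ultimately show ?thesis by simp
qed

text \<open>One step of a Jordan chain: if \<open>T v = \<rho> v + u\<close>, the norms of the iterates of \<open>v\<close>, forward and backward,
  satisfy a linear recursion with rate \<open>|\<rho>|\<close> and an inhomogeneity that grows at the same rate up to \<open>e\<close>.\<close>

lemma shift_preimage_growth:
  assumes u: "T v - \<rho> *s v \<in> growth_space T T' (ln (cmod \<rho>))" and \<rho>: "\<rho> \<noteq> 0"
  shows "v \<in> growth_space T T' (ln (cmod \<rho>))"
proof (unfold growth_space_def, intro CollectI allI impI)
  fix e :: real assume e: "e > 0"
  let ?c = "ln (cmod \<rho>)" and ?u = "T v - \<rho> *s v"
  obtain C where C: "\<And>n. norm ((T ^^ n) ?u) \<le> C * exp ((?c + e) * real n)"
    "\<And>n. norm ((T' ^^ n) ?u) \<le> C * exp ((- ?c + e) * real n)" using growth_spaceD [OF u e] by metis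
  have ex: "exp ?c = cmod \<rho>" "exp (- ?c) = inverse (cmod \<rho>)"
    using \<rho> by (simp_all add: exp_minus)
  have "\<exists>D. \<forall>n. norm ((T ^^ n) v) \<le> D * exp ((?c + e) * real n)"
  proof (rule linear_recursion_bound [OF _ e, where C = C])
    fix n
    have "(T ^^ Suc n) v = (T ^^ n) (\<rho> *s v + ?u)" by (simp add: funpow_swap1)
    also have "\<dots> = \<rho> *s (T ^^ n) v + (T ^^ n) ?u"
      by (simp only: linear_add [OF linear_power(1)] scale_power)
    finally have "norm ((T ^^ Suc n) v) \<le> cmod \<rho> * norm ((T ^^ n) v) + norm ((T ^^ n) ?u)"
      by (metis norm_triangle_ineq norm_vector_scalar_mult)
    then show "norm ((T ^^ Suc n) v) \<le> exp ?c * norm ((T ^^ n) v) + C * exp ((?c + e) * real n)"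
      using C(1) [of n] by (simp only: ex)
  qed
  moreover have "\<exists>D. \<forall>n. norm ((T' ^^ n) v) \<le> D * exp ((- ?c + e) * real n)"
  proof (rule linear_recursion_bound [OF _ e, where C = "exp (- ?c) * (C * exp (- ?c + e))"])
    fix n
    have "\<rho> *s T' v = v - T' ?u"
      using linear_diff [OF lin', of "T v" "\<rho> *s v"] by (simp add: inv' scale')
    then have "inverse \<rho> *s (\<rho> *s T' v) = inverse \<rho> *s (v - T' ?u)" by simp
    then have "T' v = inverse \<rho> *s (v - T' ?u)" using \<rho> by (simp add: vector_smult_assoc)
    then have "(T' ^^ Suc n) v = inverse \<rho> *s (T' ^^ n) (v - T' ?u)"
      by (simp only: funpow_Suc_right o_apply scale_power)
    also have "(T' ^^ n) (v - T' ?u) = (T' ^^ n) v - (T' ^^ Suc n) ?u"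
      by (simp only: linear_diff [OF linear_power(2)] funpow_Suc_right o_apply)
    finally have "norm ((T' ^^ Suc n) v) = exp (- ?c) * norm ((T' ^^ n) v - (T' ^^ Suc n) ?u)"
      by (simp only: norm_vector_scalar_mult norm_inverse ex)
    also have "\<dots> \<le> exp (- ?c) * (norm ((T' ^^ n) v) + C * exp ((- ?c + e) * real (Suc n)))"
      using C(2) [of "Suc n"] norm_triangle_ineq4 [of "(T' ^^ n) v" "(T' ^^ Suc n) ?u"]
      by (intro mult_left_mono) auto
    also have "exp ((- ?c + e) * real (Suc n)) = exp (- ?c + e) * exp ((- ?c + e) * real n)"
      unfolding exp_add [symmetric] by (simp add: algebra_simps)
    finally show "norm ((T' ^^ Suc n) v) \<le> exp (- ?c) * norm ((T' ^^ n) v) +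
        exp (- ?c) * (C * exp (- ?c + e)) * exp ((- ?c + e) * real n)"
      by (simp only: distrib_left mult.assoc)
  qed
  ultimately show "(\<exists>C. \<forall>n. norm ((T ^^ n) v) \<le> C * exp ((?c + e) * real n)) \<and>
      (\<exists>C. \<forall>n. norm ((T' ^^ n) v) \<le> C * exp ((- ?c + e) * real n))" ..
qed

definition growth_sum :: "(complex^'m) set" where
  "growth_sum = span (\<Union>c. growth_space T T' c)"

lemma growth_sum_commuting:
  assumes S: "linear S" "\<And>v. S (T v) = T (S v)" "\<And>v. S (T' v) = T' (S v)"
    and v: "v \<in> growth_sum"
  shows "S v \<in> growth_sum"
proof -
  have "S v \<in> S ` span (\<Union>c. growth_space T T' c)" using v by (simp add: growth_sum_def)
  also have "\<dots> = span (S ` (\<Union>c. growth_space T T' c))"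
    by (rule linear_span_image [OF S(1), symmetric])
  also have "\<dots> \<subseteq> growth_sum" unfolding growth_sum_def
    using growth_space_commuting [OF S] by (intro span_mono) auto
  finally show ?thesis .
qed

text \<open>On a growth space whose rate is not \<open>ln |\<rho>|\<close> the map \<open>T - \<rho>\<close> is injective by
  \<open>eigenvector_growth\<close>, hence surjective. So \<open>T - \<rho>\<close> reaches every sum of growth vectors up to a
  vector of rate \<open>ln |\<rho>|\<close>.\<close>

lemma shift_onto_growth_sum:
  assumes \<rho>: "\<rho> \<noteq> 0" and u: "u \<in> growth_sum"
  shows "\<exists>z\<in>growth_sum. T z - \<rho> *s z - u \<in> growth_space T T' (ln (cmod \<rho>))"
  using u unfolding growth_sum_def
proof (induction rule: span_induct_alt)
  case base
  have "T 0 - \<rho> *s 0 - 0 = 0" using linear_0 [OF lin] by simp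
  then show ?case
    by (intro bexI [of _ 0]) (simp_all add: span_zero subspace_0 [OF subspace_growth_space])
next
  case (step r u w)
  let ?F = "growth_space T T' (ln (cmod \<rho>))" and ?S = "\<lambda>v. T v - \<rho> *s v"
  obtain c where c: "u \<in> growth_space T T' c" using step by blast
  obtain z where z: "z \<in> growth_sum" "?S z - w \<in> ?F" using step by (auto simp: growth_sum_def)
  have "\<exists>y\<in>growth_sum. ?S y - u \<in> ?F"
  proof (cases "c = ln (cmod \<rho>)")
    case True
    have "?S 0 - u \<in> ?F"
      using c True linear_0 [OF lin] subspace_neg [OF subspace_growth_space] by simp
    then show ?thesis by (intro bexI [of _ 0]) (simp_all add: growth_sum_def span_zero)
  next
    case False
    let ?G = "growth_space T T' c"
    have inj: "inj_on ?S ?G"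
      unfolding linear_injective_on_subspace_0 [OF linear_shift subspace_growth_space]
      using eigenvector_growth \<rho> False by auto
    have "?S v \<in> ?G" if "v \<in> ?G" for v
      by (rule growth_space_commuting [OF linear_shift _ _ that])
        (simp_all add: linear_diff [OF lin] linear_diff [OF lin'] scale scale' inv inv')
    then have sub: "?S ` ?G \<subseteq> ?G" by blast
    have "span ?G = ?G" by (simp add: span_eq_iff subspace_growth_space)
    with inj have "inj_on ?S (span ?G)" by (simp only:)
    then have "dim (?S ` ?G) = dim ?G" by (rule dim_image_eq [OF linear_shift])
    then have "?S ` ?G = ?G"
      by (intro subspace_dim_equal [OF linear_subspace_image [OF linear_shift] _ sub])
        (simp_all add: subspace_growth_space)
    then have "u \<in> ?S ` ?G" by (simp only: c)
    then obtain y where y: "y \<in> ?G" "?S y = u" by blast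
    then have "y \<in> growth_sum" unfolding growth_sum_def by (intro span_base) auto
    moreover have "?S y - u \<in> ?F" using y subspace_0 [OF subspace_growth_space] by simp
    ultimately show ?thesis by blast
  qed
  then obtain y where y: "y \<in> growth_sum" "?S y - u \<in> ?F" by blast
  have "?S (r *\<^sub>R y + z) - (r *\<^sub>R u + w) = r *\<^sub>R (?S y - u) + (?S z - w)"
    using linear_add [OF linear_shift, of "r *\<^sub>R y" z] linear_cmul [OF linear_shift, of r y]
    by (simp add: scaleR_diff_right)
  also have "\<dots> \<in> ?F"
    using y z by (intro subspace_add subspace_scale subspace_growth_space)
  finally show ?case
    using y z unfolding growth_sum_def by (intro bexI [of _ "r *\<^sub>R y + z"]) (auto intro: span_add span_scale)
qed

lemma shift_preimage_growth_sum:
  assumes "T v - \<rho> *s v \<in> growth_sum"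
  shows "v \<in> growth_sum"
proof (cases "\<rho> = 0")
  case True
  then have "T v \<in> growth_sum" using assms by (simp add: vec_eq_iff)
  then have "T' (T v) \<in> growth_sum" 
    by (rule growth_sum_commuting [where S = T', rotated 3]) (simp_all add: lin' inv inv')
  then show ?thesis by (simp add: inv')
next
  case False
  obtain z where z: "z \<in> growth_sum"
    and d: "T z - \<rho> *s z - (T v - \<rho> *s v) \<in> growth_space T T' (ln (cmod \<rho>))"
    using shift_onto_growth_sum [OF False assms] by blast
  have shift: "T (z - v) - \<rho> *s (z - v) = T z - \<rho> *s z - (T v - \<rho> *s v)"
    using linear_diff [OF linear_shift, of z v] .
  have "z - v \<in> growth_space T T' (ln (cmod \<rho>))"
    by (rule shift_preimage_growth [OF _ False]) (simp only: shift d)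
  then have "z - v \<in> growth_sum" unfolding growth_sum_def by (intro span_base) auto
  with z have "z - (z - v) \<in> growth_sum" unfolding growth_sum_def by (rule span_diff)
  then show ?thesis by simp
qed

definition poly_act :: "complex poly \<Rightarrow> complex^'m \<Rightarrow> complex^'m" where
  "poly_act q v = (\<Sum>i\<le>degree q. coeff q i *s (T ^^ i) v)"

lemma poly_act_eq:
  assumes "degree q \<le> n"
  shows "poly_act q v = (\<Sum>i\<le>n. coeff q i *s (T ^^ i) v)"
  unfolding poly_act_def
  by (rule sum.mono_neutral_left) (use assms in \<open>auto simp: coeff_eq_0\<close>)

lemma poly_act_linear_factor: "poly_act ([:- \<rho>, 1:] * q) v = poly_act q (T v - \<rho> *s v)"
proof -
  let ?n = "Suc (degree q)"
  have "degree ([:- \<rho>, 1:] * q) \<le> ?n"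
    using degree_mult_le [of "[:- \<rho>, 1:]" q] by simp
  then have "poly_act ([:- \<rho>, 1:] * q) v
      = (\<Sum>i\<le>?n. coeff (pCons 0 q - smult \<rho> q) i *s (T ^^ i) v)"
    by (subst poly_act_eq [of _ ?n]) (simp_all add: algebra_simps)
  also have "\<dots> = (\<Sum>i\<le>?n. coeff (pCons 0 q) i *s (T ^^ i) v - (\<rho> * coeff q i) *s (T ^^ i) v)"
    by (intro sum.cong) (auto simp: vec_eq_iff algebra_simps)
  also have "\<dots> = (\<Sum>i\<le>?n. coeff (pCons 0 q) i *s (T ^^ i) v) - (\<Sum>i\<le>?n. (\<rho> * coeff q i) *s (T ^^ i) v)"
    by (rule sum_subtractf)
  also have "(\<Sum>i\<le>?n. coeff (pCons 0 q) i *s (T ^^ i) v) = (\<Sum>i\<le>degree q. coeff q i *s (T ^^ i) (T v))"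
    by (subst sum.atMost_Suc_shift) (simp add: funpow_swap1)
  also have "(\<Sum>i\<le>?n. (\<rho> * coeff q i) *s (T ^^ i) v) = (\<Sum>i\<le>degree q. coeff q i *s (T ^^ i) (\<rho> *s v))"
    by (simp add: coeff_eq_0 scale_power vector_smult_assoc mult.commute)
  finally show ?thesis
    unfolding poly_act_def sum_subtractf [symmetric]
    by (simp add: linear_diff [OF linear_power(1)] vec_eq_iff algebra_simps)
qed

lemma poly_act_0_imp_growth_sum:
  assumes "q \<noteq> 0" "poly_act q v = 0"
  shows "v \<in> growth_sum"
  using assms
proof (induction "degree q" arbitrary: q v)
  case 0
  then obtain a where a: "q = [:a:]" using degree_eq_zeroE by metis
  then have "a *s v = 0" "a \<noteq> 0" using 0 by (simp_all add: poly_act_def)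
  then have "v = 0" by (simp add: vec_eq_iff)
  then show ?case by (simp add: growth_sum_def span_zero)
next
  case (Suc n)
  then have "\<not> constant (poly q)" by (simp add: constant_degree)
  then obtain \<rho> where "poly q \<rho> = 0" using fundamental_theorem_of_algebra by blast
  then obtain r where r: "q = [:- \<rho>, 1:] * r" by (metis dvdE poly_eq_0_iff_dvd)
  then have "r \<noteq> 0" using Suc by auto
  then have "degree q = Suc (degree r)" unfolding r by (subst degree_mult_eq) auto
  moreover have "poly_act r (T v - \<rho> *s v) = 0" using Suc.prems r poly_act_linear_factor by simp
  ultimately have "T v - \<rho> *s v \<in> growth_sum" using Suc \<open>r \<noteq> 0\<close> by auto
  then show ?case by (rule shift_preimage_growth_sum)
qed

lemma annihilating_poly: "\<exists>q. q \<noteq> 0 \<and> poly_act q v = 0"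
proof -
  \<comment> \<open>The \<open>N + 1\<close> vectors \<open>v, T v, \<dots>\<close> are linearly dependent, or two of them coincide.\<close>
  define N where "N = DIM(complex^'m)"
  have "\<exists>c. (\<exists>i\<le>N. c i \<noteq> 0) \<and> (\<Sum>i\<le>N. c i *\<^sub>R (T ^^ i) v) = 0"
  proof (cases "inj_on (\<lambda>i. (T ^^ i) v) {..N}")
    case True
    let ?S = "(\<lambda>i. (T ^^ i) v) ` {..N}"
    have "card ?S = Suc N" using card_image [OF True] by simp
    then have "dependent ?S" by (intro dependent_biggerset) (simp add: N_def)
    then obtain u where u: "(\<Sum>w\<in>?S. u w *\<^sub>R w) = 0" "\<exists>w\<in>?S. u w \<noteq> 0"
      by (subst (asm) dependent_finite) auto
    then show ?thesis using True
      by (intro exI [of _ "\<lambda>i. u ((T ^^ i) v)"]) (auto simp: sum.reindex)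
  next
    case False
    then obtain i j where ij: "i \<le> N" "j \<le> N" "i \<noteq> j" "(T ^^ i) v = (T ^^ j) v"
      by (auto simp: inj_on_def)
    define c where "c k = (if k = i then 1 else if k = j then -1 else 0::real)" for k
    have "(\<Sum>k\<le>N. c k *\<^sub>R (T ^^ k) v) = (\<Sum>k\<in>{i,j}. c k *\<^sub>R (T ^^ k) v)"
      using ij by (intro sum.mono_neutral_right) (auto simp: c_def)
    also have "\<dots> = 0" using ij by (simp add: c_def)
    finally show ?thesis using ij by (intro exI [of _ c]) (auto simp: c_def)
  qed
  then obtain c k where c: "k \<le> N" "c k \<noteq> 0" "(\<Sum>i\<le>N. c i *\<^sub>R (T ^^ i) v) = 0" by blast
  define q where "q = (\<Sum>i\<le>N. monom (complex_of_real (c i)) i)"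
  have cf: "coeff q i = (if i \<le> N then complex_of_real (c i) else 0)" for i
    by (simp add: q_def coeff_sum sum.delta')
  have "coeff q k \<noteq> 0" using c by (simp add: cf)
  then have "q \<noteq> 0" by auto
  have "degree q \<le> N" by (intro degree_le) (simp add: cf)
  then have "poly_act q v = (\<Sum>i\<le>N. coeff q i *s (T ^^ i) v)" by (rule poly_act_eq)
  also have "\<dots> = (\<Sum>i\<le>N. c i *\<^sub>R (T ^^ i) v)"
    by (intro sum.cong) (auto simp: cf vec_eq_iff complex_eq_iff)
  finally have "poly_act q v = 0" using c by simp
  with \<open>q \<noteq> 0\<close> show ?thesis by blast
qed

lemma growth_sum_UNIV: "growth_sum = UNIV"
  using annihilating_poly poly_act_0_imp_growth_sum by blast

end

definition complexify :: "real^'m^'m \<Rightarrow> complex^'m \<Rightarrow> complex^'m" where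
  "complexify B v = map_matrix complex_of_real B *v v"

definition real_part :: "complex^'m \<Rightarrow> real^'m" where
  "real_part v = (\<chi> i. Re (v $ i))"

lemma complexify_complexify: "complexify B (complexify B' v) = complexify (B ** B') v"
proof -
  have "map_matrix complex_of_real B ** map_matrix complex_of_real B' = map_matrix complex_of_real (B ** B')"
    by (simp add: matrix_matrix_mult_def vec_eq_iff)
  then show ?thesis by (simp add: complexify_def matrix_vector_mul_assoc)
qed

lemma complexify_mat_1: "complexify (mat 1 :: real^'m^'m) v = v"
proof -
  have "map_matrix complex_of_real (mat 1 :: real^'m^'m) = mat 1" by (simp add: mat_def vec_eq_iff)
  then show ?thesis by (simp add: complexify_def)
qed

lemma linear_complexify: "linear (complexify B)"
  unfolding complexify_def by (rule matrix_vector_mul_linear)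

lemma complexify_scale: "complexify B (c *s v) = c *s complexify B v"
  unfolding complexify_def by (rule vector_scalar_commute)

lemma real_part_complexify: "real_part (complexify B v) = B *v real_part v"
  by (simp add: real_part_def complexify_def vec_eq_iff matrix_vector_mult_def)

lemma linear_real_part: "linear real_part"
  by (rule linearI) (simp_all add: real_part_def vec_eq_iff)

lemma norm_real_part_le: "norm (real_part v) \<le> norm v"
  unfolding norm_vec_def by (rule L2_set_mono) (simp_all add: real_part_def abs_Re_le_cmod)

text \<open>A real vector is the real part of its decomposition over the complex numbers; taking real parts
  commutes with real matrices and does not increase norms.\<close>

lemma span_growth_spaces_real:
  fixes B B' :: "real^'m^'m"
  assumes "B ** B' = mat 1" "B' ** B = mat 1"
  shows "span (\<Union>c. growth_space ((*v) B) ((*v) B') c) = UNIV"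
proof -
  interpret complex_automorphism "complexify B" "complexify B'"
    by (rule complex_automorphism.intro)
      (simp_all add: linear_complexify complexify_scale complexify_complexify complexify_mat_1 assms)
  have pow: "((*v) B ^^ n) (real_part v) = real_part ((complexify B ^^ n) v)"
    "((*v) B' ^^ n) (real_part v) = real_part ((complexify B' ^^ n) v)" for n v
    by (induction n) (simp_all add: real_part_complexify)
  have "real_part v \<in> growth_space ((*v) B) ((*v) B') c"
    if v: "v \<in> growth_space (complexify B) (complexify B') c" for v c
    using v unfolding growth_space_def pow mem_Collect_eq by (meson norm_real_part_le order_trans)
  then have "real_part ` span (\<Union>c. growth_space (complexify B) (complexify B') c)
      \<subseteq> span (\<Union>c. growth_space ((*v) B) ((*v) B') c)"
    unfolding linear_span_image [OF linear_real_part, symmetric] by (intro span_mono) auto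
  moreover have "surj (real_part :: complex^'m \<Rightarrow> real^'m)"
    by (rule surjI [where f = "\<lambda>v. \<chi> i. complex_of_real (v $ i)"]) (simp add: real_part_def)
  ultimately show ?thesis
    using growth_sum_UNIV by (simp add: growth_sum_def top.extremum_unique)
qed

section \<open>Lyapunov exponents at a periodic point\<close>

context cocycle
begin

text \<open>Defined by growth of the cocycle over all integer times rather than by the powers of the matrix
  of one period, so that the equivariance under the cocycle is immediate and base points along
  the orbit are treated alike.\<close>

definition exponent_space :: "'a \<Rightarrow> real \<Rightarrow> (real^'m) set" where
  "exponent_space x c = {v. \<forall>e>0. \<exists>C. \<forall>n. norm (A x n *v v) \<le> C * exp (c * real_of_int n + e * \<bar>real_of_int n\<bar>)}"

lemma exponent_spaceD:
  assumes "v \<in> exponent_space x c" "e > 0"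
  obtains C where "C \<ge> 0" "\<And>n. norm (A x n *v v) \<le> C * exp (c * real_of_int n + e * \<bar>real_of_int n\<bar>)"
proof -
  obtain C where C: "\<And>n. norm (A x n *v v) \<le> C * exp (c * real_of_int n + e * \<bar>real_of_int n\<bar>)"
    using assms unfolding exponent_space_def by blast
  have "0 \<le> C" using order_trans [OF norm_ge_zero C [of 0]] by simp
  then show ?thesis using C that by blast
qed

lemma subspace_exponent_space: "subspace (exponent_space x c)"
proof -
  have "exponent_space x c = (\<Inter>e\<in>{0<..}.
      {v. \<exists>C. \<forall>n. norm (A x n *v v) \<le> C * exp (c * real_of_int n + e * \<bar>real_of_int n\<bar>)})"
    unfolding exponent_space_def by auto
  also have "subspace \<dots>"
    by (intro subspace_Inter, clarify) (intro subspace_bounded_growth matrix_vector_mul_linear)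
  finally show ?thesis .
qed

lemma exponent_space_mono_image:
  assumes v: "v \<in> exponent_space x c"
  shows "A x k *v v \<in> exponent_space (iterate f k x) c"
proof (unfold exponent_space_def, intro CollectI allI impI)
  fix e :: real assume e: "e > 0"
  obtain C where C: "C \<ge> 0" "\<And>n. norm (A x n *v v) \<le> C * exp (c * real_of_int n + e * \<bar>real_of_int n\<bar>)"
    using exponent_spaceD [OF v e] by metis
  let ?K = "C * exp (c * real_of_int k + e * \<bar>real_of_int k\<bar>)"
  have "norm (A (iterate f k x) n *v (A x k *v v))
      \<le> ?K * exp (c * real_of_int n + e * \<bar>real_of_int n\<bar>)" for n
  proof -
    have tri: "e * \<bar>real_of_int (n + k)\<bar> \<le> e * \<bar>real_of_int n\<bar> + e * \<bar>real_of_int k\<bar>"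
      using e by (simp add: distrib_left [symmetric] mult_left_mono)
    have "norm (A x (n + k) *v v) \<le> C * exp (c * real_of_int (n + k) + e * \<bar>real_of_int (n + k)\<bar>)"
      by (rule C)
    also have "\<dots> \<le> C * exp ((c * real_of_int k + e * \<bar>real_of_int k\<bar>) + (c * real_of_int n + e * \<bar>real_of_int n\<bar>))"
      using C(1) tri by (intro mult_left_mono) (simp_all add: distrib_left)
    finally show ?thesis by (simp only: at_add exp_add mult.assoc)
  qed
  then show "\<exists>C. \<forall>n. norm (A (iterate f k x) n *v (A x k *v v)) \<le>
      C * exp (c * real_of_int n + e * \<bar>real_of_int n\<bar>)" by blast
qed

lemma exponent_space_image: "(*v) (A x k) ` exponent_space x c = exponent_space (iterate f k x) c"
proof (intro equalityI subsetI)
  fix w assume w: "w \<in> exponent_space (iterate f k x) c"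
  have "iterate f (- k) (iterate f k x) = x" using iterate_add [OF bij, of "- k" k x] by simp
  then have "A (iterate f k x) (- k) *v w \<in> exponent_space x c"
    using exponent_space_mono_image [OF w, of "- k"] by simp
  then have "A x k *v (A (iterate f k x) (- k) *v w) \<in> (*v) (A x k) ` exponent_space x c" by blast
  then show "w \<in> (*v) (A x k) ` exponent_space x c" by simp
qed (use exponent_space_mono_image in blast)

context
  fixes p N assumes N: "N > 0" and per: "(f ^^ N) p = p"
begin

lemma iterate_period: "iterate f (n + int N * k) p = iterate f n p"
proof (induction k rule: int_induct [where k = 0])
  case (step1 i)
  have "iterate f (n + int N * (i + 1)) p = iterate f (n + int N * i) (iterate f (int N) p)"
    by (simp add: iterate_add [OF bij, symmetric] algebra_simps)
  then show ?case using step1 per by (simp add: iterate_of_nat)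
next
  case (step2 i)
  have "iterate f (n + int N * i) p = iterate f (n + int N * (i - 1)) (iterate f (int N) p)"
    by (simp add: iterate_add [OF bij, symmetric] algebra_simps)
  then show ?case using step2 per by (simp add: iterate_of_nat)
qed simp

lemma finite_integer_orbit: "finite (range (\<lambda>n. iterate f n p))"
proof -
  have "iterate f n p \<in> (\<lambda>n. iterate f n p) ` {0..<int N}" for n
  proof
    show "n mod int N \<in> {0..<int N}" using N by simp
    show "iterate f n p = iterate f (n mod int N) p"
      using iterate_period [of "n mod int N" "n div int N"] by (simp add: algebra_simps)
  qed
  then have "range (\<lambda>n. iterate f n p) \<subseteq> (\<lambda>n. iterate f n p) ` {0..<int N}" by blast
  then show ?thesis by (rule finite_subset) simp
qed

lemma multiple_period: "iterate f (int N * k) p = p"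
  using iterate_period [of 0 k] by simp

text \<open>The lower bound is the upper bound for the way back from \<open>f\<^sup>n x\<close> to \<open>x\<close>, whose constant is the same
  for all \<open>n\<close> because the orbit is finite.\<close>

lemma exponent_space_two_sided:
  assumes v: "v \<in> exponent_space (iterate f j p) c" "v \<noteq> 0" and e: "e > 0"
  obtains D where "\<And>n. \<bar>ln (norm (A (iterate f j p) n *v v)) - c * real_of_int n\<bar> \<le> D + e * \<bar>real_of_int n\<bar>"
proof -
  let ?x = "iterate f j p" and ?O = "range (\<lambda>n. iterate f n p)"
  let ?g = "\<lambda>n. exp (c * real_of_int n + e * \<bar>real_of_int n\<bar>)"
  have "\<exists>C>0. \<forall>n. \<forall>v\<in>exponent_space y c. norm (A y n *v v) \<le> C * ?g n * norm v" for y
  proof (rule pointwise_bounds_uniform_on_subspace [OF subspace_exponent_space [of y c], of "\<lambda>n v. A y n *v v" ?g])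
    show "\<exists>C. \<forall>n. norm (A y n *v v) \<le> C * ?g n" if "v \<in> exponent_space y c" for v
      using exponent_spaceD [OF that e] by metis
  qed (blast | simp)+
  then obtain C where C: "\<And>y. C y > 0"
    "\<And>y n v. v \<in> exponent_space y c \<Longrightarrow> norm (A y n *v v) \<le> C y * ?g n * norm v" by metis
  define K where "K = Max (C ` ?O)"
  have K: "C (iterate f n p) \<le> K" for n
    unfolding K_def using finite_integer_orbit by (intro Max_ge) auto
  have Kpos: "K > 0" using K [of 0] C(1) [of "iterate f 0 p"] by linarith
  have bound: "norm (A (iterate f n p) k *v w) \<le> K * ?g k * norm w"
    if "w \<in> exponent_space (iterate f n p) c" for n k w
  proof -
    have "norm (A (iterate f n p) k *v w) \<le> C (iterate f n p) * ?g k * norm w" by (rule C(2) [OF that])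
    also have "\<dots> \<le> K * ?g k * norm w" using K by (intro mult_right_mono) auto
    finally show ?thesis .
  qed
  define D where "D = ln K + \<bar>ln (norm v)\<bar>"
  have "\<bar>ln (norm (A ?x n *v v)) - c * real_of_int n\<bar> \<le> D + e * \<bar>real_of_int n\<bar>" for n
  proof -
    let ?w = "A ?x n *v v"
    have w: "?w \<noteq> 0" using v(2) by (rule at_nonzero)
    have "norm ?w \<le> K * ?g n * norm v" by (rule bound [OF v(1)])
    then have "ln (norm ?w) \<le> ln (K * ?g n * norm v)" using w Kpos v(2) by (subst ln_le_cancel_iff) auto
    also have "\<dots> = ln K + (c * real_of_int n + e * \<bar>real_of_int n\<bar>) + ln (norm v)"
      using Kpos v(2) by (simp add: ln_mult)
    finally have up: "ln (norm ?w) \<le> ln K + (c * real_of_int n + e * \<bar>real_of_int n\<bar>) + ln (norm v)" .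
    have "?w \<in> exponent_space (iterate f (n + j) p) c"
      using exponent_space_mono_image [OF v(1), of n] by (simp add: iterate_add [OF bij])
    then have "norm (A (iterate f (n + j) p) (- n) *v ?w) \<le> K * ?g (- n) * norm ?w" by (rule bound)
    also have "A (iterate f (n + j) p) (- n) *v ?w = v"
      by (simp add: iterate_add [OF bij])
    finally have "ln (norm v) \<le> ln (K * ?g (- n) * norm ?w)"
      using w Kpos v(2) by (subst ln_le_cancel_iff) auto
    also have "\<dots> = ln K + (- c * real_of_int n + e * \<bar>real_of_int n\<bar>) + ln (norm ?w)"
      using Kpos w by (simp add: ln_mult)
    finally show ?thesis using up unfolding D_def by linarith
  qed
  then show ?thesis using that by blast
qed

lemma exponent_space_limits:
  assumes v: "v \<in> exponent_space (iterate f j p) c" "v \<noteq> 0"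
    and F: "filterlim (\<lambda>n. \<bar>real_of_int n\<bar>) at_top F"
  shows "((\<lambda>n. ln (norm (A (iterate f j p) n *v v)) / real_of_int n) \<longlongrightarrow> c) F"
proof (rule tendstoI)
  fix e :: real assume e: "e > 0"
  then have e2: "e / 2 > 0" by simp
  let ?l = "\<lambda>n. ln (norm (A (iterate f j p) n *v v))"
  obtain D where D: "\<And>n. \<bar>?l n - c * real_of_int n\<bar> \<le> D + e / 2 * \<bar>real_of_int n\<bar>"
    using exponent_space_two_sided [OF v e2] by metis
  have "\<forall>\<^sub>F n in F. \<bar>real_of_int n\<bar> > max 0 (2 * D / e)"
    using F unfolding filterlim_at_top_dense by blast
  then show "\<forall>\<^sub>F n in F. dist (?l n / real_of_int n) c < e"
  proof eventually_elim
    case (elim n)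
    then have n: "\<bar>real_of_int n\<bar> > 0" "D < e / 2 * \<bar>real_of_int n\<bar>"
      using e by (auto simp: field_simps)
    have "\<bar>?l n - c * real_of_int n\<bar> < e * \<bar>real_of_int n\<bar>" using D [of n] n by (simp add: field_simps)
    then have "\<bar>?l n - c * real_of_int n\<bar> / \<bar>real_of_int n\<bar> < e" using n by (simp add: divide_less_eq)
    also have "\<bar>?l n - c * real_of_int n\<bar> / \<bar>real_of_int n\<bar> = \<bar>?l n / real_of_int n - c\<bar>"
      using n unfolding abs_divide [symmetric] by (simp add: diff_divide_distrib)
    finally show ?case by (simp add: dist_real_def)
  qed
qed

text \<open>The zero vector satisfies every growth bound, whereas a sum with nonzero components would
  inherit their largest exponent.\<close>

lemma exponent_spaces_independent:
  assumes "finite I"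
  shows "independent_subspaces I (exponent_space (iterate f j p))"
proof (unfold independent_subspaces_def, intro conjI ballI allI impI)
  fix w k assume w: "\<forall>i\<in>I. w i \<in> exponent_space (iterate f j p) i" "(\<Sum>i\<in>I. w i) = 0" and k: "k \<in> I"
  let ?x = "iterate f j p"
  have top: "filterlim (\<lambda>n. \<bar>real_of_int (int n)\<bar>) at_top sequentially"
    by (simp add: filterlim_real_sequentially)
  show "w k = 0"
  proof (rule ccontr)
    assume nz: "w k \<noteq> 0"
    have "k \<le> k - 1"
    proof (rule components_of_slow_vector [where T = "\<lambda>n v. A ?x (int n) *v v" and \<phi> = "\<lambda>c. c"
          and I = I and E = "exponent_space ?x" and w = w and C = 0])
      fix i v assume "i \<in> I" "v \<in> exponent_space ?x i" "v \<noteq> 0"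
      then have "((\<lambda>n. ln (norm (A ?x n *v v)) / real_of_int n) \<longlongrightarrow> i) (filtermap int sequentially)"
        by (intro exponent_space_limits) (use top in \<open>simp_all add: filterlim_filtermap\<close>)
      then show "(\<lambda>n. ln (norm (A ?x (int n) *v v)) / real n) \<longlonglongrightarrow> i"
        by (simp add: filterlim_filtermap)
    qed (use assms w k nz at_nonzero in auto)
    then show False by simp
  qed
qed (rule subspace_exponent_space)

lemma matrix_power_cocycle:
  "((*v) (A p (int N)) ^^ n) v = A p (int N * int n) *v v"
  "((*v) (A p (- int N)) ^^ n) v = A p (- int N * int n) *v v"
proof -
  have pos: "iterate f (int N * int n) p = p" and neg: "iterate f (- int N * int n) p = p" for n
    using multiple_period [of "int n"] multiple_period [of "- int n"] by simp_all
  show "((*v) (A p (int N)) ^^ n) v = A p (int N * int n) *v v"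
  proof (induction n)
    case (Suc n)
    have "A p (int N + int N * int n) *v v = A p (int N) *v (A p (int N * int n) *v v)"
      using at_add [of p "int N" "int N * int n" v] by (simp only: pos)
    then show ?case using Suc by (simp add: algebra_simps)
  qed simp
  show "((*v) (A p (- int N)) ^^ n) v = A p (- int N * int n) *v v"
  proof (induction n)
    case (Suc n)
    have "A p (- int N + - int N * int n) *v v = A p (- int N) *v (A p (- int N * int n) *v v)"
      using at_add [of p "- int N" "- int N * int n" v] by (simp only: neg)
    then show ?case using Suc by (simp add: algebra_simps)
  qed simp
qed

lemma growth_space_subset_exponent_space:
  "growth_space ((*v) (A p (int N))) ((*v) (A p (- int N))) c \<subseteq> exponent_space p (c / real N)"
proof
  fix v assume v: "v \<in> growth_space ((*v) (A p (int N))) ((*v) (A p (- int N))) c"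
  let ?c = "c / real N"
  show "v \<in> exponent_space p ?c"
  proof (unfold exponent_space_def, intro CollectI allI impI)
    fix e :: real assume e: "e > 0"
    then have "e * real N > 0" using N by simp
    from growth_spaceD [OF v this] obtain C where C: "C \<ge> 0"
      "\<And>n. norm (A p (int N * int n) *v v) \<le> C * exp ((c + e * real N) * real n)"
      "\<And>n. norm (A p (- int N * int n) *v v) \<le> C * exp ((- c + e * real N) * real n)"
      unfolding matrix_power_cocycle by metis
    have Cq: "norm (A p (int N * q) *v v) \<le> C * exp (c * real_of_int q + e * real N * \<bar>real_of_int q\<bar>)" for q
    proof (cases "q \<ge> 0")
      case True
      then show ?thesis using C(2) [of "nat q"] by (simp add: algebra_simps)
    next
      case False
      then show ?thesis using C(3) [of "nat (- q)"] by (simp add: algebra_simps)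
    qed
    have "\<exists>K. \<forall>w. norm (A p j *v w) \<le> K * norm w" for j
      using linear_bounded [OF matrix_vector_mul_linear] by blast
    then obtain B where B: "\<And>j w. norm (A p j *v w) \<le> B j * norm w" by metis
    define K where "K = Max (B ` {0..<int N})"
    have "B j \<le> K" if "j \<in> {0..<int N}" for j
      unfolding K_def using that by (intro Max_ge) auto
    then have K: "norm (A p j *v w) \<le> K * norm w" if "j \<in> {0..<int N}" for j w
      using B that by (meson mult_right_mono norm_ge_zero order_trans)
    have "norm (A p 0 *v axis undefined 1) \<le> K * norm (axis undefined (1::real) :: real^'m)"
      using K [of 0 "axis undefined 1"] N by simp
    then have K1: "K \<ge> 1" by (simp add: norm_axis_1)
    define D where "D = K * C * exp (\<bar>c\<bar> + e * real N)"
    have "norm (A p n *v v) \<le> D * exp (?c * real_of_int n + e * \<bar>real_of_int n\<bar>)" for n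
    proof -
      define q r where "q = n div int N" and "r = n mod int N"
      have n: "n = r + int N * q" and r: "r \<in> {0..<int N}" using N by (simp_all add: q_def r_def)
      have rN: "\<bar>real_of_int r\<bar> \<le> real N" using r by auto
      have nr: "real_of_int n = real_of_int r + real N * real_of_int q" by (simp add: n)
      have "norm (A p n *v v) \<le> K * norm (A p (int N * q) *v v)"
        using K [OF r] at_add [of p r "int N * q" v] multiple_period [of q] by (simp add: n)
      also have "\<dots> \<le> K * (C * exp (c * real_of_int q + e * real N * \<bar>real_of_int q\<bar>))"
        using Cq [of q] K1 by (intro mult_left_mono) auto
      also have "\<dots> \<le> K * (C * exp ((\<bar>c\<bar> + e * real N) + (?c * real_of_int n + e * \<bar>real_of_int n\<bar>)))"
      proof -
        have "?c * real_of_int n = ?c * real_of_int r + c * real_of_int q"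
          using N by (simp add: nr field_simps)
        moreover have "\<bar>?c * real_of_int r\<bar> \<le> \<bar>c\<bar>"
        proof -
          have "\<bar>?c * real_of_int r\<bar> = \<bar>c\<bar> * (\<bar>real_of_int r\<bar> / real N)" by (simp add: abs_mult)
          also have "\<dots> \<le> \<bar>c\<bar> * 1" using rN N by (intro mult_left_mono) auto
          finally show ?thesis by simp
        qed
        moreover have "e * real N * \<bar>real_of_int q\<bar> \<le> e * real N + e * \<bar>real_of_int n\<bar>"
        proof -
          have "real N * \<bar>real_of_int q\<bar> = \<bar>real_of_int n - real_of_int r\<bar>" by (simp add: nr abs_mult)
          also have "\<dots> \<le> real N + \<bar>real_of_int n\<bar>" using rN by linarith
          finally show ?thesis using e by (simp add: mult.assoc distrib_left [symmetric])
        qed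
        ultimately have "c * real_of_int q + e * real N * \<bar>real_of_int q\<bar>
            \<le> (\<bar>c\<bar> + e * real N) + (?c * real_of_int n + e * \<bar>real_of_int n\<bar>)" by linarith
        then show ?thesis using C(1) K1 by (intro mult_left_mono) simp_all
      qed
      finally show ?thesis by (simp only: D_def exp_add mult.assoc)
    qed
    then show "\<exists>C. \<forall>n. norm (A p n *v v) \<le> C * exp (?c * real_of_int n + e * \<bar>real_of_int n\<bar>)" by blast
  qed
qed

lemma span_exponent_spaces: "span (\<Union>c. exponent_space (iterate f j p) c) = UNIV"
proof -
  have inv: "A p (int N) ** A p (- int N) = mat 1" "A p (- int N) ** A p (int N) = mat 1"
    using inverse_left [of "int N" p] inverse_right [of p "int N"] per
    by (auto simp: matrix_eq iterate_of_nat matrix_vector_mul_assoc [symmetric]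
        simp del: matrix_vector_mul_assoc)
  have "UNIV = span (\<Union>c. growth_space ((*v) (A p (int N))) ((*v) (A p (- int N))) c)"
    using span_growth_spaces_real [OF inv] by simp
  also have "\<dots> \<subseteq> span (\<Union>c. exponent_space p c)"
    using growth_space_subset_exponent_space by (intro span_mono) blast
  finally have p: "span (\<Union>c. exponent_space p c) = UNIV" by blast
  have "(*v) (A p j) ` span (\<Union>c. exponent_space p c) = span (\<Union>c. exponent_space (iterate f j p) c)"
    by (simp add: linear_span_image [symmetric] image_Union exponent_space_image image_image UN_extend_simps)
  moreover have "surj ((*v) (A p j))" using inverse_right by (metis surj_def)
  ultimately show ?thesis using p by simp
qed

lemma dim_exponent_space: "dim (exponent_space (iterate f j p) c) = dim (exponent_space p c)"
proof -
  have "inj ((*v) (A p j))" by (metis injI inverse_left)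
  then show ?thesis
    unfolding exponent_space_image [symmetric]
    by (intro dim_image_eq matrix_vector_mul_linear) (auto intro: inj_on_subset)
qed

text \<open>The exponents are the rates with a nonzero exponent space. There are finitely many of them
  because independent nonzero subspaces are at most as many as the dimension.\<close>

lemma periodic_oseledets:
  obtains chis where "sorted chis" "length chis = CARD('m)"
    "\<And>j. oseledets_at A (iterate f j p) chis (exponent_space (iterate f j p))"
proof -
  define I where "I = {c. exponent_space p c \<noteq> {0}}"
  have dim_pos: "dim (exponent_space p c) > 0 \<longleftrightarrow> c \<in> I" for c
    using subspace_0 [OF subspace_exponent_space, of p c]
    unfolding I_def by (auto simp: dim_eq_0 neq0_conv [symmetric] simp del: neq0_conv)
  have ind: "independent_subspaces J (exponent_space (iterate f j p))" if "finite J" for J j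
    using that by (rule exponent_spaces_independent)
  have fin: "finite I"
  proof (rule ccontr)
    assume "infinite I"
    then obtain J where J: "J \<subseteq> I" "finite J" "card J = Suc CARD('m)"
      using infinite_arbitrarily_large by blast
    have "card J = (\<Sum>c\<in>J. 1)" by simp
    also have "\<dots> \<le> (\<Sum>c\<in>J. dim (exponent_space p c))"
      using J dim_pos by (intro sum_mono) (auto simp: Suc_le_eq)
    also have "\<dots> = dim (span (\<Union>c\<in>J. exponent_space p c))"
      using dim_independent_subspaces [OF J(2) ind [OF J(2), of 0]] by simp
    also have "\<dots> \<le> CARD('m)" using dim_subset_UNIV [of "span (\<Union>c\<in>J. exponent_space p c)"] by simp
    finally show False using J by simp
  qed
  have span: "span (\<Union>c\<in>I. exponent_space (iterate f j p) c) = UNIV" for j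
  proof -
    have "exponent_space (iterate f j p) c \<subseteq> {0}" if "c \<notin> I" for c
    proof -
      have "dim (exponent_space (iterate f j p) c) = 0"
        using that dim_pos [of c] by (simp add: dim_exponent_space)
      then show ?thesis by (simp only: dim_eq_0)
    qed
    then have "(\<Union>c. exponent_space (iterate f j p) c) \<subseteq> insert 0 (\<Union>c\<in>I. exponent_space (iterate f j p) c)"
      by blast
    then have "span (\<Union>c. exponent_space (iterate f j p) c) \<subseteq> span (insert 0 (\<Union>c\<in>I. exponent_space (iterate f j p) c))"
      by (rule span_mono)
    then show ?thesis using span_exponent_spaces by (simp add: span_insert_0 top.extremum_unique)
  qed
  define chis where "chis = sorted_list_of_multiset (\<Sum>c\<in>I. replicate_mset (dim (exponent_space p c)) c)"
  have count: "count_list chis c = (if c \<in> I then dim (exponent_space p c) else 0)" for c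
  proof -
    have "count_list chis c = (\<Sum>d\<in>I. if d = c then dim (exponent_space p d) else 0)"
      unfolding chis_def count_mset [symmetric] by (simp add: count_sum eq_commute)
    also have "\<dots> = (if c \<in> I then dim (exponent_space p c) else 0)"
      using fin by (simp add: sum.delta)
    finally show ?thesis .
  qed
  have "c \<in> set chis \<longleftrightarrow> count_list chis c > 0" for c
    by (simp add: count_list_0_iff neq0_conv [symmetric] del: neq0_conv)
  then have set: "set chis = I"
    using dim_pos count by (auto split: if_splits)
  have "length chis = (\<Sum>c\<in>I. dim (exponent_space p c))"
    unfolding sum_count_set [of chis I, OF eq_refl [OF set] fin, symmetric] by (simp add: count)
  also have "\<dots> = dim (span (\<Union>c\<in>I. exponent_space p c))"
    using dim_independent_subspaces [OF fin ind [OF fin, of 0]] by simp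
  also have "\<dots> = CARD('m)" using span [of 0] by (simp add: dim_UNIV)
  finally have len: "length chis = CARD('m)" .
  have top: "filterlim (\<lambda>n. \<bar>real_of_int n\<bar>) at_top at_top"
    unfolding filterlim_at_top
  proof
    fix Z :: real
    show "\<forall>\<^sub>F n in at_top. Z \<le> \<bar>real_of_int n\<bar>"
      using eventually_ge_at_top [of "\<lceil>\<bar>Z\<bar>\<rceil>"] by eventually_elim linarith
  qed
  have bot: "filterlim (\<lambda>n. \<bar>real_of_int n\<bar>) at_top at_bot"
    unfolding filterlim_at_top
  proof
    fix Z :: real
    show "\<forall>\<^sub>F n in at_bot. Z \<le> \<bar>real_of_int n\<bar>"
      using eventually_le_at_bot [of "- \<lceil>\<bar>Z\<bar>\<rceil>"] by eventually_elim linarith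
  qed
  have "oseledets_at A (iterate f j p) chis (exponent_space (iterate f j p))" for j
    unfolding oseledets_at_def
  proof (intro conjI ballI impI)
    show "direct_sum_decomposition (set chis) (exponent_space (iterate f j p))"
      using fin ind span by (simp add: set direct_sum_decomposition_iff)
    show "dim (exponent_space (iterate f j p) c) = count_list chis c" if "c \<in> set chis" for c
      using that by (simp add: set count dim_exponent_space)
  qed (use exponent_space_limits top bot in blast)+
  with len show ?thesis using that [of chis] by (simp add: chis_def)
qed

end

end

section \<open>Recurrence with controlled visits\<close>

locale measure_preserving = prob_space M for M :: "'a measure" +
  fixes T :: "'a \<Rightarrow> 'a"
  assumes T_meas [measurable]: "T \<in> measurable M M" and T_distr: "distr M M T = M"
begin

lemma iterates_measurable [measurable]: "T ^^ n \<in> measurable M M"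
  by (induction n) (auto intro: measurable_comp)

lemma distr_iterates: "distr M M (T ^^ n) = M"
proof (induction n)
  case 0
  then show ?case by (simp add: id_def)
next
  case (Suc n)
  have "distr M M (T ^^ Suc n) = distr (distr M M (T ^^ n)) M T"
    by (subst distr_distr) auto
  then show ?case by (simp only: Suc T_distr)
qed

lemma AE_along_orbit:
  assumes "AE x in M. P x"
  shows "AE x in M. \<forall>n. P ((T ^^ n) x)"
proof (subst AE_all_countable, intro allI)
  fix n
  have "AE x in distr M M (T ^^ n). P x" by (simp only: distr_iterates assms)
  then show "AE x in M. P ((T ^^ n) x)" by (rule AE_distrD [OF iterates_measurable])
qed

text \<open>Garsia's proof of the maximal ergodic inequality, for the function \<open>g = indicator B - c\<close>. Its centre
  is the pointwise estimate \<open>m \<le> g + m \<circ> T\<close> on \<open>E N\<close> for the maximum \<open>m\<close> of the Birkhoff sums of \<open>g\<close>.\<close>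

lemma maximal_inequality_finite:
  fixes c :: real
  assumes B [measurable]: "B \<in> sets M"
  defines "E \<equiv> \<lambda>N. {x\<in>space M. \<exists>n\<in>{1..N}. c * real n < (\<Sum>i<n. indicator B ((T ^^ i) x))}"
  assumes c: "c \<ge> 0"
  shows "c * measure M (E N) \<le> measure M B"
proof -
  define g where "g x = indicator B x - c" for x
  define S where "S n x = (\<Sum>i<n. g ((T ^^ i) x))" for n x
  define m where "m x = Max ((\<lambda>n. S n x) ` {..N})" for x
  have g_meas [measurable]: "g \<in> borel_measurable M" unfolding g_def by measurable
  have S_meas [measurable]: "S n \<in> borel_measurable M" for n unfolding S_def by measurable
  have m_meas [measurable]: "m \<in> borel_measurable M"
    unfolding m_def by (rule borel_measurable_Max) auto
  have S_eq: "S n x = (\<Sum>i<n. indicator B ((T ^^ i) x)) - c * real n" for n x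
    by (simp add: S_def g_def sum_subtractf)
  have E_eq: "E N = {x\<in>space M. \<exists>n\<in>{1..N}. 0 < S n x}" unfolding E_def S_eq by auto
  have E_meas [measurable]: "E N \<in> sets M" unfolding E_eq by measurable
  have S_Suc: "S (Suc n) x = g x + S n (T x)" for n x
    unfolding S_def by (subst sum.lessThan_Suc_shift) (simp add: funpow_swap1)
  have S_le_m: "S n x \<le> m x" if "n \<le> N" for n x
    unfolding m_def using that by (intro Max_ge) auto
  have m_in: "m x \<in> (\<lambda>n. S n x) ` {..N}" for x unfolding m_def by (rule Max_in) auto
  have S0: "S 0 x = 0" for x by (simp add: S_def)
  have S_bound: "\<bar>S n x\<bar> \<le> real N * (1 + c)" if "n \<le> N" for n x
  proof -
    have "\<bar>S n x\<bar> \<le> real (card {..<n}) * (1 + c)"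
      unfolding S_def by (rule sum_norm_bound [where 'a = real, simplified])
        (use c in \<open>auto simp: g_def indicator_def abs_le_iff\<close>)
    also have "\<dots> \<le> real N * (1 + c)" using that c by (intro mult_right_mono) auto
    finally show ?thesis .
  qed
  have m_bound: "\<bar>m x\<bar> \<le> real N * (1 + c)" for x
  proof -
    obtain n where "n \<le> N" "m x = S n x" using m_in [of x] by auto
    then show ?thesis using S_bound [of n x] by simp
  qed
  have m_int: "integrable M m"
    by (rule integrable_const_bound [where B = "real N * (1 + c)"])
      (use m_bound in auto)
  have m_int': "integrable M (\<lambda>x. m (T x))"
    by (rule integrable_const_bound [where B = "real N * (1 + c)"])
      (use m_bound in auto)
  have g_int: "integrable M (\<lambda>x. indicator (E N) x * g x)"
    by (rule integrable_const_bound [where B = "1 + c"]) (use c in \<open>auto simp: g_def indicator_def abs_le_iff\<close>)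
  have pw: "m x \<le> indicator (E N) x * g x + m (T x)" if x: "x \<in> space M" for x
  proof (cases "x \<in> E N")
    case True
    then obtain k where k: "k \<in> {1..N}" "0 < S k x" unfolding E_eq by blast
    obtain n where n: "n \<le> N" "m x = S n x" using m_in by auto
    have "n \<noteq> 0" using k S_le_m [of k x] n S0 by (intro notI) auto
    then obtain l where l: "n = Suc l" using not0_implies_Suc by blast
    show ?thesis using True n S_le_m [of l "T x"] S_Suc [of l x] by (simp add: l)
  next
    case False
    obtain n where n: "n \<le> N" "m x = S n x" using m_in by auto
    have "S n x \<le> 0"
    proof (cases "n = 0")
      case False
      with \<open>x \<notin> E N\<close> x n(1) show ?thesis unfolding E_eq by (auto simp: not_less)
    qed (simp add: S0)
    then show ?thesis using False n S_le_m [of 0 "T x"] S0 by simp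
  qed
  have "(\<integral>x. m x \<partial>M) \<le> (\<integral>x. indicator (E N) x * g x + m (T x) \<partial>M)"
    by (rule integral_mono_AE) (use m_int m_int' g_int pw in auto)
  also have "\<dots> = (\<integral>x. indicator (E N) x * g x \<partial>M) + (\<integral>x. m (T x) \<partial>M)"
    using g_int m_int' by simp
  also have "(\<integral>x. m (T x) \<partial>M) = (\<integral>x. m x \<partial>M)"
    using integral_distr [of T M M m] T_distr by simp
  finally have "0 \<le> (\<integral>x. indicator (E N) x * g x \<partial>M)" by simp
  also have "(\<integral>x. indicator (E N) x * g x \<partial>M)
      = (\<integral>x. indicator (B \<inter> E N) x - c * indicator (E N) x \<partial>M)"
    by (rule Bochner_Integration.integral_cong) (auto simp: g_def indicator_def)
  also have "\<dots> = measure M (B \<inter> E N) - c * measure M (E N)"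
    by (subst Bochner_Integration.integral_diff) (auto simp: emeasure_eq_measure)
  also have "measure M (B \<inter> E N) \<le> measure M B" by (rule finite_measure_mono) auto
  finally show ?thesis by simp
qed

lemma maximal_inequality:
  fixes c :: real
  assumes B [measurable]: "B \<in> sets M" and c: "c \<ge> 0"
  defines "E \<equiv> {x\<in>space M. \<exists>n>0. c * real n < (\<Sum>i<n. indicator B ((T ^^ i) x))}"
  shows "E \<in> sets M" "c * measure M E \<le> measure M B"
proof -
  let ?E = "\<lambda>N. {x\<in>space M. \<exists>n\<in>{1..N}. c * real n < (\<Sum>i<n. indicator B ((T ^^ i) x))}"
  show "E \<in> sets M" unfolding E_def by measurable
  have U: "E = (\<Union>N. ?E N)"
  proof (intro equalityI subsetI)
    fix x assume "x \<in> E"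
    then obtain n where "x \<in> space M" "n > 0" "c * real n < (\<Sum>i<n. indicator B ((T ^^ i) x))"
      unfolding E_def by blast
    then have "x \<in> ?E n" by (auto intro: bexI [of _ n])
    then show "x \<in> (\<Union>N. ?E N)" by blast
  next
    fix x assume "x \<in> (\<Union>N. ?E N)"
    then obtain N n where "x \<in> space M" "n \<in> {1..N}" "c * real n < (\<Sum>i<n. indicator B ((T ^^ i) x))"
      by blast
    then have "n > 0" by simp
    then show "x \<in> E" unfolding E_def using \<open>x \<in> space M\<close> \<open>c * real n < _\<close> by blast
  qed
  have inc: "incseq ?E"
  proof (unfold incseq_def, intro allI impI subsetI)
    fix k N :: nat and x assume kN: "k \<le> N" and x: "x \<in> ?E k"
    then obtain n where "x \<in> space M" "n \<in> {1..k}" "c * real n < (\<Sum>i<n. indicator B ((T ^^ i) x))"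
      by blast
    moreover have "n \<in> {1..N}" using kN \<open>n \<in> {1..k}\<close> by simp
    ultimately show "x \<in> ?E N" by blast
  qed
  have "(\<lambda>N. measure M (?E N)) \<longlonglongrightarrow> measure M (\<Union>N. ?E N)"
    by (rule finite_Lim_measure_incseq [OF _ inc]) auto
  then have "(\<lambda>N. c * measure M (?E N)) \<longlonglongrightarrow> c * measure M E"
    unfolding U by (rule tendsto_mult_left)
  then show "c * measure M E \<le> measure M B"
    by (rule LIMSEQ_le_const2) (use maximal_inequality_finite [OF B c] in blast)
qed

text \<open>The sets of points that visit \<open>R\<close> at some time \<open>n \<ge> N\<close> decrease with \<open>N\<close>, and by invariance each of
  them has at least the measure of \<open>R\<close>.\<close>

lemma infinitely_many_visits:
  assumes R [measurable]: "R \<in> sets M" and pos: "measure M R > 0" and Q: "AE x in M. Q x"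
  obtains x where "x \<in> space M" "Q x" "infinite {n. (T ^^ n) x \<in> R}"
proof -
  define V where "V N = {x\<in>space M. \<exists>n\<ge>N. (T ^^ n) x \<in> R}" for N :: nat
  have V_meas [measurable]: "V N \<in> sets M" for N unfolding V_def by measurable
  have "measure M R \<le> measure M (V N)" for N
  proof -
    have "measure M R = measure (distr M M (T ^^ N)) R" by (simp add: distr_iterates)
    also have "\<dots> = measure M ((T ^^ N) -` R \<inter> space M)" by (subst measure_distr) auto
    also have "\<dots> \<le> measure M (V N)" by (rule finite_measure_mono) (auto simp: V_def)
    finally show ?thesis .
  qed
  moreover have "(\<lambda>N. measure M (V N)) \<longlonglongrightarrow> measure M (\<Inter>N. V N)"
    by (rule finite_Lim_measure_decseq) (auto simp: decseq_def V_def intro: order_trans)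
  ultimately have "measure M R \<le> measure M (\<Inter>N. V N)"
    by (intro LIMSEQ_le_const) auto
  then have pos': "measure M (\<Inter>N. V N) > 0" using pos by simp
  have "\<exists>x\<in>(\<Inter>N. V N). Q x"
  proof (rule ccontr)
    assume "\<not> ?thesis"
    then have "AE x in M. x \<notin> (\<Inter>N. V N)" using Q by (auto elim!: eventually_mono)
    then have "measure M (\<Inter>N. V N) = 0"
      by (subst (asm) AE_iff_null_sets [symmetric]) (auto simp: null_sets_def measure_def)
    then show False using pos' by simp
  qed
  then obtain x where x: "x \<in> (\<Inter>N. V N)" "Q x" by blast
  then have "infinite {n. (T ^^ n) x \<in> R}"
    unfolding infinite_nat_iff_unbounded_le by (auto simp: V_def)
  with x that show ?thesis by (auto simp: V_def)
qed

text \<open>The level of \<open>T\<^sup>n x\<close> is at most \<open>m\<close> plus the number of visits to the complement of \<open>G m\<close> up to time \<open>n\<close>: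
  it rises by at most one in each step, and it is back at \<open>m\<close> whenever the orbit is in \<open>G m\<close>.\<close>

lemma slow_variation_along_orbit:
  fixes G :: "nat \<Rightarrow> 'a set" and c :: real
  assumes mono: "\<And>k l. k \<le> l \<Longrightarrow> G k \<subseteq> G l"
    and step: "\<And>l x. x \<in> G l \<Longrightarrow> T x \<in> G (Suc l)"
    and x: "x \<in> space M" and c: "c < 1"
    and few: "\<not> (\<exists>n>0. c * real n < (\<Sum>i<n. indicator (space M - G m) ((T ^^ i) x)))"
    and l: "real m + c * real (Suc n) \<le> real l"
  shows "(T ^^ n) x \<in> G l"
proof -
  define s where "s n = card {i. i < n \<and> (T ^^ i) x \<notin> G m}" for n
  have s: "(\<Sum>i<n. indicator (space M - G m) ((T ^^ i) x)) = real (s n)" for n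
  proof -
    have "(\<Sum>i<n. indicator (space M - G m) ((T ^^ i) x) :: real)
        = (\<Sum>i<n. if i \<in> {i. (T ^^ i) x \<notin> G m} then 1 else 0)"
      using measurable_space [OF iterates_measurable x]
      by (intro sum.cong) (auto simp: indicator_def)
    also have "\<dots> = real (card ({..<n} \<inter> {i. (T ^^ i) x \<notin> G m}))"
      by (simp add: sum.If_cases)
    also have "{..<n} \<inter> {i. (T ^^ i) x \<notin> G m} = {i. i < n \<and> (T ^^ i) x \<notin> G m}" by auto
    finally show ?thesis by (simp add: s_def)
  qed
  have s_Suc: "s (Suc n) = (if (T ^^ n) x \<in> G m then s n else Suc (s n))" for n
  proof -
    have "{i. i < Suc n \<and> (T ^^ i) x \<notin> G m}
        = (if (T ^^ n) x \<in> G m then {} else {n}) \<union> {i. i < n \<and> (T ^^ i) x \<notin> G m}"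
      by (auto simp: less_Suc_eq)
    then show ?thesis unfolding s_def by simp
  qed
  have 1: "real (s n) \<le> c * real n" if "n > 0" for n
    using few that s by (metis not_less)
  have "s 1 = 0" using 1 [of 1] c by simp
  then have good0: "x \<in> G m" using s_Suc [of 0] by (auto split: if_splits)
  have "(T ^^ n) x \<in> G (m + s (Suc n))" for n
  proof (induction n)
    case 0
    then show ?case using good0 mono [of m "m + s (Suc 0)"] by auto
  next
    case (Suc n)
    show ?case
    proof (cases "(T ^^ Suc n) x \<in> G m")
      case True
      then show ?thesis using mono [of m "m + s (Suc (Suc n))"] by auto
    next
      case False
      then have "s (Suc (Suc n)) = Suc (s (Suc n))" using s_Suc [of "Suc n"] by simp
      then show ?thesis using step [OF Suc] by simp
    qed
  qed
  moreover have "real (m + s (Suc n)) \<le> real l" using 1 [of "Suc n"] l by simp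
  then have "m + s (Suc n) \<le> l" by linarith
  ultimately show ?thesis using mono by blast
qed

end

text \<open>The sets \<open>G l\<close> are the sublevel sets of a finite function that varies by at most one along the
  orbits. By the maximal inequality, most points visit the complement of a large sublevel set
  with frequency at most \<open>c\<close> in every initial segment of both half orbits.\<close>

lemma slow_variation_on_positive_measure:
  fixes G :: "nat \<Rightarrow> 'a set" and c :: real
  assumes f: "measure_preserving M f" and g: "measure_preserving M g"
    and G: "\<And>l. G l \<in> sets M" and mono: "\<And>k l. k \<le> l \<Longrightarrow> G k \<subseteq> G l"
    and fstep: "\<And>l x. x \<in> G l \<Longrightarrow> f x \<in> G (Suc l)"
    and gstep: "\<And>l x. x \<in> G l \<Longrightarrow> g x \<in> G (Suc l)"
    and ae: "AE x in M. \<exists>l. x \<in> G l" and c: "0 < c" "c < 1"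
  obtains K R where "R \<in> sets M" "measure M R > 0"
    "\<And>x n l. x \<in> R \<Longrightarrow> K + c * real n \<le> real l \<Longrightarrow> (f ^^ n) x \<in> G l \<and> (g ^^ n) x \<in> G l"
proof -
  interpret f: measure_preserving M f by fact
  interpret g: measure_preserving M g by fact
  note [measurable] = G
  have "(\<lambda>l. measure M (G l)) \<longlonglongrightarrow> measure M (\<Union>l. G l)"
    by (rule f.finite_Lim_measure_incseq) (auto simp: incseq_def dest: mono)
  moreover have "measure M (\<Union>l. G l) = 1"
    using ae by (intro f.prob_eq_1 [THEN iffD2]) auto
  ultimately have "\<forall>\<^sub>F l in sequentially. measure M (G l) > 1 - c / 4"
    using c by (intro order_tendstoD(1)) auto
  then obtain m where m: "measure M (G m) > 1 - c / 4" by (auto simp: eventually_sequentially)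
  let ?B = "space M - G m"
  have B: "measure M ?B < c / 4" using m by (simp add: f.prob_compl)
  define E where "E T = {x\<in>space M. \<exists>n>0. c * real n < (\<Sum>i<n. indicator ?B ((T ^^ i) x))}"
    for T :: "'a \<Rightarrow> 'a"
  have E: "E f \<in> sets M" "c * measure M (E f) \<le> measure M ?B"
    "E g \<in> sets M" "c * measure M (E g) \<le> measure M ?B"
    unfolding E_def using f.maximal_inequality [of ?B c] g.maximal_inequality [of ?B c] c by auto
  define R where "R = space M - (E f \<union> E g)"
  have R: "R \<in> sets M" unfolding R_def using E by auto
  have "c * measure M (E f) < c * (1/4)" "c * measure M (E g) < c * (1/4)" using E(2,4) B by auto
  then have "measure M (E f) < 1/4" "measure M (E g) < 1/4" using c by auto
  then have "measure M (E f \<union> E g) < 1/2"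
    using measure_Un_le [OF E(1,3)] by simp
  then have "measure M R > 0" unfolding R_def using E by (subst f.prob_compl) auto
  moreover have "(f ^^ n) x \<in> G l \<and> (g ^^ n) x \<in> G l"
    if x: "x \<in> R" and l: "(real m + c) + c * real n \<le> real l" for x n l
  proof
    show "(f ^^ n) x \<in> G l"
      by (rule f.slow_variation_along_orbit [where c = c and m = m])
        (use mono fstep x l c in \<open>auto simp: R_def E_def algebra_simps\<close>)
    show "(g ^^ n) x \<in> G l"
      by (rule g.slow_variation_along_orbit [where c = c and m = m])
        (use mono gstep x l c in \<open>auto simp: R_def E_def algebra_simps\<close>)
  qed
  ultimately show ?thesis using R that by blast
qed

section \<open>Cones along an approximate orbit\<close>

text \<open>The numbers \<open>u i\<close> and \<open>s i\<close> stand for the sizes, in adapted norms, of the fast and of the slow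
  component of a vector after \<open>i\<close> steps along the perturbed orbit. At the end of the period the vector
  is measured once more, by \<open>u'\<close> and \<open>s'\<close>, in the adapted norms at the starting point; this costs a
  factor \<open>L\<close> and another small error. The predicate says that then the cone \<open>s \<le> u\<close> is preserved and
  expanded.\<close>

definition cone_step :: "real \<Rightarrow> real \<Rightarrow> real \<Rightarrow> real \<Rightarrow> nat \<Rightarrow> bool" where
  "cone_step t e L \<eta> n \<longleftrightarrow>
     (\<forall>u s u' s'. (\<forall>i\<le>n. 0 \<le> u i \<and> 0 \<le> s i) \<longrightarrow>
        (\<forall>i<n. exp (t + e) * u i - \<eta> * (u i + s i) \<le> u (Suc i) \<and>
               s (Suc i) \<le> exp (t - e) * s i + \<eta> * (u i + s i)) \<longrightarrow>
        u n / L - \<eta> * (u n + s n) \<le> u' \<longrightarrow> s' \<le> L * s n + L * \<eta> * (u n + s n) \<longrightarrow>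
        s 0 \<le> u 0 \<longrightarrow> s' \<le> u' \<and> exp (t * real n) * u 0 \<le> u')"

lemma cone_stepD:
  assumes "cone_step t e L \<eta> n" "\<forall>i\<le>n. 0 \<le> u i \<and> 0 \<le> s i"
    "\<forall>i<n. exp (t + e) * u i - \<eta> * (u i + s i) \<le> u (Suc i) \<and>
             s (Suc i) \<le> exp (t - e) * s i + \<eta> * (u i + s i)"
    "u n / L - \<eta> * (u n + s n) \<le> u'" "s' \<le> L * s n + L * \<eta> * (u n + s n)" "s 0 \<le> u 0"
  shows "s' \<le> u' \<and> exp (t * real n) * u 0 \<le> u'"
  by (rule assms(1) [unfolded cone_step_def, THEN spec, THEN spec, THEN spec, THEN spec,
        THEN mp, THEN mp, THEN mp, THEN mp, THEN mp]) (rule assms)+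

text \<open>Up to the errors, the slope \<open>s i / u i\<close> is multiplied by \<open>q = exp (- 3 e / 2)\<close> in every step. So it falls from
  \<open>1\<close> to at most \<open>2 \<tau>\<close>, which makes up for the factor \<open>L\<close> twice; of the expansion by
  \<open>exp (t + e)\<close> the rate \<open>e / 2\<close> is spent on the errors and another \<open>e / 2\<close> on the factor \<open>2 L\<close>.\<close>

lemma cone_step_exists:
  assumes e: "e > 0" and L: "L \<ge> 1"
  shows "\<exists>\<eta>\<^sub>0>0. \<forall>\<eta>. 0 < \<eta> \<and> \<eta> \<le> \<eta>\<^sub>0 \<longrightarrow> (\<forall>\<^sub>F n in sequentially. cone_step t e L \<eta> n)"
proof -
  define \<rho> where "\<rho> = exp (t + e/2)"
  define q where "q = exp (- (3 * e / 2))"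
  define \<tau> where "\<tau> = 1 / (8 * L\<^sup>2)"
  have \<rho>: "\<rho> > 0" "\<rho> < exp (t + e)" "exp (t - e) = \<rho> * q"
    using e by (simp_all add: \<rho>_def q_def exp_add [symmetric] field_simps)
  have q: "0 < q" "q < 1" using e by (simp_all add: q_def)
  have "1 \<le> L\<^sup>2" using L by (rule one_le_power)
  then have "1 \<le> 8 * L\<^sup>2" by linarith
  then have \<tau>: "0 < \<tau>" "\<tau> \<le> 1" using L by (auto simp: \<tau>_def divide_le_eq)
  \<comment> \<open>The three bounds serve the expansion, the contraction of the slope, and the comparison of norms
    at the end; the factors \<open>3\<close> come from \<open>u i + s i \<le> 3 * u i\<close>.\<close>
  define \<eta>\<^sub>0 where "\<eta>\<^sub>0 = min ((exp (t + e) - \<rho>) / 3) (min (\<rho> * (1 - q) * \<tau> / 3) (1 / (12 * L\<^sup>2)))"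
  have "L\<^sup>2 > 0" using L by simp
  then have \<eta>\<^sub>0: "\<eta>\<^sub>0 > 0" unfolding \<eta>\<^sub>0_def using \<rho> q \<tau> by simp
  have "\<forall>\<^sub>F n in sequentially. cone_step t e L \<eta> n" if \<eta>: "0 < \<eta>" "\<eta> \<le> \<eta>\<^sub>0" for \<eta>
  proof -
    have \<eta>_le: "\<eta> \<le> (exp (t + e) - \<rho>) / 3" "\<eta> \<le> \<rho> * (1 - q) * \<tau> / 3" "\<eta> \<le> 1 / (12 * L\<^sup>2)"
      using \<eta>(2) unfolding \<eta>\<^sub>0_def by (meson min.cobounded1 min.cobounded2 order_trans)+
    have step: "s' \<le> u' \<and> exp (t * real n) * u 0 \<le> u'"
      if nn: "\<forall>i\<le>n. 0 \<le> u i \<and> 0 \<le> s i"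
        and step: "\<forall>i<n. exp (t + e) * u i - \<eta> * (u i + s i) \<le> u (Suc i) \<and>
                 s (Suc i) \<le> exp (t - e) * s i + \<eta> * (u i + s i)"
        and u': "u n / L - \<eta> * (u n + s n) \<le> u'" and s': "s' \<le> L * s n + L * \<eta> * (u n + s n)"
        and s0: "s 0 \<le> u 0" and n: "q ^ n \<le> \<tau>" "2 * L \<le> exp (e/2 * real n)"
      for n and u s :: "nat \<Rightarrow> real" and u' s'
    proof -
      have ind: "s i \<le> (q ^ i + \<tau>) * u i \<and> \<rho> ^ i * u 0 \<le> u i" if "i \<le> n" for i
        using that
      proof (induction i)
        case 0
        have "0 \<le> \<tau> * u 0" using \<tau> nn by simp
        then show ?case using s0 by (simp add: algebra_simps)
      next
        case (Suc i)
        then have ih: "s i \<le> (q ^ i + \<tau>) * u i" "\<rho> ^ i * u 0 \<le> u i" by auto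
        have ui: "0 \<le> u i" using nn Suc by simp
        have "q ^ i \<le> 1" using q by (simp add: power_le_one)
        then have "(q ^ i + \<tau>) * u i \<le> 2 * u i" using \<tau> ui by (intro mult_right_mono) auto
        then have "u i + s i \<le> 3 * u i" using ih by simp
        then have err: "\<eta> * (u i + s i) \<le> 3 * \<eta> * u i" using \<eta>(1) mult_left_mono by fastforce
        have "3 * \<eta> * u i \<le> (exp (t + e) - \<rho>) * u i"
          using \<eta>_le(1) ui by (intro mult_right_mono) auto
        then have u_ge: "\<rho> * u i \<le> u (Suc i)"
          using step [rule_format, of i] Suc.prems err by (simp add: algebra_simps)
        have "s (Suc i) \<le> exp (t - e) * s i + 3 * \<eta> * u i"
          using step [rule_format, of i] Suc.prems err by linarith
        also have "\<dots> \<le> \<rho> * q * ((q ^ i + \<tau>) * u i) + \<rho> * (1 - q) * \<tau> * u i"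
          using ih(1) \<rho> q \<eta>_le(2) ui by (intro add_mono mult_left_mono mult_right_mono) auto
        also have "\<dots> = (q ^ Suc i + \<tau>) * (\<rho> * u i)" by (simp add: algebra_simps)
        also have "\<dots> \<le> (q ^ Suc i + \<tau>) * u (Suc i)"
          using u_ge q \<tau> by (intro mult_left_mono) auto
        finally have "s (Suc i) \<le> (q ^ Suc i + \<tau>) * u (Suc i)" .
        moreover have "\<rho> ^ Suc i * u 0 \<le> u (Suc i)"
          using mult_left_mono [OF ih(2) less_imp_le [OF \<rho>(1)]] u_ge
          unfolding power_Suc mult.assoc by (rule order_trans)
        ultimately show ?case by blast
      qed
      have un: "0 \<le> u n" using nn by simp
      have sn: "s n \<le> 2 * \<tau> * u n"
        using ind [of n] n(1) un mult_right_mono [of "q ^ n + \<tau>" "2 * \<tau>" "u n"] by simp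
      have "2 * \<tau> * u n \<le> 2 * u n" using \<tau> un by (simp add: mult_right_mono)
      then have "u n + s n \<le> 3 * u n" using sn by simp
      then have err: "\<eta> * (u n + s n) \<le> 3 * \<eta> * u n" using \<eta>(1) mult_left_mono by fastforce
      have "3 * \<eta> * u n \<le> 3 * (1 / (12 * L\<^sup>2)) * u n"
        using \<eta>_le(3) un by (intro mult_right_mono) auto
      with err have err': "\<eta> * (u n + s n) \<le> u n / (4 * L\<^sup>2)" by simp
      have Lsq: "u n / (4 * L\<^sup>2) \<le> u n / (4 * L)"
        using L un by (intro divide_left_mono) (auto simp: power2_eq_square)
      have "u n / (2 * L) = u n / L - u n / (2 * L)" using L by (simp add: field_simps)
      also have "\<dots> \<le> u n / L - u n / (4 * L)" using L un by (simp add: field_simps)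
      finally have u'_ge: "u n / (2 * L) \<le> u'" using u' err' Lsq by linarith
      have "L * s n \<le> L * (2 * \<tau> * u n)" using sn L by (intro mult_left_mono) auto
      also have "\<dots> = u n / (4 * L)" using L by (simp add: \<tau>_def field_simps power2_eq_square)
      finally have 1: "L * s n \<le> u n / (4 * L)" .
      have "L * \<eta> * (u n + s n) \<le> L * (u n / (4 * L\<^sup>2))"
        unfolding mult.assoc using err' L by (intro mult_left_mono) auto
      also have "\<dots> = u n / (4 * L)" using L by (simp add: field_simps power2_eq_square)
      finally have "s' \<le> u n / (4 * L) + u n / (4 * L)" using s' 1 by linarith
      also have "\<dots> = u n / (2 * L)" using L by (simp add: field_simps)
      finally have "s' \<le> u'" using u'_ge by linarith
      moreover have "exp (t * real n) * u 0 \<le> u'"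
      proof -
        have "\<rho> ^ n = exp (t * real n) * exp (e/2 * real n)"
          by (simp add: \<rho>_def exp_of_nat_mult [symmetric] exp_add [symmetric] algebra_simps)
        then have "exp (t * real n) * (2 * L) \<le> \<rho> ^ n" using n(2) by simp
        then have "exp (t * real n) * (2 * L) * u 0 \<le> \<rho> ^ n * u 0"
          using nn by (intro mult_right_mono) auto
        also have "\<dots> \<le> u n" using ind by blast
        finally have "exp (t * real n) * u 0 \<le> u n / (2 * L)"
          using L by (simp add: field_simps)
        then show ?thesis using u'_ge by simp
      qed
      ultimately show ?thesis ..
    qed
    have "(\<lambda>n. q ^ n) \<longlonglongrightarrow> 0" using q by (intro LIMSEQ_realpow_zero) auto
    then have ev1: "\<forall>\<^sub>F n in sequentially. q ^ n < \<tau>" using \<tau>(1) by (rule order_tendstoD(2))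
    have ev2: "\<forall>\<^sub>F n in sequentially. 2 * L \<le> exp (e/2 * real n)"
      using exp_linear_at_top [of "e/2"] e by (simp add: filterlim_at_top)
    from ev1 ev2 show "\<forall>\<^sub>F n in sequentially. cone_step t e L \<eta> n"
    proof eventually_elim
      case (elim n)
      show ?case unfolding cone_step_def
      proof (intro allI impI, goal_cases)
        case (1 u s u' s')
        then show ?case by (intro step [of n u s u' s']) (use elim in simp_all)
      qed
    qed
  qed
  with \<eta>\<^sub>0 show ?thesis by blast
qed

section \<open>Adapted norms\<close>

definition backward_bounded ::
    "('a \<Rightarrow> int \<Rightarrow> real^'m^'m) \<Rightarrow> real \<Rightarrow> 'a \<Rightarrow> real^'m^'m \<Rightarrow> real \<Rightarrow> bool" where
  "backward_bounded A b y P l \<longleftrightarrow>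
     (\<forall>k v. exp (b * real k) * norm (A y (- int k) *v (P *v v)) \<le> l * norm v)"

text \<open>The matrix \<open>P\<close> plays the part of the projection onto the fast space along the slow space. Only upper
  bounds occur, and the slow part is the fast part of the reversed cocycle, so that one
  statement covers both.\<close>

definition dichotomy ::
    "('a \<Rightarrow> int \<Rightarrow> real^'m^'m) \<Rightarrow> real \<Rightarrow> real \<Rightarrow> 'a \<Rightarrow> real^'m^'m \<Rightarrow> real \<Rightarrow> bool" where
  "dichotomy A t e y P l \<longleftrightarrow> backward_bounded A (t + e) y P l \<and>
     backward_bounded (reverse_cocycle A) (- t + e) y (mat 1 - P) l"

lemma dichotomy_reverse:
  "dichotomy A t e y P l \<Longrightarrow> dichotomy (reverse_cocycle A) (- t) e y (mat 1 - P) l"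
  by (simp add: dichotomy_def)

lemma idempotent_complement:
  fixes P :: "real^'m^'m"
  assumes "P ** P = P"
  shows "(mat 1 - P) ** (mat 1 - P) = mat 1 - P"
proof (subst matrix_eq, intro allI)
  fix z
  have "P *v (P *v z) = P *v z" using assms by (metis matrix_vector_mul_assoc)
  then show "((mat 1 - P) ** (mat 1 - P)) *v z = (mat 1 - P) *v z"
    by (simp add: matrix_vector_mul_assoc [symmetric] matrix_vector_mult_diff_rdistrib
        matrix_vector_mult_diff_distrib)
qed

lemma dichotomy_mono:
  assumes "dichotomy A t e y P l" "l \<le> l'"
  shows "dichotomy A t e y P l'"
  using assms unfolding dichotomy_def backward_bounded_def
  by (meson mult_right_mono norm_ge_zero order_trans)

text \<open>The supremum over the past absorbs all constants: one step of the cocycle expands this norm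
  by the full factor \<open>exp b\<close> (\<open>adapted_norm_expands\<close>).\<close>

definition adapted_norm ::
    "('a \<Rightarrow> int \<Rightarrow> real^'m^'m) \<Rightarrow> real \<Rightarrow> 'a \<Rightarrow> real^'m^'m \<Rightarrow> real^'m \<Rightarrow> real" where
  "adapted_norm A b y P v = (SUP k. exp (b * real k) * norm (A y (- int k) *v (P *v v)))"

context cocycle
begin

lemma dichotomy_projection_bound:
  assumes "dichotomy A t e y P l"
  shows "norm (P *v v) \<le> l * norm v" "0 \<le> l"
proof -
  have "exp ((t + e) * real 0) * norm (A y (- int 0) *v (P *v v)) \<le> l * norm v" for v
    using assms unfolding dichotomy_def backward_bounded_def by blast
  then have *: "norm (P *v v) \<le> l * norm v" for v by simp
  then show "norm (P *v v) \<le> l * norm v" .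
  show "0 \<le> l"
    using order_trans [OF norm_ge_zero * [of "axis undefined 1"]] by (simp add: norm_axis_1)
qed

context
  fixes b y P l assumes bb: "backward_bounded A b y P l"
begin

lemma adapted_norm_bdd: "bdd_above (range (\<lambda>k. exp (b * real k) * norm (A y (- int k) *v (P *v v))))"
  using bb unfolding backward_bounded_def by (intro bdd_aboveI2) auto

lemma adapted_norm_le: "adapted_norm A b y P v \<le> l * norm v"
  unfolding adapted_norm_def using bb unfolding backward_bounded_def by (intro cSUP_least) auto

lemma adapted_norm_ge: "exp (b * real k) * norm (A y (- int k) *v (P *v v)) \<le> adapted_norm A b y P v"
  unfolding adapted_norm_def by (rule cSUP_upper [OF UNIV_I adapted_norm_bdd])

lemma norm_projection_le_adapted: "norm (P *v v) \<le> adapted_norm A b y P v"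
  using adapted_norm_ge [of 0 v] by simp

lemma adapted_norm_nonneg: "0 \<le> adapted_norm A b y P v"
  using norm_projection_le_adapted [of v] norm_ge_zero order_trans by blast

lemma adapted_norm_triangle:
  "adapted_norm A b y P (v + w) \<le> adapted_norm A b y P v + adapted_norm A b y P w"
proof -
  have "exp (b * real k) * norm (A y (- int k) *v (P *v (v + w)))
      \<le> adapted_norm A b y P v + adapted_norm A b y P w" for k
  proof -
    have "exp (b * real k) * norm (A y (- int k) *v (P *v (v + w)))
      \<le> exp (b * real k) * (norm (A y (- int k) *v (P *v v)) + norm (A y (- int k) *v (P *v w)))"
      by (simp add: matrix_vector_right_distrib norm_triangle_ineq)
    also have "\<dots> \<le> adapted_norm A b y P v + adapted_norm A b y P w"
      using adapted_norm_ge [of k v] adapted_norm_ge [of k w] by (simp add: distrib_left)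
    finally show ?thesis .
  qed
  then show ?thesis unfolding adapted_norm_def [of A b y P "v + w"] by (intro cSUP_least) auto
qed

lemma adapted_norm_perturb:
  "adapted_norm A b y P v \<le> adapted_norm A b y P w + l * norm (v - w)"
  using adapted_norm_triangle [of w "v - w"] adapted_norm_le [of "v - w"] by simp

lemma adapted_norm_idempotent:
  assumes "P ** P = P"
  shows "adapted_norm A b y P v \<le> l * norm (P *v v)"
proof -
  have "adapted_norm A b y P v = adapted_norm A b y P (P *v v)"
    unfolding adapted_norm_def by (simp add: matrix_vector_mul_assoc assms del: matrix_vector_mul_assoc [symmetric])
  then show ?thesis using adapted_norm_le by metis
qed

end

lemma adapted_norm_expands:
  assumes bb: "backward_bounded A b (f y) P' l" and eq: "P' ** A y 1 = A y 1 ** P"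
  shows "exp b * adapted_norm A b y P v \<le> adapted_norm A b (f y) P' (A y 1 *v v)"
proof -
  have "exp (b * real k) * norm (A y (- int k) *v (P *v v))
      \<le> exp (- b) * adapted_norm A b (f y) P' (A y 1 *v v)" for k
  proof -
    have it: "iterate f 1 y = f y" by (simp add: iterate_def)
    have "A y (- int (Suc k) + 1) *v (P *v v) = A (f y) (- int (Suc k)) *v (A y 1 *v (P *v v))"
      unfolding at_add it ..
    also have "A y 1 *v (P *v v) = P' *v (A y 1 *v v)"
      using eq by (metis matrix_vector_mul_assoc)
    finally have "A y (- int k) *v (P *v v) = A (f y) (- int (Suc k)) *v (P' *v (A y 1 *v v))"
      by simp
    then have "exp b * (exp (b * real k) * norm (A y (- int k) *v (P *v v)))
        \<le> adapted_norm A b (f y) P' (A y 1 *v v)"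
      using adapted_norm_ge [OF bb, of "Suc k" "A y 1 *v v"]
      by (simp add: exp_add [symmetric] mult.assoc [symmetric] algebra_simps)
    then show ?thesis by (simp add: exp_minus field_simps)
  qed
  then have "adapted_norm A b y P v \<le> exp (- b) * adapted_norm A b (f y) P' (A y 1 *v v)"
    unfolding adapted_norm_def [of A b y] by (intro cSUP_least) auto
  then show ?thesis by (simp add: exp_minus field_simps)
qed

lemma equivariance_inverse:
  assumes "P' ** A x 1 = A x 1 ** P"
  shows "(mat 1 - P) ** A (f x) (- 1) = A (f x) (- 1) ** (mat 1 - P')"
proof (subst matrix_eq, intro allI)
  fix z
  have it: "iterate f 1 x = f x" by (simp add: iterate_def)
  have li: "A (f x) (- 1) *v (A x 1 *v u) = u" for u using inverse_left [of 1 x u] by (simp add: it)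
  have ri: "A x 1 *v (A (f x) (- 1) *v u) = u" for u using inverse_right [of x 1 u] by (simp add: it)
  have "P' *v z = A x 1 *v (P *v (A (f x) (- 1) *v z))"
    using assms ri [of z] by (metis matrix_vector_mul_assoc)
  then have "A (f x) (- 1) *v (P' *v z) = P *v (A (f x) (- 1) *v z)" by (simp add: li)
  then show "((mat 1 - P) ** A (f x) (- 1)) *v z = (A (f x) (- 1) ** (mat 1 - P')) *v z"
    by (simp add: matrix_vector_mul_assoc [symmetric] matrix_vector_mult_diff_rdistrib
        matrix_vector_mult_diff_distrib)
qed

text \<open>Each period satisfies the hypotheses of \<open>cone_step\<close>, with \<open>U i\<close> and \<open>S i\<close> the adapted norms of
  the fast and of the slow part at \<open>f\<^sup>i y\<close>. A vector with \<open>P 0 *v v = v\<close> has no slow part and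
  lies in the initial cone, so it is expanded in every period.\<close>

lemma growth_along_shadowing_orbit:
  assumes cone: "cone_step t e L \<eta> n"
    and p: "(f ^^ n) p = p"
    and dich: "\<And>i. i \<le> n \<Longrightarrow> dichotomy A t e ((f ^^ i) y) (P i) (K i)"
    and K: "K 0 \<le> L" "K n \<le> L" and L: "L \<ge> 1"
    and eqv: "\<And>i. i < n \<Longrightarrow> P (Suc i) ** A ((f ^^ i) y) 1 = A ((f ^^ i) y) 1 ** P i"
    and idem: "P 0 ** P 0 = P 0" "P n ** P n = P n"
    and close: "\<And>i v. i < n \<Longrightarrow>
      K (Suc i) * norm (A ((f ^^ i) p) 1 *v v - A ((f ^^ i) y) 1 *v v) \<le> \<eta> * norm v"
    and close': "\<And>v. norm (P 0 *v v - P n *v v) \<le> \<eta> * norm v" and \<eta>: "\<eta> \<ge> 0"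
    and v: "P 0 *v v = v"
  shows "exp (t * real n * real k) * norm v \<le> L * norm (A p (int (n * k)) *v v)"
proof -
  interpret r: cocycle "inv f" "reverse_cocycle A" by (rule cocycle_reverse)
  define U where "U i w = adapted_norm A (t + e) ((f ^^ i) y) (P i) w" for i w
  define S where "S i w = adapted_norm (reverse_cocycle A) (- t + e) ((f ^^ i) y) (mat 1 - P i) w" for i w
  have d1: "backward_bounded A (t + e) ((f ^^ i) y) (P i) (K i)"
    and d2: "backward_bounded (reverse_cocycle A) (- t + e) ((f ^^ i) y) (mat 1 - P i) (K i)"
    if "i \<le> n" for i using dich [OF that] by (auto simp: dichotomy_def)
  note U_perturb = adapted_norm_perturb [OF d1, folded U_def]
    and S_perturb = r.adapted_norm_perturb [OF d2, folded S_def]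
    and U_nn = adapted_norm_nonneg [OF d1, folded U_def]
    and S_nn = r.adapted_norm_nonneg [OF d2, folded S_def]
  have norm_le: "norm w \<le> U i w + S i w" if "i \<le> n" for i w
  proof -
    have "norm w = norm (P i *v w + (mat 1 - P i) *v w)"
      by (simp add: matrix_vector_mult_diff_rdistrib)
    also have "\<dots> \<le> norm (P i *v w) + norm ((mat 1 - P i) *v w)" by (rule norm_triangle_ineq)
    also have "\<dots> \<le> U i w + S i w"
      unfolding U_def S_def
      by (intro add_mono norm_projection_le_adapted [OF d1] r.norm_projection_le_adapted [OF d2] that)
    finally show ?thesis .
  qed
  have U_exp: "exp (t + e) * U i w \<le> U (Suc i) (A ((f ^^ i) y) 1 *v w)" if "i < n" for i w
    unfolding U_def using adapted_norm_expands [of "t + e" "(f ^^ i) y" "P (Suc i)"] d1 [of "Suc i"] eqv that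
    by simp
  have S_contr: "S (Suc i) (A ((f ^^ i) y) 1 *v w) \<le> exp (t - e) * S i w" if i: "i < n" for i w
  proof -
    let ?x = "(f ^^ i) y" and ?A = "A ((f ^^ i) y) 1"
    have inv: "inv f (f ?x) = ?x" using bij by (simp add: bij_is_inj)
    have it: "iterate f 1 ?x = f ?x" by (simp add: iterate_def)
    have li: "A (f ?x) (- 1) *v (?A *v z) = z" for z using inverse_left [of 1 ?x z] by (simp add: it)
    have "(mat 1 - P i) ** reverse_cocycle A (f ?x) 1 = reverse_cocycle A (f ?x) 1 ** (mat 1 - P (Suc i))"
      using equivariance_inverse [OF eqv [OF i]] by (simp add: reverse_cocycle_def)
    then have "exp (- t + e) * S (Suc i) (?A *v w) \<le> S i (A (f ?x) (- 1) *v (?A *v w))"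
      using r.adapted_norm_expands [of "- t + e" "f ?x" "mat 1 - P i" "K i" "mat 1 - P (Suc i)" "?A *v w"]
        d2 [of i] i
      unfolding S_def by (simp add: inv reverse_cocycle_def)
    then have "exp (- t + e) * S (Suc i) (?A *v w) \<le> S i w" by (simp add: li)
    then have "exp (t - e) * (exp (- t + e) * S (Suc i) (?A *v w)) \<le> exp (t - e) * S i w"
      by (intro mult_left_mono) auto
    then show ?thesis by (simp add: mult.assoc [symmetric] exp_add [symmetric])
  qed
  have period: "S 0 (A p (int n) *v w) \<le> U 0 (A p (int n) *v w) \<and>
      exp (t * real n) * U 0 w \<le> U 0 (A p (int n) *v w)" if w: "S 0 w \<le> U 0 w" for w
  proof -
    define z where "z i = A p (int i) *v w" for i
    have z_Suc: "z (Suc i) = A ((f ^^ i) p) 1 *v z i" for i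
      using at_add [of p 1 "int i" w] by (simp add: z_def iterate_of_nat add.commute)
    have z_n: "norm (z n) \<le> U n (z n) + S n (z n)" by (rule norm_le) simp
    have "(\<forall>i\<le>n. 0 \<le> U i (z i) \<and> 0 \<le> S i (z i))" using U_nn S_nn by blast
    moreover have "\<forall>i<n. exp (t + e) * U i (z i) - \<eta> * (U i (z i) + S i (z i)) \<le> U (Suc i) (z (Suc i)) \<and>
        S (Suc i) (z (Suc i)) \<le> exp (t - e) * S i (z i) + \<eta> * (U i (z i) + S i (z i))"
    proof (intro allI impI)
      fix i assume i: "i < n"
      let ?w = "A ((f ^^ i) y) 1 *v z i"
      have "K (Suc i) * norm (z (Suc i) - ?w) \<le> \<eta> * norm (z i)"
        using close [OF i, of "z i"] by (simp add: z_Suc)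
      also have "\<dots> \<le> \<eta> * (U i (z i) + S i (z i))"
        using norm_le [of i "z i"] i \<eta> by (intro mult_left_mono) auto
      finally have err: "K (Suc i) * norm (z (Suc i) - ?w) \<le> \<eta> * (U i (z i) + S i (z i))" .
      have "U (Suc i) ?w \<le> U (Suc i) (z (Suc i)) + K (Suc i) * norm (z (Suc i) - ?w)"
        using U_perturb [of "Suc i" ?w "z (Suc i)"] i by (simp add: norm_minus_commute)
      moreover have "S (Suc i) (z (Suc i)) \<le> S (Suc i) ?w + K (Suc i) * norm (z (Suc i) - ?w)"
        using S_perturb [of "Suc i" "z (Suc i)" ?w] i by simp
      ultimately show "exp (t + e) * U i (z i) - \<eta> * (U i (z i) + S i (z i)) \<le> U (Suc i) (z (Suc i)) \<and>
        S (Suc i) (z (Suc i)) \<le> exp (t - e) * S i (z i) + \<eta> * (U i (z i) + S i (z i))"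
        using err U_exp [OF i, of "z i"] S_contr [OF i, of "z i"] by linarith
    qed
    moreover have "U n (z n) / L - \<eta> * (U n (z n) + S n (z n)) \<le> U 0 (z n)"
    proof -
      have "U n (z n) \<le> K n * norm (P n *v z n)"
        unfolding U_def by (rule adapted_norm_idempotent [OF d1 idem(2)]) simp
      also have "\<dots> \<le> L * norm (P n *v z n)" using K by (intro mult_right_mono) auto
      finally have "U n (z n) / L \<le> norm (P n *v z n)" using L by (simp add: field_simps)
      also have "\<dots> \<le> norm (P 0 *v z n) + norm (P 0 *v z n - P n *v z n)"
        by (metis norm_minus_commute norm_triangle_sub)
      also have "norm (P 0 *v z n) \<le> U 0 (z n)"
        using norm_projection_le_adapted [OF d1, of 0] by (simp add: U_def)
      also have "norm (P 0 *v z n - P n *v z n) \<le> \<eta> * (U n (z n) + S n (z n))"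
        using close' [of "z n"] z_n \<eta> by (meson mult_left_mono order_trans)
      finally show ?thesis by simp
    qed
    moreover have "S 0 (z n) \<le> L * S n (z n) + L * \<eta> * (U n (z n) + S n (z n))"
    proof -
      have "(mat 1 - P 0) ** (mat 1 - P 0) = mat 1 - P 0"
        by (rule idempotent_complement [OF idem(1)])
      then have "S 0 (z n) \<le> K 0 * norm ((mat 1 - P 0) *v z n)"
        using r.adapted_norm_idempotent [OF d2, of 0] by (simp add: S_def)
      also have "\<dots> \<le> L * norm ((mat 1 - P 0) *v z n)" using K by (intro mult_right_mono) auto
      also have "(mat 1 - P 0) *v z n = (mat 1 - P n) *v z n - (P 0 *v z n - P n *v z n)"
        by (simp add: matrix_vector_mult_diff_rdistrib)
      also have "norm \<dots> \<le> norm ((mat 1 - P n) *v z n) + norm (P 0 *v z n - P n *v z n)"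
        by (rule norm_triangle_ineq4)
      also have "norm ((mat 1 - P n) *v z n) \<le> S n (z n)"
        using r.norm_projection_le_adapted [OF d2, of n] by (simp add: S_def)
      also have "norm (P 0 *v z n - P n *v z n) \<le> \<eta> * (U n (z n) + S n (z n))"
        using close' [of "z n"] z_n \<eta> by (meson mult_left_mono order_trans)
      finally show ?thesis using L by (simp add: algebra_simps)
    qed
    moreover have "S 0 (z 0) \<le> U 0 (z 0)" using w by (simp add: z_def)
    ultimately have "S 0 (z n) \<le> U 0 (z n) \<and> exp (t * real n) * U 0 (z 0) \<le> U 0 (z n)"
      by (rule cone_stepD [OF cone, of "\<lambda>i. U i (z i)" "\<lambda>i. S i (z i)"])
    then show ?thesis by (simp add: z_def)
  qed
  have pk: "(f ^^ (n * k)) p = p" for k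
    by (induction k) (use p in \<open>simp_all add: funpow_add\<close>)
  have S0: "S 0 v = 0"
    using r.adapted_norm_idempotent [OF d2 idempotent_complement [OF idem(1)], of v] S_nn [of 0 v] v
    by (simp add: S_def matrix_vector_mult_diff_rdistrib)
  have "S 0 (A p (int (n * k)) *v v) \<le> U 0 (A p (int (n * k)) *v v) \<and>
      exp (t * real n * real k) * U 0 v \<le> U 0 (A p (int (n * k)) *v v)"
  proof (induction k)
    case 0
    then show ?case using S0 U_nn [of 0 v] by simp
  next
    case (Suc k)
    let ?w = "A p (int (n * k)) *v v"
    have eq: "A p (int (n * Suc k)) *v v = A p (int n) *v ?w"
      using at_add [of p "int n" "int (n * k)" v] pk [of k] iterate_of_nat [of f "n * k" p]
      by simp
    have "t * real n * real (Suc k) = t * real n + t * real n * real k" by (simp add: algebra_simps)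
    then have "exp (t * real n * real (Suc k)) * U 0 v = exp (t * real n) * (exp (t * real n * real k) * U 0 v)"
      by (simp only: exp_add mult.assoc)
    also have "\<dots> \<le> exp (t * real n) * U 0 ?w" using Suc by (intro mult_left_mono) auto
    finally show ?case unfolding eq using period [of ?w] Suc by force
  qed
  moreover have "norm v \<le> U 0 v"
    using norm_projection_le_adapted [OF d1, of 0 v] v by (simp add: U_def)
  then have "exp (t * real n * real k) * norm v \<le> exp (t * real n * real k) * U 0 v"
    by (intro mult_left_mono) auto
  moreover have "U 0 (A p (int (n * k)) *v v) \<le> L * norm (A p (int (n * k)) *v v)"
  proof -
    have "U 0 (A p (int (n * k)) *v v) \<le> K 0 * norm (A p (int (n * k)) *v v)"
      using adapted_norm_le [OF d1, of 0] by (simp add: U_def)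
    also have "\<dots> \<le> L * norm (A p (int (n * k)) *v v)" using K by (intro mult_right_mono) auto
    finally show ?thesis .
  qed
  ultimately show ?thesis by linarith
qed

end

section \<open>Dichotomies at hyperbolic points\<close>

text \<open>The inequality for the dimensions, together with the trivial intersection, says that the slow
  spaces for the two time directions are complementary.\<close>

definition hyperbolic_at ::
    "('a \<Rightarrow> int \<Rightarrow> real^'m^'m) \<Rightarrow> real \<Rightarrow> real \<Rightarrow> 'a \<Rightarrow> bool" where
  "hyperbolic_at A t e x \<longleftrightarrow>
     slow_space A x (t - e) \<inter> slow_space (reverse_cocycle A) x (- t - e) = {0} \<and>
     CARD('m) \<le> dim (slow_space A x (t - e)) + dim (slow_space (reverse_cocycle A) x (- t - e))"

lemma backward_bounded_slow:
  assumes "backward_bounded A (t + e) x P l"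
  shows "P *v v \<in> slow_space (reverse_cocycle A) x (- t - e)"
proof -
  have "norm (reverse_cocycle A x (int k) *v (P *v v)) \<le> (l * norm v) * exp ((- t - e) * real k)" for k
  proof -
    have "exp ((t + e) * real k) * norm (A x (- int k) *v (P *v v)) \<le> l * norm v"
      using assms by (simp add: backward_bounded_def)
    then have "exp ((- t - e) * real k) * (exp ((t + e) * real k) * norm (A x (- int k) *v (P *v v)))
        \<le> exp ((- t - e) * real k) * (l * norm v)" by (intro mult_left_mono) auto
    moreover have "(- t - e) * real k + (t + e) * real k = 0" by (simp add: algebra_simps)
    ultimately show ?thesis
      unfolding mult.assoc [symmetric] exp_add [symmetric] by (simp add: reverse_cocycle_def mult_ac)
  qed
  then show ?thesis unfolding slow_space_def by blast
qed

lemma dichotomy_slow: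
  assumes "dichotomy A t e x P l"
  shows "P *v v \<in> slow_space (reverse_cocycle A) x (- t - e)" "v - P *v v \<in> slow_space A x (t - e)"
  using backward_bounded_slow [of A t e x P l v]
    backward_bounded_slow [of "reverse_cocycle A" "- t" e x "mat 1 - P" l v] assms
  by (auto simp: dichotomy_def matrix_vector_mult_diff_rdistrib)

lemma hyperbolic_at_reverse:
  "hyperbolic_at A t e x \<Longrightarrow> hyperbolic_at (reverse_cocycle A) (- t) e x"
  by (simp add: hyperbolic_at_def Int_commute add.commute)

lemma hyperbolic_at_eqI:
  assumes "hyperbolic_at A t e x" "v - w \<in> slow_space A x (t - e)"
    "v - w \<in> slow_space (reverse_cocycle A) x (- t - e)"
  shows "v = w"
proof -
  have "v - w \<in> {0}" using assms unfolding hyperbolic_at_def by blast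
  then show ?thesis by simp
qed

lemma dichotomy_fixes_slow:
  assumes H: "hyperbolic_at A t e x" and D: "dichotomy A t e x P l"
    and v: "v \<in> slow_space (reverse_cocycle A) x (- t - e)"
  shows "P *v v = v"
  using hyperbolic_at_eqI [OF H dichotomy_slow(2) [OF D]
      subspace_diff [OF subspace_slow_space v dichotomy_slow(1) [OF D]]] by simp

lemma dichotomy_idempotent:
  assumes "hyperbolic_at A t e x" "dichotomy A t e x P l"
  shows "P ** P = P"
  using dichotomy_fixes_slow [OF assms dichotomy_slow(1) [OF assms(2)]]
  by (simp add: matrix_eq flip: matrix_vector_mul_assoc)

text \<open>The difference of two such projections has values in the slow spaces for both time
  directions, which meet only in \<open>0\<close>.\<close>

lemma dichotomy_unique:
  assumes H: "hyperbolic_at A t e x" and D: "dichotomy A t e x P l" and D': "dichotomy A t e x P' l'"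
  shows "P = P'"
proof -
  have "P *v v = P' *v v" for v
  proof (rule hyperbolic_at_eqI [OF H])
    show "P *v v - P' *v v \<in> slow_space (reverse_cocycle A) x (- t - e)"
      by (intro subspace_diff [OF subspace_slow_space] dichotomy_slow(1) [OF D] dichotomy_slow(1) [OF D'])
    have "(v - P' *v v) - (v - P *v v) \<in> slow_space A x (t - e)"
      by (intro subspace_diff [OF subspace_slow_space] dichotomy_slow(2) [OF D] dichotomy_slow(2) [OF D'])
    then show "P *v v - P' *v v \<in> slow_space A x (t - e)" by simp
  qed
  then show ?thesis by (simp add: matrix_eq)
qed

lemma slow_space_uniform:
  obtains C where "C > 0" "\<And>n v. v \<in> slow_space A x a \<Longrightarrow> norm (A x (int n) *v v) \<le> C * exp (a * real n) * norm v"
proof -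
  have "\<exists>C. \<forall>n. norm (A x (int n) *v v) \<le> C * exp (a * real n)" if "v \<in> slow_space A x a" for v
    using that by (simp add: slow_space_def)
  then show ?thesis
    using pointwise_bounds_uniform_on_subspace [OF subspace_slow_space [of A x a],
      of "\<lambda>n v. A x (int n) *v v" "\<lambda>n. exp (a * real n)"] that
    by (metis exp_ge_zero matrix_vector_mul_linear)
qed

lemma dichotomy_exists:
  fixes A :: "'a \<Rightarrow> int \<Rightarrow> real^'m^'m"
  assumes H: "hyperbolic_at A t e x"
  shows "\<exists>P l. dichotomy A t e x P l"
proof -
  let ?S = "slow_space A x (t - e)" and ?U = "slow_space (reverse_cocycle A) x (- t - e)"
  have sub: "subspace ?S" "subspace ?U" by (rule subspace_slow_space)+
  have "dim {s + u |s u. s \<in> ?S \<and> u \<in> ?U} = dim ?S + dim ?U"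
    using dim_sums_Int [OF sub] H by (simp add: hyperbolic_at_def)
  then have "CARD('m) \<le> dim {s + u |s u. s \<in> ?S \<and> u \<in> ?U}"
    using H by (simp add: hyperbolic_at_def)
  then have "dim {s + u |s u. s \<in> ?S \<and> u \<in> ?U} = DIM(real^'m)"
    using dim_subset_UNIV [of "{s + u |s u. s \<in> ?S \<and> u \<in> ?U}"] by simp
  then have "span {s + u |s u. s \<in> ?S \<and> u \<in> ?U} = UNIV" by (rule dim_eq_full [THEN iffD1])
  then have UN: "{s + u |s u. s \<in> ?S \<and> u \<in> ?U} = UNIV"
    using span_eq_iff [THEN iffD2, OF subspace_sums [OF sub]] by (simp only:)
  have "\<exists>u\<in>?U. v - u \<in> ?S" for v
  proof -
    have "v \<in> {s + u |s u. s \<in> ?S \<and> u \<in> ?U}" using UN by simp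
    then obtain s u where "v = s + u" "s \<in> ?S" "u \<in> ?U" by blast
    then show ?thesis by (intro bexI [of _ u]) auto
  qed
  then obtain \<pi> where \<pi>: "\<And>v. \<pi> v \<in> ?U" "\<And>v. v - \<pi> v \<in> ?S" by metis
  have lin: "linear \<pi>"
  proof (rule linearI)
    fix v w
    show "\<pi> (v + w) = \<pi> v + \<pi> w"
    proof (rule hyperbolic_at_eqI [OF H])
      have "(v - \<pi> v) + (w - \<pi> w) - (v + w - \<pi> (v + w)) \<in> ?S"
        by (intro subspace_diff subspace_add sub \<pi>)
      then show "\<pi> (v + w) - (\<pi> v + \<pi> w) \<in> ?S" by (simp add: algebra_simps)
    qed (intro subspace_diff subspace_add sub \<pi>)
  next
    fix r v
    show "\<pi> (r *\<^sub>R v) = r *\<^sub>R \<pi> v"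
    proof (rule hyperbolic_at_eqI [OF H])
      have "r *\<^sub>R (v - \<pi> v) - (r *\<^sub>R v - \<pi> (r *\<^sub>R v)) \<in> ?S"
        by (intro subspace_diff subspace_scale sub \<pi>)
      then show "\<pi> (r *\<^sub>R v) - r *\<^sub>R \<pi> v \<in> ?S" by (simp add: algebra_simps)
    qed (intro subspace_diff subspace_scale sub \<pi>)
  qed
  define P where "P = matrix \<pi>"
  have P: "P *v v = \<pi> v" for v using lin by (simp add: P_def matrix_works)
  obtain C where C: "C > 0" "\<And>n v. v \<in> ?S \<Longrightarrow> norm (A x (int n) *v v) \<le> C * exp ((t - e) * real n) * norm v"
    using slow_space_uniform [of A x "t - e"] by blast
  obtain D where D: "D > 0" "\<And>n v. v \<in> ?U \<Longrightarrow>
      norm (reverse_cocycle A x (int n) *v v) \<le> D * exp ((- t - e) * real n) * norm v"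
    using slow_space_uniform [of "reverse_cocycle A" x "- t - e"] by blast
  obtain B where B: "B > 0" "\<And>v. norm (\<pi> v) \<le> B * norm v" using linear_bounded_pos [OF lin] by blast
  define l where "l = D * B + C * (1 + B)"
  have "exp ((t + e) * real k) * norm (A x (- int k) *v (P *v v)) \<le> l * norm v" for k v
  proof -
    have "exp ((t + e) * real k) * norm (A x (- int k) *v (P *v v))
        \<le> exp ((t + e) * real k) * (D * exp ((- t - e) * real k) * (B * norm v))"
      unfolding P using D(2) [OF \<pi>(1), of k v] B(2) [of v] D(1)
      by (intro mult_left_mono) (auto simp: reverse_cocycle_def intro: order_trans mult_left_mono)
    also have "\<dots> = (exp ((t + e) * real k) * exp ((- t - e) * real k)) * (D * B * norm v)"
      by (simp add: mult_ac)
    also have "exp ((t + e) * real k) * exp ((- t - e) * real k) = 1"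
      unfolding exp_add [symmetric] by (simp add: algebra_simps)
    also have "1 * (D * B * norm v) \<le> l * norm v"
      using C(1) B(1) by (simp add: l_def mult_right_mono)
    finally show ?thesis .
  qed
  moreover have "exp ((- t + e) * real k) * norm (A x (int k) *v ((mat 1 - P) *v v)) \<le> l * norm v" for k v
  proof -
    have "norm (v - \<pi> v) \<le> (1 + B) * norm v"
      using norm_triangle_ineq4 [of v "\<pi> v"] B(2) [of v] by (simp add: distrib_right)
    then have "exp ((- t + e) * real k) * norm (A x (int k) *v ((mat 1 - P) *v v))
        \<le> exp ((- t + e) * real k) * (C * exp ((t - e) * real k) * ((1 + B) * norm v))"
      using C(2) [OF \<pi>(2), of k v] C(1)
      by (intro mult_left_mono)
        (auto simp: matrix_vector_mult_diff_rdistrib P intro: order_trans mult_left_mono)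
    also have "\<dots> = (exp ((- t + e) * real k) * exp ((t - e) * real k)) * (C * (1 + B) * norm v)"
      by (simp only: mult_ac)
    also have "exp ((- t + e) * real k) * exp ((t - e) * real k) = 1"
      unfolding exp_add [symmetric] by (simp add: algebra_simps)
    also have "1 * (C * (1 + B) * norm v) \<le> l * norm v"
      using D(1) B(1) by (simp add: l_def mult_right_mono)
    finally show ?thesis .
  qed
  ultimately have "dichotomy A t e x P l"
    by (simp add: dichotomy_def backward_bounded_def reverse_cocycle_def)
  then show ?thesis by blast
qed

text \<open>The constant enters the levels of \<open>slow_variation_on_positive_measure\<close> through its logarithm,
  therefore it matters that one step changes it by a bounded factor only.\<close>

lemma (in cocycle) dichotomy_step:
  assumes D: "dichotomy A t e x P l"
    and bound: "\<And>x v. norm (A x 1 *v v) \<le> B * norm v" "\<And>x v. norm (A x (- 1) *v v) \<le> B * norm v"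
    and B: "B \<ge> 1" and s: "\<bar>t\<bar> + \<bar>e\<bar> \<le> s"
  shows "dichotomy A t e (f x) (A x 1 ** P ** A (f x) (- 1)) ((B\<^sup>2 + B * exp s) * l)"
proof -
  let ?Q = "A x 1 ** P ** A (f x) (- 1)" and ?l' = "(B\<^sup>2 + B * exp s) * l"
  have it: "iterate f 1 x = f x" by (simp add: iterate_def)
  have ri: "A x 1 *v (A (f x) (- 1) *v v) = v" for v using inverse_right [of x 1 v] by (simp add: it)
  have d1: "\<And>k v. exp ((t + e) * real k) * norm (A x (- int k) *v (P *v v)) \<le> l * norm v"
    and d2: "\<And>k v. exp ((- t + e) * real k) * norm (A x (int k) *v ((mat 1 - P) *v v)) \<le> l * norm v"
    using D by (auto simp: dichotomy_def backward_bounded_def reverse_cocycle_def)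
  have l: "l \<ge> 0" by (rule dichotomy_projection_bound(2) [OF D])
  have lw: "l * norm (A (f x) (- 1) *v v) \<le> l * B * norm v" for v
    using mult_left_mono [OF bound(2) l] by (simp add: mult.assoc)
  have Q: "A (f x) n *v (?Q *v v) = A x (n + 1) *v (P *v (A (f x) (- 1) *v v))" for n v
    using at_add [of x n 1 "P *v (A (f x) (- 1) *v v)"]
    by (simp add: it flip: matrix_vector_mul_assoc)
  have Q': "A (f x) n *v ((mat 1 - ?Q) *v v) = A x (n + 1) *v ((mat 1 - P) *v (A (f x) (- 1) *v v))" for n v
  proof -
    have "(mat 1 - ?Q) *v v = A x 1 *v ((mat 1 - P) *v (A (f x) (- 1) *v v))"
      by (simp add: matrix_vector_mult_diff_rdistrib matrix_vector_mult_diff_distrib ri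
          flip: matrix_vector_mul_assoc)
    then show ?thesis using at_add [of x n 1] by (simp add: it)
  qed
  have es: "exp (t + e) \<le> exp s" "exp (t - e) \<le> exp s" using s by auto
  have lB: "0 \<le> l * B * norm v" for v using l B by simp
  have "exp ((t + e) * real k) * norm (A (f x) (- int k) *v (?Q *v v)) \<le> ?l' * norm v" for k v
  proof (cases k)
    case 0
    let ?w = "A (f x) (- 1) *v v"
    have "norm (P *v ?w) \<le> l * norm ?w" using d1 [of 0 ?w] by simp
    then have "norm (P *v ?w) \<le> l * B * norm v" using lw [of v] by simp
    then have "B * norm (P *v ?w) \<le> B * (l * B * norm v)" using B by (intro mult_left_mono) auto
    then have "norm (A x 1 *v (P *v ?w)) \<le> B\<^sup>2 * l * norm v"
      using bound(1) [of x "P *v ?w"] by (simp add: power2_eq_square mult_ac)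
    moreover have "0 \<le> B * exp s * l * norm v" using B l by simp
    ultimately show ?thesis using Q [of 0 v] 0 by (simp add: distrib_right)
  next
    case (Suc j)
    let ?w = "A (f x) (- 1) *v v"
    have "exp ((t + e) * real k) * norm (A (f x) (- int k) *v (?Q *v v))
        = exp (t + e) * (exp ((t + e) * real j) * norm (A x (- int j) *v (P *v ?w)))"
      unfolding Q Suc by (simp add: exp_add [symmetric] distrib_left mult.assoc [symmetric] algebra_simps)
    also have "\<dots> \<le> exp s * (l * B * norm v)"
      by (rule mult_mono [OF es(1) order_trans [OF d1 lw]]) simp_all
    also have "\<dots> \<le> exp s * (l * B * norm v) + B\<^sup>2 * l * norm v" using l by simp
    also have "\<dots> = ?l' * norm v" by (simp add: algebra_simps)
    finally show ?thesis .
  qed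
  moreover have "exp ((- t + e) * real k) * norm (A (f x) (int k) *v ((mat 1 - ?Q) *v v)) \<le> ?l' * norm v" for k v
  proof -
    let ?w = "A (f x) (- 1) *v v"
    have "(- t + e) * real k = (t - e) + (- t + e) * real (Suc k)" by (simp add: algebra_simps)
    then have "exp ((- t + e) * real k) * norm (A (f x) (int k) *v ((mat 1 - ?Q) *v v))
        = exp (t - e) * (exp ((- t + e) * real (Suc k)) * norm (A x (int (Suc k)) *v ((mat 1 - P) *v ?w)))"
      unfolding Q' by (simp only: exp_add mult.assoc of_nat_Suc add.commute)
    also have "\<dots> \<le> exp s * (l * B * norm v)"
      by (rule mult_mono [OF es(2) order_trans [OF d2 lw]]) simp_all
    also have "\<dots> \<le> exp s * (l * B * norm v) + B\<^sup>2 * l * norm v" using l by simp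
    also have "\<dots> = ?l' * norm v" by (simp add: algebra_simps)
    finally show ?thesis .
  qed
  ultimately show ?thesis
    by (simp only: dichotomy_def backward_bounded_def reverse_reverse)
      (simp add: reverse_cocycle_def)
qed

text \<open>Since no exponent lies within \<open>e\<close> of \<open>t\<close>, the exponents below \<open>t - e\<close> and those above \<open>t + e\<close>
  exhaust the list, so the dimensions of the two slow spaces add up to the full dimension.\<close>

lemma (in cocycle) oseledets_imp_hyperbolic:
  assumes O: "oseledets_at A x chis E" and len: "length chis = CARD('m)"
    and e: "e > 0" and gap: "\<And>c. c \<in> set chis \<Longrightarrow> \<bar>c - t\<bar> > e"
  shows "hyperbolic_at A t e x"
    "length (filter (\<lambda>c. c < t) chis) \<le> dim (slow_space A x (t - e))"
    "length (filter (\<lambda>c. t < c) chis) \<le> dim (slow_space (reverse_cocycle A) x (- t - e))"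
proof -
  have "filter (\<lambda>c. c < t - e) chis = filter (\<lambda>c. c < t) chis"
    "filter (\<lambda>c. - c < - t - e) chis = filter (\<lambda>c. t < c) chis"
    using gap e by (intro filter_cong refl; force simp: abs_less_iff)+
  then show d: "length (filter (\<lambda>c. c < t) chis) \<le> dim (slow_space A x (t - e))"
    "length (filter (\<lambda>c. t < c) chis) \<le> dim (slow_space (reverse_cocycle A) x (- t - e))"
    using dim_slow_space_ge [OF O] by metis+
  have "filter (\<lambda>c. \<not> c < t) chis = filter (\<lambda>c. t < c) chis"
    using gap e by (intro filter_cong refl) force
  then have "length (filter (\<lambda>c. c < t) chis) + length (filter (\<lambda>c. t < c) chis) = CARD('m)"
    using sum_length_filter_compl [of "\<lambda>c. c < t" chis] len by simp
  moreover have "slow_space A x (t - e) \<inter> slow_space (reverse_cocycle A) x (- t - e) = {0}"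
    using slow_spaces_transversal [OF O, of "t - e" "t + e"] e by simp
  ultimately show "hyperbolic_at A t e x" using d by (simp add: hyperbolic_at_def)
qed

section \<open>Hoelder cocycles over a compact space\<close>

lemma continuous_on_matrix_vector_mult:
  fixes M :: "'b::topological_space \<Rightarrow> real^'n^'m"
  assumes "continuous_on S M" "continuous_on S w"
  shows "continuous_on S (\<lambda>x. M x *v w x)"
  unfolding matrix_vector_mult_def
  by (intro continuous_on_vec_lambda continuous_on_sum continuous_on_mult continuous_on_component assms)

lemma continuous_on_matrixI:
  fixes M :: "'b::topological_space \<Rightarrow> real^'n^'m"
  assumes "\<And>v. continuous_on S (\<lambda>x. M x *v v)"
  shows "continuous_on S M"
proof -
  have "continuous_on S (\<lambda>x. \<chi> i j. (M x *v axis j 1) $ i)"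
    by (intro continuous_on_vec_lambda continuous_on_component assms)
  moreover have "(\<chi> i j. (M x *v axis j 1) $ i) = M x" for x
    by (simp add: vec_eq_iff matrix_vector_mult_basis column_def)
  ultimately show ?thesis by simp
qed

lemma Hoelder_imp_continuous_on:
  fixes F :: "'a::metric_space \<Rightarrow> 'b::real_normed_vector"
  assumes bound: "\<And>x y. norm (F x - F y) \<le> C * dist (g x) (g y) powr \<alpha>"
    and g: "continuous_on UNIV g" and \<alpha>: "\<alpha> > 0"
  shows "continuous_on UNIV F"
  unfolding continuous_on_def
proof
  fix x
  have "(g \<longlongrightarrow> g x) (at x)" using g unfolding continuous_on_def by blast
  then have "((\<lambda>y. dist (g y) (g x)) \<longlongrightarrow> 0) (at x)" by (rule tendsto_dist_iff [THEN iffD1])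
  then have "((\<lambda>y. dist (g y) (g x) powr \<alpha>) \<longlongrightarrow> 0) (at x)"
    using \<alpha> by (intro tendsto_zero_powrI [OF _ tendsto_const]) auto
  then have "((\<lambda>y. C * dist (g y) (g x) powr \<alpha>) \<longlongrightarrow> 0) (at x)"
    by (rule tendsto_mult_right_zero)
  then have "((\<lambda>y. F y - F x) \<longlongrightarrow> 0) (at x)"
    by (rule Lim_null_comparison [rotated]) (use bound in auto)
  then show "(F \<longlongrightarrow> F x) (at x)" by (rule LIM_zero_cancel)
qed

lemma compact_bounded_matrices: "compact {P :: real^'n^'m. \<forall>v. norm (P *v v) \<le> l * norm v}"
  unfolding compact_eq_bounded_closed
proof
  show "bounded {P :: real^'n^'m. \<forall>v. norm (P *v v) \<le> l * norm v}"
  proof (rule boundedI)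
    fix P :: "real^'n^'m" assume P: "P \<in> {P. \<forall>v. norm (P *v v) \<le> l * norm v}"
    have "norm P \<le> (\<Sum>i\<in>UNIV. norm (P $ i))" unfolding norm_vec_def by (rule L2_set_le_sum) simp
    also have "\<dots> \<le> (\<Sum>i\<in>(UNIV::'m set). \<Sum>j\<in>(UNIV::'n set). \<bar>P $ i $ j\<bar>)"
      by (intro sum_mono norm_le_l1_cart)
    also have "\<dots> \<le> (\<Sum>i\<in>(UNIV::'m set). \<Sum>j\<in>(UNIV::'n set). l)"
    proof (intro sum_mono)
      fix i :: 'm and j :: 'n
      have "\<bar>P $ i $ j\<bar> = \<bar>(P *v axis j 1) $ i\<bar>" by (simp add: matrix_vector_mult_basis column_def)
      also have "\<dots> \<le> norm (P *v axis j 1)" by (rule component_le_norm_cart)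
      also have "\<dots> \<le> l" using P by (auto simp: norm_axis_1 dest: spec [of _ "axis j 1"])
      finally show "\<bar>P $ i $ j\<bar> \<le> l" .
    qed
    finally show "norm P \<le> (\<Sum>i\<in>(UNIV::'m set). \<Sum>j\<in>(UNIV::'n set). l)" .
  qed
  have "closed {P :: real^'n^'m. norm (P *v v) \<le> l * norm v}" for v
    by (intro closed_Collect_le continuous_on_norm continuous_on_matrix_vector_mult continuous_intros)
  then have "closed (\<Inter>v. {P :: real^'n^'m. norm (P *v v) \<le> l * norm v})" by blast
  also have "(\<Inter>v. {P :: real^'n^'m. norm (P *v v) \<le> l * norm v}) = {P. \<forall>v. norm (P *v v) \<le> l * norm v}"
    by blast
  finally show "closed {P :: real^'n^'m. \<forall>v. norm (P *v v) \<le> l * norm v}" .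
qed

lemma norm_matrix_vector_mult_le: "norm (M *v v) \<le> real CARD('m) * norm M * norm v" for M :: "real^'n^'m"
proof -
  have "norm (M *v v) \<le> (\<Sum>i\<in>UNIV. \<bar>(M *v v) $ i\<bar>)" by (rule norm_le_l1_cart)
  also have "\<dots> \<le> (\<Sum>i\<in>(UNIV::'m set). norm M * norm v)"
  proof (rule sum_mono)
    fix i
    have "\<bar>(M *v v) $ i\<bar> \<le> norm (M $ i) * norm v"
      unfolding matrix_vector_mul_component by (rule Cauchy_Schwarz_ineq2)
    also have "\<dots> \<le> norm M * norm v" by (intro mult_right_mono Finite_Cartesian_Product.norm_nth_le) simp
    finally show "\<bar>(M *v v) $ i\<bar> \<le> norm M * norm v" .
  qed
  finally show ?thesis by simp
qed

locale holder_cocycle = cocycle f A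
  for f :: "'a::metric_space \<Rightarrow> 'a" and A :: "'a \<Rightarrow> int \<Rightarrow> real^'m^'m" +
  fixes H \<alpha> :: real
  assumes compact_space: "compact (UNIV :: 'a set)"
    and cont: "continuous_on UNIV f" and cont_inv: "continuous_on UNIV (inv f)"
    and \<alpha>: "\<alpha> > 0" and H: "H \<ge> 0"
    and holder: "norm (A x 1 *v v - A y 1 *v v) \<le> H * dist x y powr \<alpha> * norm v"
begin

lemma continuous_at_1: "continuous_on UNIV (\<lambda>x. A x 1)"
proof (rule continuous_on_matrixI)
  fix v
  show "continuous_on UNIV (\<lambda>x. A x 1 *v v)"
    by (rule Hoelder_imp_continuous_on [where g = "\<lambda>x. x" and C = "H * norm v" and \<alpha> = \<alpha>])
      (use holder \<alpha> in \<open>auto simp: mult_ac intro: continuous_intros\<close>)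
qed

text \<open>The continuous function \<open>norm (A x 1 *v v)\<close> has a positive minimum on the compact product of the space
  and the unit sphere; this bounds the inverse matrices.\<close>

lemma uniform_bound:
  obtains D where "D \<ge> 1" "\<And>x v. norm (A x 1 *v v) \<le> D * norm v" "\<And>x v. norm (A x (- 1) *v v) \<le> D * norm v"
proof -
  let ?S = "UNIV \<times> sphere 0 1 :: ('a \<times> (real^'m)) set" and ?h = "\<lambda>(x, v). norm (A x 1 *v v)"
  have comp: "compact ?S" by (intro compact_Times compact_space compact_sphere)
  have "(axis undefined 1 :: real^'m) \<in> sphere 0 1" by (simp add: norm_axis_1)
  then have ne: "?S \<noteq> {}" by blast
  have h: "continuous_on ?S ?h"
    unfolding case_prod_beta
    by (intro continuous_on_norm continuous_on_matrix_vector_mult continuous_on_snd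
        continuous_on_compose2 [OF continuous_at_1] continuous_on_fst continuous_on_id) auto
  obtain m where m: "m \<in> ?S" "\<And>z. z \<in> ?S \<Longrightarrow> ?h m \<le> ?h z"
    using continuous_attains_inf [OF comp ne h] by blast
  obtain M where M: "M \<in> ?S" "\<And>z. z \<in> ?S \<Longrightarrow> ?h z \<le> ?h M"
    using continuous_attains_sup [OF comp ne h] by blast
  define a where "a = ?h m"
  have "snd m \<noteq> 0" using m(1) by (cases m) auto
  then have a: "a > 0" unfolding a_def using at_nonzero [of "snd m" "fst m" 1] by (simp add: case_prod_beta)
  have hom: "norm (A x 1 *v v) = norm v * ?h (x, v /\<^sub>R norm v)" if "v \<noteq> 0" for x v
    using that by (simp add: matrix_vector_mult_scaleR)
  have up: "norm (A x 1 *v v) \<le> ?h M * norm v" for x v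
  proof (cases "v = 0")
    case False
    then have "(x, v /\<^sub>R norm v) \<in> ?S" by simp
    then have "?h (x, v /\<^sub>R norm v) \<le> ?h M" by (rule M(2))
    then show ?thesis unfolding hom [OF False, of x] by (subst mult.commute) (rule mult_right_mono, simp_all)
  qed simp
  have lo: "a * norm v \<le> norm (A x 1 *v v)" for x v
  proof (cases "v = 0")
    case False
    then have "(x, v /\<^sub>R norm v) \<in> ?S" by simp
    then have "a \<le> ?h (x, v /\<^sub>R norm v)" using m(2) unfolding a_def by blast
    then show ?thesis unfolding hom [OF False, of x] by (subst mult.commute) (rule mult_left_mono, simp_all)
  qed simp
  have up': "norm (A x (- 1) *v v) \<le> (1 / a) * norm v" for x v
  proof -
    let ?y = "iterate f (- 1) x"
    have "A ?y 1 *v (A x (- 1) *v v) = v" using inverse_left [of "-1" x v] by simp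
    then have "a * norm (A x (- 1) *v v) \<le> norm v" using lo [of "A x (- 1) *v v" ?y] by simp
    then show ?thesis using a by (simp add: field_simps)
  qed
  define D where "D = max 1 (max (?h M) (1 / a))"
  have D: "1 \<le> D" "?h M \<le> D" "1 / a \<le> D" unfolding D_def by auto
  have "norm (A x 1 *v v) \<le> D * norm v" "norm (A x (- 1) *v v) \<le> D * norm v" for x v
    using order_trans [OF up mult_right_mono [OF D(2) norm_ge_zero]]
      order_trans [OF up' mult_right_mono [OF D(3) norm_ge_zero]] by auto
  then show ?thesis using D(1) that by blast
qed

lemma inverse_holder:
  assumes D: "\<And>x v. norm (A x (- 1) *v v) \<le> D * norm v" "D \<ge> 0"
  shows "norm (A x (- 1) *v v - A y (- 1) *v v) \<le> D\<^sup>2 * H * dist (inv f x) (inv f y) powr \<alpha> * norm v"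
proof -
  have it: "iterate f (- 1) z = inv f z" for z by (simp add: iterate_def)
  let ?B = "A (inv f x) 1" and ?C = "A (inv f y) 1" and ?w = "A x (- 1) *v v"
  have li: "A y (- 1) *v (?C *v u) = u" for u
    using inverse_right [of y "-1" u] by (simp add: it)
  have ri: "?B *v ?w = v" using inverse_left [of "-1" x v] by (simp add: it)
  have "?w - A y (- 1) *v v = A y (- 1) *v (?C *v ?w - ?B *v ?w)"
    by (simp add: matrix_vector_mult_diff_distrib li ri)
  then have "norm (?w - A y (- 1) *v v) \<le> D * norm (?C *v ?w - ?B *v ?w)" using D by metis
  also have "\<dots> \<le> D * (H * dist (inv f x) (inv f y) powr \<alpha> * norm ?w)"
    using holder [of "inv f y" ?w "inv f x"] D(2) by (intro mult_left_mono) (auto simp: dist_commute)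
  also have "\<dots> \<le> D * (H * dist (inv f x) (inv f y) powr \<alpha> * (D * norm v))"
    using D H by (intro mult_left_mono) auto
  also have "\<dots> = D\<^sup>2 * H * dist (inv f x) (inv f y) powr \<alpha> * norm v"
    by (simp add: power2_eq_square mult_ac)
  finally show ?thesis .
qed

lemma continuous_iterate: "continuous_on UNIV (iterate f n)"
proof -
  have "continuous_on UNIV (f ^^ k)" "continuous_on UNIV (inv f ^^ k)" for k
    by (induction k)
      (auto intro: continuous_on_compose2 [OF cont] continuous_on_compose2 [OF cont_inv])
  then show ?thesis unfolding iterate_def by simp
qed

lemma continuous_cocycle: "continuous_on UNIV (\<lambda>x. A x n)"
proof -
  obtain D where D: "D \<ge> 1" "\<And>x v. norm (A x (- 1) *v v) \<le> D * norm v" using uniform_bound by metis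
  have m1: "continuous_on UNIV (\<lambda>x. A x (- 1))"
  proof (rule continuous_on_matrixI)
    fix v
    show "continuous_on UNIV (\<lambda>x. A x (- 1) *v v)"
      by (rule Hoelder_imp_continuous_on [where g = "inv f" and C = "D\<^sup>2 * H * norm v" and \<alpha> = \<alpha>, OF _ cont_inv \<alpha>])
        (use inverse_holder [OF D(2)] D(1) in \<open>auto simp: mult_ac\<close>)
  qed
  have step: "continuous_on UNIV (\<lambda>x. A x (k + n))"
    if "continuous_on UNIV (\<lambda>x. A x n)" "continuous_on UNIV (\<lambda>x. A x k)" for n k
  proof (rule continuous_on_matrixI)
    fix v
    have "continuous_on UNIV (\<lambda>x. A (iterate f n x) k)"
      by (rule continuous_on_compose2 [OF that(2) continuous_iterate]) auto
    then have "continuous_on UNIV (\<lambda>x. A (iterate f n x) k *v (A x n *v v))"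
      by (intro continuous_on_matrix_vector_mult that(1) continuous_on_const)
    then show "continuous_on UNIV (\<lambda>x. A x (k + n) *v v)" by (simp only: at_add)
  qed
  show ?thesis
  proof (induction n rule: int_induct [where k = 0])
    case base
    then show ?case by simp
  next
    case (step1 i)
    then show ?case using step [OF step1(2) continuous_at_1] by (simp add: add.commute)
  next
    case (step2 i)
    then show ?case using step [OF step2(2) m1] by (simp add: algebra_simps)
  qed
qed

definition good_set :: "real \<Rightarrow> real \<Rightarrow> real \<Rightarrow> 'a set" where
  "good_set t e l = {x. \<exists>P. dichotomy A t e x P l}"

text \<open>The matrices \<open>P\<close> that can occur are bounded by \<open>l\<close>, so the set is the projection of a compact
  set. This makes it a Borel set although the splitting need not depend measurably on the point.\<close>

lemma closed_good_set: "closed (good_set t e l)"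
proof -
  let ?K = "{P :: real^'m^'m. \<forall>v. norm (P *v v) \<le> l * norm v}"
  let ?Z = "{(x, P). dichotomy A t e x P l}"
  have 1: "closed {(x::'a, P :: real^'m^'m). exp (b * real k) * norm (A x n *v (P *v v)) \<le> r}" for b k n v r
    unfolding case_prod_beta
    by (intro closed_Collect_le continuous_intros continuous_on_norm continuous_on_matrix_vector_mult
        continuous_on_compose2 [OF continuous_cocycle]) auto
  have 2: "closed {(x::'a, P :: real^'m^'m). exp (b * real k) * norm (A x n *v ((mat 1 - P) *v v)) \<le> r}" for b k n v r
    unfolding case_prod_beta
    by (intro closed_Collect_le continuous_intros continuous_on_norm continuous_on_matrix_vector_mult
        continuous_on_compose2 [OF continuous_cocycle]) auto
  have "?Z = (\<Inter>k v. {(x, P). exp ((t + e) * real k) * norm (A x (- int k) *v (P *v v)) \<le> l * norm v})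
      \<inter> (\<Inter>k v. {(x, P). exp ((- t + e) * real k) * norm (A x (int k) *v ((mat 1 - P) *v v)) \<le> l * norm v})"
    unfolding dichotomy_def backward_bounded_def reverse_cocycle_def by auto
  also have "closed \<dots>" by (intro closed_Int closed_INT ballI 1 2)
  finally have Z: "closed ?Z" .
  have "compact ((UNIV :: 'a set) \<times> ?K)" by (intro compact_Times compact_space compact_bounded_matrices)
  then have "compact ((UNIV \<times> ?K) \<inter> ?Z)" using Z by (rule compact_Int_closed)
  then have "compact (fst ` ((UNIV \<times> ?K) \<inter> ?Z))"
    by (intro compact_continuous_image continuous_on_fst continuous_on_id)
  moreover have "fst ` ((UNIV \<times> ?K) \<inter> ?Z) = good_set t e l"
    using dichotomy_projection_bound(1) unfolding good_set_def by (force simp: image_iff)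
  ultimately show ?thesis by (simp add: compact_imp_closed)
qed

lemma good_set_mono: "l \<le> l' \<Longrightarrow> good_set t e l \<subseteq> good_set t e l'"
  unfolding good_set_def using dichotomy_mono [of A t e _ _ l l'] by blast

lemma good_set_step:
  assumes x: "x \<in> good_set t e l"
    and bound: "\<And>x v. norm (A x 1 *v v) \<le> B * norm v" "\<And>x v. norm (A x (- 1) *v v) \<le> B * norm v"
    and B: "B \<ge> 1" and s: "\<bar>t\<bar> + \<bar>e\<bar> \<le> s"
  shows "f x \<in> good_set t e ((B\<^sup>2 + B * exp s) * l)" "inv f x \<in> good_set t e ((B\<^sup>2 + B * exp s) * l)"
proof -
  obtain P where P: "dichotomy A t e x P l" using x unfolding good_set_def by blast
  show "f x \<in> good_set t e ((B\<^sup>2 + B * exp s) * l)"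
    using dichotomy_step [OF P bound B s] unfolding good_set_def by blast
  have "dichotomy (reverse_cocycle A) (- t) e x (mat 1 - P) l" by (rule dichotomy_reverse [OF P])
  then obtain Q where "dichotomy (reverse_cocycle A) (- t) e (inv f x) Q ((B\<^sup>2 + B * exp s) * l)"
    using cocycle.dichotomy_step [OF cocycle_reverse, of "- t" e x "mat 1 - P" l B s] bound B s
    by (auto simp: reverse_cocycle_def)
  from dichotomy_reverse [OF this]
  show "inv f x \<in> good_set t e ((B\<^sup>2 + B * exp s) * l)" unfolding good_set_def by auto
qed

end

context holder_cocycle
begin

lemma dichotomy_equivariant:
  assumes "dichotomy A t e x P l" "dichotomy A t e (f x) P' l'" "hyperbolic_at A t e (f x)"
  shows "P' ** A x 1 = A x 1 ** P"
proof -
  obtain D where D: "D \<ge> 1" "\<And>x v. norm (A x 1 *v v) \<le> D * norm v"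
    "\<And>x v. norm (A x (- 1) *v v) \<le> D * norm v" using uniform_bound by metis
  have "P' = A x 1 ** P ** A (f x) (- 1)"
    by (rule dichotomy_unique [OF assms(3,2) dichotomy_step [OF assms(1) D(2,3,1) order_refl]])
  moreover have "A (f x) (- 1) *v (A x 1 *v u) = u" for u
    using inverse_left [of 1 x u] by (simp add: iterate_def)
  ultimately show ?thesis by (simp add: matrix_eq flip: matrix_vector_mul_assoc)
qed

end

section \<open>From growth to the number of exponents\<close>

lemma dim_growth_plus_dim_slow_le:
  fixes B :: "'a \<Rightarrow> int \<Rightarrow> real^'m^'m"
  assumes W: "subspace W" and a: "a < t" and n: "n > 0"
    and grow: "\<And>v k. v \<in> W \<Longrightarrow> exp (t * real n * real k) * norm v \<le> L * norm (B p (int (n * k)) *v v)"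
    and L: "L \<ge> 0"
  shows "dim W + dim (slow_space B p a) \<le> CARD('m)"
proof -
  have zero: "v = 0" if v: "v \<in> W" "v \<in> slow_space B p a" for v
  proof (rule ccontr)
    assume nz: "v \<noteq> 0"
    obtain C where C: "\<And>n. norm (B p (int n) *v v) \<le> C * exp (a * real n)"
      using v(2) unfolding slow_space_def by blast
    have "exp ((t * real n) * real k) \<le> (L * C / norm v) * exp ((a * real n) * real k)" for k
    proof -
      have "exp (t * real n * real k) * norm v \<le> L * (C * exp (a * real (n * k)))"
        using grow [OF v(1), of k] C [of "n * k"] L by (meson mult_left_mono order_trans)
      then show ?thesis using nz by (simp add: field_simps)
    qed
    then have "t * real n \<le> a * real n" by (rule exp_rate_le [OF always_eventually [OF allI]])
    then show False using a n by simp
  qed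
  then have "W \<inter> slow_space B p a = {0}"
    using subspace_0 [OF W] subspace_0 [OF subspace_slow_space, of B p a] zero by auto
  then have "dim W + dim (slow_space B p a) = dim {x + y |x y. x \<in> W \<and> y \<in> slow_space B p a}"
    using dim_sums_Int [OF W subspace_slow_space, of B p a] by simp
  also have "\<dots> \<le> CARD('m)"
    using dim_subset_UNIV [of "{x + y |x y. x \<in> W \<and> y \<in> slow_space B p a}"] by simp
  finally show ?thesis .
qed

lemma filter_less_perturb:
  fixes \<phi> :: "'b \<Rightarrow> real"
  shows "\<exists>a<s. filter (\<lambda>c. \<phi> c < a) xs = filter (\<lambda>c. \<phi> c < s) xs"
proof -
  define m where "m = Max (insert (s - 1) {\<phi> c |c. c \<in> set xs \<and> \<phi> c < s})"
  have fin: "finite {\<phi> c |c. c \<in> set xs \<and> \<phi> c < s}" by simp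
  have m: "m < s" unfolding m_def using fin by (subst Max_less_iff) auto
  have "\<phi> c \<le> m" if "c \<in> set xs" "\<phi> c < s" for c
    unfolding m_def using fin that by (intro Max_ge) auto
  then have "filter (\<lambda>c. \<phi> c < (m + s) / 2) xs = filter (\<lambda>c. \<phi> c < s) xs"
    using m by (intro filter_cong refl) force
  then show ?thesis using m by (intro exI [of _ "(m + s) / 2"]) auto
qed

lemma sorted_nth_filter:
  assumes "sorted xs" "i < length xs" "\<And>x y. x \<le> y \<Longrightarrow> P y \<Longrightarrow> P x"
  shows "P (xs ! i) \<longleftrightarrow> i < length (filter P xs)"
  using assms(1,2)
proof (induction xs arbitrary: i)
  case (Cons x xs)
  show ?case
  proof (cases "P x")
    case True
    then show ?thesis using Cons by (cases i) auto
  next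
    case False
    then have "\<not> P y" if "y \<in> set (x # xs)" for y using that Cons.prems assms(3) by auto
    then have "filter P (x # xs) = []" "\<not> P ((x # xs) ! i)"
      using nth_mem [OF Cons.prems(2)] by (blast intro: filter_False)+
    then show ?thesis by simp
  qed
qed simp

lemma sorted_lists_close:
  fixes xs ys :: "real list"
  assumes xs: "sorted xs" "length xs = m" and ys: "sorted ys" "length ys = m"
    and low: "\<And>c. c \<in> set xs \<Longrightarrow>
      length (filter (\<lambda>y. y < c - d) ys) \<le> length (filter (\<lambda>x. x < c - d) xs)"
    and high: "\<And>c. c \<in> set xs \<Longrightarrow>
      length (filter (\<lambda>y. c + d < y) ys) \<le> length (filter (\<lambda>x. c + d < x) xs)"
    and d: "d \<ge> 0" and i: "i < m"
  shows "\<bar>xs ! i - ys ! i\<bar> \<le> d"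
proof -
  let ?c = "xs ! i"
  have c: "?c \<in> set xs" using i xs by simp
  have "\<not> i < length (filter (\<lambda>x. x < ?c - d) xs)"
    using sorted_nth_filter [OF xs(1), of i "\<lambda>x. x < ?c - d"] i xs d by auto
  then have "\<not> i < length (filter (\<lambda>y. y < ?c - d) ys)" using low [OF c] by simp
  then have 1: "\<not> ys ! i < ?c - d"
    using sorted_nth_filter [OF ys(1), of i "\<lambda>y. y < ?c - d"] i ys by auto
  have split: "length (filter (\<lambda>x. x \<le> ?c + d) zs) = length zs - length (filter (\<lambda>x. ?c + d < x) zs)" for zs
    using sum_length_filter_compl [of "\<lambda>x. ?c + d < x" zs] by (simp add: not_less)
  have "i < length (filter (\<lambda>x. x \<le> ?c + d) xs)"
    using sorted_nth_filter [OF xs(1), of i "\<lambda>x. x \<le> ?c + d"] i xs d by auto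
  also have "\<dots> \<le> length (filter (\<lambda>y. y \<le> ?c + d) ys)"
    unfolding split using high [OF c] xs ys by simp
  finally have "ys ! i \<le> ?c + d"
    using sorted_nth_filter [OF ys(1), of i "\<lambda>y. y \<le> ?c + d"] i ys by auto
  with 1 show ?thesis by simp
qed

lemma simultaneously_convergent_subsequence:
  fixes X :: "'i \<Rightarrow> nat \<Rightarrow> 'b::metric_space"
  assumes "finite T" "compact S" "\<And>t k. t \<in> T \<Longrightarrow> X t k \<in> S"
  shows "\<exists>r::nat \<Rightarrow> nat. strict_mono r \<and> (\<forall>t\<in>T. convergent (\<lambda>k. X t (r k)))"
  using assms(1,3)
proof (induction T rule: finite_induct)
  case empty
  show ?case by (intro exI [of _ id]) (simp add: strict_mono_def)
next
  case (insert t T)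
  then obtain r where r: "strict_mono r" "\<forall>t\<in>T. convergent (\<lambda>k. X t (r k))" by auto
  have "\<forall>k. X t (r k) \<in> S" using insert.prems by simp
  then obtain l r' where r': "strict_mono r'" "((\<lambda>k. X t (r k)) \<circ> r') \<longlonglongrightarrow> l"
    using assms(2) unfolding compact_def by meson
  have "convergent (\<lambda>k. X s (r (r' k)))" if "s \<in> T" for s
    using convergent_subseq_convergent [OF r(2) [rule_format, OF that] r'(1)] by (simp add: o_def)
  moreover have "convergent (\<lambda>k. X t (r (r' k)))" using r'(2) by (auto simp: convergent_def o_def)
  ultimately show ?case
    using strict_mono_o [OF r(1) r'(1)] by (intro exI [of _ "\<lambda>k. r (r' k)"]) (auto simp: o_def)
qed

text \<open>The vectors of the fast space of \<open>y\<close> grow so fast along the orbit of \<open>p\<close> that this space meets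
  the slow space of \<open>p\<close> only in \<open>0\<close>. The constants \<open>K i\<close> of the dichotomies may grow towards the
  middle of the segment exactly as fast as the distance of the two orbits, raised to the Hoelder
  exponent, decays there. The factor \<open>exp (\<alpha> * \<kappa>)\<close> in the smallness condition pays for the shift
  from \<open>i\<close> to \<open>Suc i\<close>: the error of step \<open>i\<close> is measured in the adapted norm at step \<open>Suc i\<close>.
  The second claim is the first one for the inverse map.\<close>

lemma (in holder_cocycle) shadowing_exponent_counts:
  assumes cone: "cone_step t e L \<eta> n" "cone_step (- t) e L \<eta> n" and \<eta>: "\<eta> \<ge> 0" and L: "L \<ge> 1"
    and D: "D \<ge> 1" "\<And>x v. norm (A x (- 1) *v v) \<le> D * norm v"
    and p: "(f ^^ n) p = p"
    and dich: "\<And>i. i \<le> n \<Longrightarrow> dichotomy A t e ((f ^^ i) y) (P i) (K i)"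
    and hyp: "\<And>i. i \<le> n \<Longrightarrow> hyperbolic_at A t e ((f ^^ i) y)"
    and K: "\<And>i. i \<le> n \<Longrightarrow> K i \<le> L * exp (\<alpha> * \<kappa> * real (min i (n - i)))"
    and \<kappa>: "\<kappa> \<ge> 0" and \<delta>: "\<delta> \<ge> 0"
    and close: "\<And>i. i \<le> n \<Longrightarrow> dist ((f ^^ i) y) ((f ^^ i) p) \<le> \<delta> * exp (- \<kappa> * real (min i (n - i)))"
    and small: "L * exp (\<alpha> * \<kappa>) * D\<^sup>2 * H * \<delta> powr \<alpha> \<le> \<eta>"
    and P: "\<And>v. norm (P 0 *v v - P n *v v) \<le> \<eta> * norm v"
    and n: "n > 0" and os: "oseledets_at A p chi' E'"
  shows "dim (slow_space (reverse_cocycle A) y (- t - e)) + length (filter (\<lambda>c. c < t) chi') \<le> CARD('m)"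
    and "dim (slow_space A ((f ^^ n) y) (t - e)) + length (filter (\<lambda>c. t < c) chi') \<le> CARD('m)"
proof -
  have idem: "P i ** P i = P i" if "i \<le> n" for i
    by (rule dichotomy_idempotent [OF hyp dich]) (use that in auto)
  have eqv: "P (Suc i) ** A ((f ^^ i) y) 1 = A ((f ^^ i) y) 1 ** P i" if "i < n" for i
    using dichotomy_equivariant [OF dich, of i "P (Suc i)" "K (Suc i)"] dich [of "Suc i"] hyp [of "Suc i"] that
    by simp
  have K0: "K 0 \<le> L" "K n \<le> L" using K [of 0] K [of n] by simp_all
  have dist_powr: "dist ((f ^^ i) y) ((f ^^ i) p) powr \<alpha> \<le> \<delta> powr \<alpha> * exp (- (\<alpha> * \<kappa> * real (min i (n - i))))"
    if "i \<le> n" for i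
  proof -
    have "dist ((f ^^ i) y) ((f ^^ i) p) powr \<alpha> \<le> (\<delta> * exp (- \<kappa> * real (min i (n - i)))) powr \<alpha>"
      using close [OF that] \<alpha> by (intro powr_mono2) auto
    also have "\<dots> = \<delta> powr \<alpha> * exp (- (\<alpha> * \<kappa> * real (min i (n - i))))"
      using \<delta> by (simp add: powr_mult exp_powr_real mult_ac)
    finally show ?thesis .
  qed
  have weight: "K j * (dist ((f ^^ i) y) ((f ^^ i) p) powr \<alpha>) \<le> L * exp (\<alpha> * \<kappa>) * \<delta> powr \<alpha>"
    if ij: "i \<le> n" "j \<le> n" "min j (n - j) \<le> min i (n - i) + 1" for i j
  proof -
    have "\<alpha> * \<kappa> * real (min j (n - j)) \<le> \<alpha> * \<kappa> * (real (min i (n - i)) + 1)"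
      using ij(3) \<alpha> \<kappa> by (intro mult_left_mono) auto
    then have "L * exp (\<alpha> * \<kappa> * real (min j (n - j))) \<le> L * exp (\<alpha> * \<kappa> * real (min i (n - i)) + \<alpha> * \<kappa>)"
      using L by (intro mult_left_mono) (simp_all add: distrib_left)
    then have "K j \<le> L * exp (\<alpha> * \<kappa> * real (min i (n - i)) + \<alpha> * \<kappa>)" using K [OF ij(2)] by linarith
    then have "K j * (dist ((f ^^ i) y) ((f ^^ i) p) powr \<alpha>)
        \<le> L * exp (\<alpha> * \<kappa> * real (min i (n - i)) + \<alpha> * \<kappa>) * (\<delta> powr \<alpha> * exp (- (\<alpha> * \<kappa> * real (min i (n - i)))))"
      using dist_powr [OF ij(1)] L by (intro mult_mono) auto
    also have "\<dots> = L * (exp (\<alpha> * \<kappa> * real (min i (n - i)) + \<alpha> * \<kappa>) * exp (- (\<alpha> * \<kappa> * real (min i (n - i))))) * \<delta> powr \<alpha>"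
      by (simp only: mult_ac)
    also have "exp (\<alpha> * \<kappa> * real (min i (n - i)) + \<alpha> * \<kappa>) * exp (- (\<alpha> * \<kappa> * real (min i (n - i)))) = exp (\<alpha> * \<kappa>)"
      unfolding exp_add [symmetric] by simp
    finally show ?thesis .
  qed
  have Knn: "K i \<ge> 0" if "i \<le> n" for i using dichotomy_projection_bound(2) [OF dich [OF that]] .
  have D2: "1 \<le> D\<^sup>2" using D(1) by (rule one_le_power)
  have step: "K j * (D\<^sup>2 * H * dist ((f ^^ i) y) ((f ^^ i) p) powr \<alpha> * norm v) \<le> \<eta> * norm v"
    if ij: "i \<le> n" "j \<le> n" "min j (n - j) \<le> min i (n - i) + 1" for i j and v :: "real^'m"
  proof -
    have "K j * (D\<^sup>2 * H * dist ((f ^^ i) y) ((f ^^ i) p) powr \<alpha> * norm v)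
        = (K j * (dist ((f ^^ i) y) ((f ^^ i) p) powr \<alpha>)) * (D\<^sup>2 * H * norm v)" by (simp only: mult_ac)
    also have "\<dots> \<le> (L * exp (\<alpha> * \<kappa>) * \<delta> powr \<alpha>) * (D\<^sup>2 * H * norm v)"
      using weight [OF ij] H by (intro mult_right_mono) auto
    also have "\<dots> = (L * exp (\<alpha> * \<kappa>) * D\<^sup>2 * H * \<delta> powr \<alpha>) * norm v" by (simp only: mult_ac)
    also have "\<dots> \<le> \<eta> * norm v" using small by (intro mult_right_mono) auto
    finally show ?thesis .
  qed
  have growth: "exp (t * real n * real k) * norm v \<le> L * norm (A p (int (n * k)) *v v)"
    if "P 0 *v v = v" for v k
  proof (rule growth_along_shadowing_orbit [OF cone(1) p dich K0 L eqv _ _ _ P \<eta> that])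
    fix i and v :: "real^'m" assume i: "i < n"
    have "norm (A ((f ^^ i) p) 1 *v v - A ((f ^^ i) y) 1 *v v) \<le> H * dist ((f ^^ i) p) ((f ^^ i) y) powr \<alpha> * norm v"
      by (rule holder)
    also have "\<dots> \<le> D\<^sup>2 * (H * dist ((f ^^ i) p) ((f ^^ i) y) powr \<alpha> * norm v)"
      using D2 H mult_right_mono [of 1 "D\<^sup>2" "H * dist ((f ^^ i) p) ((f ^^ i) y) powr \<alpha> * norm v"] by simp
    also have "\<dots> = D\<^sup>2 * H * dist ((f ^^ i) y) ((f ^^ i) p) powr \<alpha> * norm v"
      by (simp only: mult.assoc dist_commute)
    finally have "K (Suc i) * norm (A ((f ^^ i) p) 1 *v v - A ((f ^^ i) y) 1 *v v)
        \<le> K (Suc i) * (D\<^sup>2 * H * dist ((f ^^ i) y) ((f ^^ i) p) powr \<alpha> * norm v)"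
      using Knn [of "Suc i"] i by (intro mult_left_mono) auto
    also have "\<dots> \<le> \<eta> * norm v" by (rule step) (use i in auto)
    finally show "K (Suc i) * norm (A ((f ^^ i) p) 1 *v v - A ((f ^^ i) y) 1 *v v) \<le> \<eta> * norm v" .
  qed (simp_all add: idem)
  have backward: "(inv f ^^ i) ((f ^^ n) z) = (f ^^ (n - i)) z" if "i \<le> n" for i z
    using that
  proof (induction i)
    case (Suc i)
    then have "(f ^^ (n - i)) z = f ((f ^^ (n - Suc i)) z)"
      by (metis Suc_diff_Suc Suc_le_lessD comp_apply funpow.simps(2))
    then show ?case using Suc bij by (simp add: bij_is_inj)
  qed simp
  have invp: "(inv f ^^ n) p = p" using backward [of n p] p by simp
  have backp: "(inv f ^^ i) p = (f ^^ (n - i)) p" if "i \<le> n" for i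
    using backward [OF that, of p] p by simp
  have growth': "exp (- t * real n * real k) * norm v \<le> L * norm (reverse_cocycle A p (int (n * k)) *v v)"
    if v: "P n *v v = 0" for v k
  proof (rule cocycle.growth_along_shadowing_orbit [OF cocycle_reverse cone(2) invp,
        where y = "(f ^^ n) y" and P = "\<lambda>i. mat 1 - P (n - i)" and K = "\<lambda>i. K (n - i)"])
    show "dichotomy (reverse_cocycle A) (- t) e ((inv f ^^ i) ((f ^^ n) y)) (mat 1 - P (n - i)) (K (n - i))"
      if "i \<le> n" for i
      using dichotomy_reverse [OF dich, of "n - i"] that by (simp add: backward)
    show "(mat 1 - P (n - Suc i)) ** reverse_cocycle A ((inv f ^^ i) ((f ^^ n) y)) 1
        = reverse_cocycle A ((inv f ^^ i) ((f ^^ n) y)) 1 ** (mat 1 - P (n - i))" if i: "i < n" for i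
    proof -
      define j where "j = n - Suc i"
      have j: "n - i = Suc j" "j < n" using i by (auto simp: j_def)
      show ?thesis
        using equivariance_inverse [OF eqv [OF j(2)]] i
        by (simp add: backward j j_def [symmetric] reverse_cocycle_def)
    qed
    show "K (n - Suc i) * norm (reverse_cocycle A ((inv f ^^ i) p) 1 *v v
        - reverse_cocycle A ((inv f ^^ i) ((f ^^ n) y)) 1 *v v) \<le> \<eta> * norm v" if i: "i < n" for i v
    proof -
      define j where "j = n - Suc i"
      have j: "n - i = Suc j" "j < n" using i by (auto simp: j_def)
      have inv: "inv f ((f ^^ Suc j) z) = (f ^^ j) z" for z using bij by (simp add: bij_is_inj)
      have "norm (A ((f ^^ Suc j) p) (- 1) *v v - A ((f ^^ Suc j) y) (- 1) *v v)
          \<le> D\<^sup>2 * H * dist ((f ^^ j) y) ((f ^^ j) p) powr \<alpha> * norm v"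
        using inverse_holder [OF D(2), of "(f ^^ Suc j) p" v "(f ^^ Suc j) y"] D(1)
        unfolding inv by (simp add: dist_commute)
      then have "K j * norm (A ((f ^^ Suc j) p) (- 1) *v v - A ((f ^^ Suc j) y) (- 1) *v v)
          \<le> K j * (D\<^sup>2 * H * dist ((f ^^ j) y) ((f ^^ j) p) powr \<alpha> * norm v)"
        using Knn [of j] j by (intro mult_left_mono) auto
      also have "\<dots> \<le> \<eta> * norm v" by (rule step) (use j in auto)
      finally show ?thesis
        using i by (simp add: backward backp j j_def [symmetric] reverse_cocycle_def del: funpow.simps)
    qed
    show "norm ((mat 1 - P (n - 0)) *v w - (mat 1 - P (n - n)) *v w) \<le> \<eta> * norm w" for w
      using P [of w] by (simp add: matrix_vector_mult_diff_rdistrib)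
  qed (use K0 L \<eta> v idem in \<open>simp_all add: idempotent_complement matrix_vector_mult_diff_rdistrib\<close>)
  obtain a where a: "a < t" "filter (\<lambda>c. c < a) chi' = filter (\<lambda>c. c < t) chi'"
    using filter_less_perturb [of t "\<lambda>c. c"] by blast
  have "dim (slow_space (reverse_cocycle A) y (- t - e)) + dim (slow_space A p a) \<le> CARD('m)"
  proof (rule dim_growth_plus_dim_slow_le [OF subspace_slow_space a(1) n, where L = L])
    fix v i assume v: "v \<in> slow_space (reverse_cocycle A) y (- t - e)"
    have "P 0 *v v = v" using dichotomy_fixes_slow [OF hyp [of 0] dich [of 0]] v by simp
    then show "exp (t * real n * real i) * norm v \<le> L * norm (A p (int (n * i)) *v v)"
      by (intro growth)
  qed (use L in simp)
  then show "dim (slow_space (reverse_cocycle A) y (- t - e)) + length (filter (\<lambda>c. c < t) chi') \<le> CARD('m)"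
    using dim_slow_space_ge(1) [OF os, of a] a(2) by simp
  obtain a' where a': "a' < - t" "filter (\<lambda>c. - c < a') chi' = filter (\<lambda>c. - c < - t) chi'"
    using filter_less_perturb [of "- t" uminus] by blast
  have "dim (slow_space A ((f ^^ n) y) (t - e)) + dim (slow_space (reverse_cocycle A) p a') \<le> CARD('m)"
  proof (rule dim_growth_plus_dim_slow_le [OF subspace_slow_space a'(1) n, where L = L])
    fix v i assume v: "v \<in> slow_space A ((f ^^ n) y) (t - e)"
    have "(mat 1 - P n) *v v = v"
      using dichotomy_fixes_slow [OF hyperbolic_at_reverse [OF hyp [of n]] dichotomy_reverse [OF dich [of n]]] v
      by simp
    then have "P n *v v = 0" by (simp add: matrix_vector_mult_diff_rdistrib)
    then show "exp (- t * real n * real i) * norm v \<le> L * norm (reverse_cocycle A p (int (n * i)) *v v)"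
      by (intro growth')
  qed (use L in simp)
  then show "dim (slow_space A ((f ^^ n) y) (t - e)) + length (filter (\<lambda>c. t < c) chi') \<le> CARD('m)"
    using dim_slow_space_ge(2) [OF os, of a'] a'(2) by simp
qed

section \<open>Periodic approximation\<close>

lemma finite_set_separation:
  fixes S :: "real set"
  assumes "finite S" "\<epsilon> > 0"
  obtains e where "e > 0" "2 * e < \<epsilon>" "\<And>c d. c \<in> S \<Longrightarrow> d \<in> S \<Longrightarrow> c \<noteq> d \<Longrightarrow> \<bar>c - d\<bar> > 4 * e"
proof -
  define g where "g = Min (insert \<epsilon> ((\<lambda>(c, d). \<bar>c - d\<bar>) ` {z \<in> S \<times> S. fst z \<noteq> snd z}))"
  have fin: "finite ((\<lambda>(c, d). \<bar>c - d\<bar>) ` {z \<in> S \<times> S. fst z \<noteq> snd z})" using assms by simp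
  have g: "g > 0" unfolding g_def using fin assms by (subst Min_gr_iff) auto
  have "g \<le> \<epsilon>" unfolding g_def using fin by (intro Min_le) auto
  moreover have "g \<le> \<bar>c - d\<bar>" if "c \<in> S" "d \<in> S" "c \<noteq> d" for c d
    unfolding g_def using fin that by (intro Min_le) force+
  ultimately show ?thesis using g that [of "g / 8"] by force
qed

lemma cone_steps_uniform:
  assumes "finite T" "e > 0" "L \<ge> 1"
  obtains \<eta> N where "\<eta> > 0"
    "\<And>t n. t \<in> T \<Longrightarrow> n \<ge> N \<Longrightarrow> cone_step t e L \<eta> n \<and> cone_step (- t) e L \<eta> n"
proof -
  let ?T = "T \<union> uminus ` T"
  have finT: "finite ?T" using assms by simp
  obtain h where h: "\<And>t. h t > 0"
    "\<And>t \<eta>. 0 < \<eta> \<and> \<eta> \<le> h t \<longrightarrow> (\<forall>\<^sub>F n in sequentially. cone_step t e L \<eta> n)"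
    using cone_step_exists [OF assms(2,3)] by metis
  define \<eta> where "\<eta> = Min (insert 1 (h ` ?T))"
  have \<eta>: "\<eta> > 0" unfolding \<eta>_def using finT h(1) by (subst Min_gr_iff) auto
  have "\<eta> \<le> h t" if "t \<in> ?T" for t
    unfolding \<eta>_def using finT that by (intro Min_le) auto
  then have "\<forall>\<^sub>F n in sequentially. \<forall>t\<in>?T. cone_step t e L \<eta> n"
    using \<eta> h(2) by (intro eventually_ball_finite [OF finT]) blast
  then obtain N where "\<And>n t. n \<ge> N \<Longrightarrow> t \<in> ?T \<Longrightarrow> cone_step t e L \<eta> n"
    unfolding eventually_sequentially by blast
  then show ?thesis using that [OF \<eta>, of N] by auto
qed

context holder_cocycle
begin

lemma invariant_measure_preserving:
  fixes M :: "'a measure"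
  assumes inv: "invariant_measure f M"
  shows "measure_preserving M f" "measure_preserving M (inv f)"
proof -
  have sets: "sets M = sets borel" and prob: "prob_space M" and meas: "f \<in> measurable M M"
    and f_distr: "distr M M f = M" using inv by (auto simp: invariant_measure_def)
  show "measure_preserving M f"
    using prob meas f_distr by (simp add: measure_preserving_def measure_preserving_axioms_def)
  have meas': "inv f \<in> measurable M M"
    using borel_measurable_continuous_onI [OF cont_inv] measurable_cong_sets [OF sets sets] by blast
  have "distr (distr M M f) M (inv f) = distr M M (inv f \<circ> f)"
    by (rule distr_distr [OF meas' meas])
  also have "inv f \<circ> f = (\<lambda>x. x)" using bij by (auto simp: bij_is_inj)
  finally have "distr M M (inv f) = M" by (simp add: f_distr)
  then show "measure_preserving M (inv f)"
    using prob meas' by (simp add: measure_preserving_def measure_preserving_axioms_def)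
qed

text \<open>Logarithms of the constants vary by a bounded amount along orbits, so
  \<open>slow_variation_on_positive_measure\<close> applies to the closed sets \<open>good_set t e (b ^ l)\<close>. A finite set of
  thresholds is treated at once, because later the same orbit segment has to serve all of them.\<close>

lemma tempered_dichotomies:
  fixes M :: "'a measure"
  assumes inv: "invariant_measure f M" and T: "finite T" and \<tau>: "\<tau> > 0"
    and hyp: "AE x in M. \<forall>t\<in>T. hyperbolic_at A t e x"
  obtains L R where "L \<ge> 1" "R \<in> sets M" "measure M R > 0"
    "\<And>x n t. x \<in> R \<Longrightarrow> t \<in> T \<Longrightarrow> (f ^^ n) x \<in> good_set t e (L * exp (\<tau> * real n)) \<and>
       (inv f ^^ n) x \<in> good_set t e (L * exp (\<tau> * real n))"
proof -
  obtain D where D: "D \<ge> 1" "\<And>x v. norm (A x 1 *v v) \<le> D * norm v"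
    "\<And>x v. norm (A x (- 1) *v v) \<le> D * norm v" using uniform_bound by metis
  define s where "s = (\<Sum>t\<in>T. \<bar>t\<bar> + \<bar>e\<bar>)"
  have s: "\<bar>t\<bar> + \<bar>e\<bar> \<le> s" if "t \<in> T" for t
    unfolding s_def using member_le_sum [of t T "\<lambda>t. \<bar>t\<bar> + \<bar>e\<bar>"] that T by simp
  have "s \<ge> 0" unfolding s_def by (intro sum_nonneg) simp
  \<comment> \<open>One step of the dynamics multiplies the constant of a dichotomy by at most \<open>b\<close>.\<close>
  define b where "b = D\<^sup>2 + D * exp s"
  have "1 \<le> D\<^sup>2" using D(1) by (rule one_le_power)
  moreover have "1 \<le> D * exp s" using mult_mono [of 1 D 1 "exp s"] D(1) \<open>s \<ge> 0\<close> by simp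
  ultimately have b: "b > 1" by (simp add: b_def)
  define G where "G l = (\<Inter>t\<in>T. good_set t e (b ^ l))" for l :: nat
  have pow_step: "b * b ^ l = b ^ Suc l" for l by simp
  have ae_G: "AE x in M. \<exists>l. x \<in> G l"
    using hyp
  proof eventually_elim
    case (elim x)
    have "\<exists>l. x \<in> good_set t e l" if "t \<in> T" for t
      using dichotomy_exists [of A t e x] elim that unfolding good_set_def by auto
    then obtain l where l: "\<And>t. t \<in> T \<Longrightarrow> x \<in> good_set t e (l t)" by metis
    obtain N where N: "(\<Sum>t\<in>T. \<bar>l t\<bar>) < b ^ N" using real_arch_pow [OF b] by blast
    have "l t \<le> b ^ N" if "t \<in> T" for t
      using member_le_sum [of t T "\<lambda>t. \<bar>l t\<bar>"] that T N by force
    then have "x \<in> G N" unfolding G_def using l good_set_mono by blast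
    then show ?case by blast
  qed
  define \<theta> where "\<theta> = min (1/2) (\<tau> / ln b)"
  have lnb: "ln b > 0" using b by simp
  have \<theta>: "0 < \<theta>" "\<theta> < 1" unfolding \<theta>_def using \<tau> lnb by auto
  have "\<theta> \<le> \<tau> / ln b" unfolding \<theta>_def by (rule min.cobounded2)
  then have \<theta>b: "\<theta> * ln b \<le> \<tau>" using lnb by (simp add: pos_le_divide_eq)
  have sets: "sets M = sets borel" using inv by (simp add: invariant_measure_def)
  obtain K' R where R: "R \<in> sets M" "measure M R > 0"
    "\<And>x n l. x \<in> R \<Longrightarrow> K' + \<theta> * real n \<le> real l \<Longrightarrow> (f ^^ n) x \<in> G l \<and> (inv f ^^ n) x \<in> G l"
  proof (rule slow_variation_on_positive_measure [OF invariant_measure_preserving [OF inv], of G \<theta>])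
    show "G l \<in> sets M" for l
      unfolding sets G_def using closed_good_set by (intro borel_closed closed_INT) auto
    show "G k \<subseteq> G l" if "k \<le> l" for k l
      unfolding G_def using good_set_mono power_increasing [OF that, of b] b by (blast intro: less_imp_le)
    show "f x \<in> G (Suc l)" "inv f x \<in> G (Suc l)" if "x \<in> G l" for x l
    proof -
      have "f x \<in> good_set t e (b ^ Suc l)" "inv f x \<in> good_set t e (b ^ Suc l)" if t: "t \<in> T" for t
        using good_set_step [where t = t and e = e and l = "b ^ l", OF _ D(2,3,1) s [OF t]] \<open>x \<in> G l\<close> t
        unfolding G_def b_def [symmetric] pow_step by blast+
      then show "f x \<in> G (Suc l)" "inv f x \<in> G (Suc l)" unfolding G_def by blast+
    qed
  qed (use ae_G \<theta> in auto)
  define K where "K = max 0 K'"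
  define L where "L = b powr (K + 1)"
  have L: "L \<ge> 1" unfolding L_def using b by (intro ge_one_powr_ge_zero) (auto simp: K_def)
  have good: "(f ^^ n) x \<in> good_set t e (L * exp (\<tau> * real n)) \<and>
      (inv f ^^ n) x \<in> good_set t e (L * exp (\<tau> * real n))" if xt: "x \<in> R" "t \<in> T" for x n t
  proof -
    define l where "l = nat \<lceil>K + \<theta> * real n\<rceil>"
    have nn: "0 \<le> K + \<theta> * real n" using \<theta> by (simp add: K_def)
    have "K' + \<theta> * real n \<le> real l" unfolding l_def K_def by linarith
    then have G: "(f ^^ n) x \<in> good_set t e (b ^ l) \<and> (inv f ^^ n) x \<in> good_set t e (b ^ l)"
      using R(3) [OF xt(1)] xt(2) unfolding G_def by blast
    have "real l \<le> K + 1 + \<theta> * real n" unfolding l_def using nn by linarith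
    then have "b powr real l \<le> b powr (K + 1 + \<theta> * real n)"
      using b by (intro powr_mono) auto
    also have "\<dots> = L * b powr (\<theta> * real n)" by (simp add: L_def powr_add)
    also have "b powr (\<theta> * real n) = exp ((\<theta> * ln b) * real n)" using b by (simp add: powr_def mult_ac)
    also have "L * \<dots> \<le> L * exp (\<tau> * real n)"
      using \<theta>b L by (intro mult_left_mono) (simp_all add: mult_right_mono)
    finally have "b ^ l \<le> L * exp (\<tau> * real n)" using b by (simp add: powr_realpow)
    then show ?thesis using G good_set_mono by blast
  qed
  show ?thesis by (rule that [OF L R(1,2) good])
qed

lemma periodic_approximation:
  fixes M :: "'a measure" and \<epsilon> :: real
  assumes closing: "closing_property f" and inv: "invariant_measure f M"
    and O: "AE x in M. oseledets_at A x chi (\<lambda>c. E c x)"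
    and chi: "sorted chi" "length chi = CARD('m)" and \<epsilon>: "\<epsilon> > 0"
  obtains p n chi' where "n > 0" "(f ^^ n) p = p" "sorted chi'" "length chi' = CARD('m)"
    "\<And>j. oseledets_at A (iterate f j p) chi' (exponent_space (iterate f j p))"
    "\<And>i. i < CARD('m) \<Longrightarrow> \<bar>chi ! i - chi' ! i\<bar> < \<epsilon>"
proof -
  obtain e where e: "e > 0" "2 * e < \<epsilon>"
    "\<And>c d. c \<in> set chi \<Longrightarrow> d \<in> set chi \<Longrightarrow> c \<noteq> d \<Longrightarrow> \<bar>c - d\<bar> > 4 * e"
    using finite_set_separation [OF finite_set \<epsilon>] by metis
  \<comment> \<open>Every exponent is enclosed between two thresholds at distance \<open>2 * e\<close> from it, and all
    exponents stay at distance more than \<open>e\<close> from all thresholds.\<close>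
  define T where "T = (\<lambda>c. c - 2 * e) ` set chi \<union> (\<lambda>c. c + 2 * e) ` set chi"
  have finT: "finite T" by (simp add: T_def)
  have gap: "\<bar>c - t\<bar> > e" if "t \<in> T" "c \<in> set chi" for t c
  proof -
    obtain d where d: "d \<in> set chi" "t = d - 2 * e \<or> t = d + 2 * e" using \<open>t \<in> T\<close> by (auto simp: T_def)
    show ?thesis using e(1) e(3) [OF that(2) d(1)] d(2) by (cases "c = d") auto
  qed
  have hyp: "AE x in M. \<forall>t\<in>T. hyperbolic_at A t e x \<and>
      length (filter (\<lambda>c. c < t) chi) \<le> dim (slow_space A x (t - e)) \<and>
      length (filter (\<lambda>c. t < c) chi) \<le> dim (slow_space (reverse_cocycle A) x (- t - e))"
    using O by eventually_elim (use oseledets_imp_hyperbolic [OF _ chi(2) e(1) gap] in blast)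
  obtain D where D: "D \<ge> 1" "\<And>x v. norm (A x (- 1) *v v) \<le> D * norm v" using uniform_bound by metis
  obtain c \<kappa> \<delta>\<^sub>0 where c: "c > 0" and \<kappa>: "\<kappa> > 0" and \<delta>\<^sub>0: "\<delta>\<^sub>0 > 0"
    and closing': "\<And>x n. n > 0 \<Longrightarrow> dist x ((f ^^ n) x) < \<delta>\<^sub>0 \<Longrightarrow>
      \<exists>p. (f ^^ n) p = p \<and> exponentially_close f (c * dist x ((f ^^ n) x)) \<kappa> n x p"
    using closing unfolding closing_property_def Let_def by metis
  have pos: "\<alpha> * \<kappa> > 0" using \<alpha> \<kappa> by simp
  have hyp': "AE x in M. \<forall>t\<in>T. hyperbolic_at A t e x" using hyp by eventually_elim blast
  obtain L R where L: "L \<ge> 1" and R: "R \<in> sets M" "measure M R > 0"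
    "\<And>x n t. x \<in> R \<Longrightarrow> t \<in> T \<Longrightarrow> (f ^^ n) x \<in> good_set t e (L * exp (\<alpha> * \<kappa> * real n)) \<and>
       (inv f ^^ n) x \<in> good_set t e (L * exp (\<alpha> * \<kappa> * real n))"
    by (rule tempered_dichotomies [OF inv finT pos hyp']) (rule that)
  obtain \<eta> N where \<eta>: "\<eta> > 0" and cone:
    "\<And>t n. t \<in> T \<Longrightarrow> n \<ge> N \<Longrightarrow> cone_step t e L \<eta> n \<and> cone_step (- t) e L \<eta> n"
    using cone_steps_uniform [OF finT e(1) L] by metis
  let ?C = "L * exp (\<alpha> * \<kappa>) * D\<^sup>2 * H"
  have C: "?C \<ge> 0" using L H by simp
  define \<delta>\<^sub>1 where "\<delta>\<^sub>1 = (\<eta> / (?C + 1)) powr (1 / \<alpha>)"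
  have \<delta>\<^sub>1: "\<delta>\<^sub>1 > 0" unfolding \<delta>\<^sub>1_def using \<eta> C by simp
  have small: "?C * \<delta> powr \<alpha> \<le> \<eta>" if "0 \<le> \<delta>" "\<delta> \<le> \<delta>\<^sub>1" for \<delta>
  proof -
    have "\<delta> powr \<alpha> \<le> \<delta>\<^sub>1 powr \<alpha>" using that \<alpha> by (intro powr_mono2) auto
    also have "\<dots> = \<eta> / (?C + 1)" unfolding \<delta>\<^sub>1_def using \<alpha> \<eta> C by (simp add: powr_powr)
    finally have "?C * \<delta> powr \<alpha> \<le> ?C * (\<eta> / (?C + 1))" using C by (intro mult_left_mono)
    also have "\<dots> \<le> \<eta>" using C \<eta> by (simp add: divide_simps algebra_simps)
    finally show ?thesis .
  qed
  define \<delta>\<^sub>2 where "\<delta>\<^sub>2 = min \<delta>\<^sub>0 (\<delta>\<^sub>1 / c)"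
  have \<delta>\<^sub>2: "\<delta>\<^sub>2 > 0" unfolding \<delta>\<^sub>2_def using \<delta>\<^sub>0 \<delta>\<^sub>1 c by simp
  interpret mp: measure_preserving M f 
    by (rule invariant_measure_preserving [OF inv])
  obtain x where x': "\<forall>i. \<forall>t\<in>T. hyperbolic_at A t e ((f ^^ i) x) \<and>
      length (filter (\<lambda>c. c < t) chi) \<le> dim (slow_space A ((f ^^ i) x) (t - e)) \<and>
      length (filter (\<lambda>c. t < c) chi) \<le> dim (slow_space (reverse_cocycle A) ((f ^^ i) x) (- t - e))"
    and visits: "infinite {n. (f ^^ n) x \<in> R}"
    by (rule mp.infinitely_many_visits [OF R(1,2) mp.AE_along_orbit [OF hyp]])
  note x = x' [THEN spec, THEN bspec]
  obtain r :: "nat \<Rightarrow> nat" where r: "strict_mono r" "\<And>k. (f ^^ r k) x \<in> R"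
    using infinite_enumerate [OF visits] unfolding mem_Collect_eq by blast
  have "\<exists>P. dichotomy A t e ((f ^^ r k) x) P L" if "t \<in> T" for t k
    using R(3) [OF r(2) [of k] that, of 0] by (simp add: good_set_def)
  then obtain P where P: "\<And>t k. t \<in> T \<Longrightarrow> dichotomy A t e ((f ^^ r k) x) (P t k) L" by metis
  have Pb: "P t k \<in> {P. \<forall>v. norm (P *v v) \<le> L * norm v}" if "t \<in> T" for t k
    using dichotomy_projection_bound(1) [OF P [OF that]] by simp
  \<comment> \<open>Among the visits to \<open>R\<close>, two are chosen whose points and projections nearly agree.\<close>
  obtain s1 :: "nat \<Rightarrow> nat" and l1 where s1: "strict_mono s1" "(\<lambda>k. (f ^^ r (s1 k)) x) \<longlonglongrightarrow> l1"
    using compact_space [unfolded compact_def, rule_format, of "\<lambda>k. (f ^^ r k) x"] by (auto simp: o_def)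
  obtain s2 :: "nat \<Rightarrow> nat" where s2: "strict_mono s2" "\<And>t. t \<in> T \<Longrightarrow> convergent (\<lambda>k. P t (s1 (s2 k)))"
    using simultaneously_convergent_subsequence [OF finT compact_bounded_matrices [of L], of "\<lambda>t k. P t (s1 k)"] Pb
    by auto
  define q where "q k = s1 (s2 k)" for k
  have q: "strict_mono (\<lambda>k. r (q k))"
    using r(1) s1(1) s2(1) by (simp add: q_def strict_mono_def)
  have "Cauchy (\<lambda>k. (f ^^ r (q k)) x)"
    using LIMSEQ_subseq_LIMSEQ [OF s1(2) s2(1)] by (intro LIMSEQ_imp_Cauchy) (simp add: q_def o_def)
  then have ev1: "\<forall>\<^sub>F j in sequentially. \<forall>k\<ge>j. dist ((f ^^ r (q j)) x) ((f ^^ r (q k)) x) < \<delta>\<^sub>2"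
    using \<delta>\<^sub>2 unfolding Cauchy_def eventually_sequentially by (meson order_trans)
  have ev2: "\<forall>\<^sub>F j in sequentially. \<forall>t\<in>T. \<forall>k\<ge>j. dist (P t (q j)) (P t (q k)) < \<eta> / real CARD('m)"
  proof (rule eventually_ball_finite [OF finT], rule ballI)
    fix t assume "t \<in> T"
    then have "Cauchy (\<lambda>k. P t (q k))" using s2(2) convergent_Cauchy unfolding q_def by blast
    moreover have "\<eta> / real CARD('m) > 0" using \<eta> by simp
    ultimately show "\<forall>\<^sub>F j in sequentially. \<forall>k\<ge>j. dist (P t (q j)) (P t (q k)) < \<eta> / real CARD('m)"
      unfolding Cauchy_def eventually_sequentially by (meson order_trans)
  qed
  obtain j where j: "\<And>k. k \<ge> j \<Longrightarrow> dist ((f ^^ r (q j)) x) ((f ^^ r (q k)) x) < \<delta>\<^sub>2"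
    "\<And>t k. t \<in> T \<Longrightarrow> k \<ge> j \<Longrightarrow> dist (P t (q j)) (P t (q k)) < \<eta> / real CARD('m)"
    using eventually_conj [OF ev1 ev2] unfolding eventually_sequentially by blast
  \<comment> \<open>The second visit is taken late enough that the segment has length at least \<open>N\<close>.\<close>
  define k where "k = max j (r (q j) + N + 1)"
  define n where "n = r (q k) - r (q j)"
  have kj: "k \<ge> j" by (simp add: k_def)
  have "r (q j) + N + 1 \<le> k" by (simp add: k_def)
  also have "k \<le> r (q k)" using seq_suble [OF q, of k] .
  finally have n: "n > 0" "n \<ge> N" "r (q k) = n + r (q j)" by (auto simp: n_def)
  define y where "y = (f ^^ r (q j)) x"
  have yn: "(f ^^ n) y = (f ^^ r (q k)) x" by (simp add: y_def n(3) funpow_add)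
  have yR: "y \<in> R" "(f ^^ n) y \<in> R" unfolding yn by (simp_all add: y_def r(2))
  have yd: "dist y ((f ^^ n) y) < \<delta>\<^sub>2" using j(1) [OF kj] by (simp add: y_def yn [unfolded y_def])
  have yi: "(f ^^ i) y = (f ^^ (i + r (q j))) x" for i by (simp add: y_def funpow_add)
  let ?\<delta> = "c * dist y ((f ^^ n) y)"
  have d: "dist y ((f ^^ n) y) < \<delta>\<^sub>0" "0 \<le> ?\<delta>" "?\<delta> \<le> \<delta>\<^sub>1"
    using yd c by (auto simp: \<delta>\<^sub>2_def field_simps)
  obtain p where p: "(f ^^ n) p = p" "exponentially_close f ?\<delta> \<kappa> n y p"
    using closing' [OF n(1) d(1)] by blast
  obtain chi' where chi': "sorted chi'" "length chi' = CARD('m)"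
    "\<And>j. oseledets_at A (iterate f j p) chi' (exponent_space (iterate f j p))"
    using periodic_oseledets [OF n(1) p(1)] by metis
  \<comment> \<open>The first half of the segment is controlled from its start \<open>y\<close>, the second half from its end.\<close>
  have yG: "(f ^^ i) y \<in> good_set t e (L * exp (\<alpha> * \<kappa> * real (min i (n - i))))"
    if i: "i \<le> n" and t: "t \<in> T" for i t
  proof (cases "i \<le> n - i")
    case True
    then show ?thesis using R(3) [OF yR(1) t, of i] by (simp add: min_def)
  next
    case False
    have "(inv f ^^ (n - i)) ((f ^^ (n - i)) z) = z" for z
      using bij by (metis bij_is_inj inv_f_f inj_fn inv_fn o_apply)
    from this [of "(f ^^ i) y"] have "(inv f ^^ (n - i)) ((f ^^ n) y) = (f ^^ i) y"
      using i by (simp add: funpow_add [symmetric, THEN fun_cong, unfolded o_apply])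
    then show ?thesis using R(3) [OF yR(2) t, of "n - i"] False by (simp add: min_def)
  qed
  have counts: "length (filter (\<lambda>c. c < t) chi') \<le> length (filter (\<lambda>c. c < t) chi)"
    "length (filter (\<lambda>c. t < c) chi') \<le> length (filter (\<lambda>c. t < c) chi)" if t: "t \<in> T" for t
  proof -
    define l where "l i = L * exp (\<alpha> * \<kappa> * real (min i (n - i)))" for i
    have "\<exists>Q. dichotomy A t e ((f ^^ i) y) Q (l i)" if "i \<le> n" for i
      using yG [OF that t] unfolding good_set_def l_def by blast
    then obtain Q where Q: "\<And>i. i \<le> n \<Longrightarrow> dichotomy A t e ((f ^^ i) y) (Q i) (l i)" by metis
    have hy: "hyperbolic_at A t e ((f ^^ i) y)" for i using x [OF t] by (simp add: yi)
    have Q0: "Q 0 = P t (q j)"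
      using dichotomy_unique [OF hy [of 0] Q [of 0]] P [OF t, of "q j"] by (simp add: y_def)
    have Qn: "Q n = P t (q k)"
      using dichotomy_unique [OF hy [of n] Q [of n]] P [OF t, of "q k"] by (simp add: yn)
    have Qclose: "norm (Q 0 *v v - Q n *v v) \<le> \<eta> * norm v" for v
    proof -
      have "norm ((Q 0 - Q n) *v v) \<le> real CARD('m) * norm (Q 0 - Q n) * norm v"
        by (rule norm_matrix_vector_mult_le)
      also have "real CARD('m) * norm (Q 0 - Q n) \<le> real CARD('m) * (\<eta> / real CARD('m))"
        using j(2) [OF t kj] by (intro mult_left_mono) (simp_all add: Q0 Qn dist_norm)
      also have "\<dots> = \<eta>" by simp
      finally show ?thesis by (simp add: matrix_vector_mult_diff_rdistrib mult_right_mono)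
    qed
    have close: "dist ((f ^^ i) y) ((f ^^ i) p) \<le> ?\<delta> * exp (- \<kappa> * real (min i (n - i)))" if "i \<le> n" for i
      using p(2) that unfolding exponentially_close_def by blast
    have os: "oseledets_at A p chi' (exponent_space p)" using chi'(3) [of 0] by simp
    have "length (filter (\<lambda>c. \<not> c < t) chi) = length (filter (\<lambda>c. t < c) chi)"
      using gap [OF t] e(1) by (intro arg_cong [where f = length] filter_cong refl) force
    then have total: "length (filter (\<lambda>c. c < t) chi) + length (filter (\<lambda>c. t < c) chi) = CARD('m)"
      using sum_length_filter_compl [of "\<lambda>c. c < t" chi] chi(2) by simp
    have "dim (slow_space (reverse_cocycle A) y (- t - e)) + length (filter (\<lambda>c. c < t) chi') \<le> CARD('m)"
      "dim (slow_space A ((f ^^ n) y) (t - e)) + length (filter (\<lambda>c. t < c) chi') \<le> CARD('m)"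
      by (rule shadowing_exponent_counts [where P = Q and K = l and \<delta> = "?\<delta>" and \<kappa> = \<kappa> and D = D and \<eta> = \<eta>
            and L = L and p = p];
          use cone [OF t n(2)] \<eta> L D p(1) Q hy \<kappa> d(2) close small [OF d(2,3)] Qclose n(1) os in \<open>simp add: l_def\<close>)+
    moreover have "length (filter (\<lambda>c. t < c) chi) \<le> dim (slow_space (reverse_cocycle A) y (- t - e))"
      using x [OF t] by (simp add: y_def)
    moreover have "length (filter (\<lambda>c. c < t) chi) \<le> dim (slow_space A ((f ^^ n) y) (t - e))"
      using x [OF t] by (simp add: yi)
    ultimately show "length (filter (\<lambda>c. c < t) chi') \<le> length (filter (\<lambda>c. c < t) chi)"
      "length (filter (\<lambda>c. t < c) chi') \<le> length (filter (\<lambda>c. t < c) chi)"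
      using total by linarith+
  qed
  have "\<bar>chi ! i - chi' ! i\<bar> < \<epsilon>" if i: "i < CARD('m)" for i
  proof -
    have "\<bar>chi ! i - chi' ! i\<bar> \<le> 2 * e"
      by (rule sorted_lists_close [OF chi chi'(1,2)])
        (use counts e(1) i in \<open>auto simp: T_def\<close>)
    then show ?thesis using e(2) by simp
  qed
  then show ?thesis using that n(1) p(1) chi' by blast
qed

end

lemma AE_orbit_measure:
  fixes f :: "'a::metric_space \<Rightarrow> 'a"
  assumes n: "n > 0" "(f ^^ n) p = p" and Q: "\<And>k. Q ((f ^^ k) p)"
  shows "AE x in orbit_measure f p. Q x"
proof -
  have "(f ^^ (n * k)) p = p" for k
    by (induction k) (simp_all add: funpow_add n(2))
  then have period: "(f ^^ (m + n * k)) p = (f ^^ m) p" for m k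
    by (simp add: funpow_add)
  have "orbit f p \<subseteq> (\<lambda>k. (f ^^ k) p) ` {..<n}"
  proof
    fix z assume "z \<in> orbit f p"
    then obtain k where k: "z = (f ^^ k) p" by (auto simp: orbit_altdef)
    have "z = (f ^^ (k mod n)) p" using period [of "k mod n" "k div n"] k by (simp add: add.commute)
    then show "z \<in> (\<lambda>k. (f ^^ k) p) ` {..<n}" using n(1) by auto
  qed
  then have fin: "finite (orbit f p)" by (rule finite_subset) simp
  then have orb: "orbit f p \<in> sets borel" by (intro borel_closed finite_imp_closed)
  have sub: "Q z" if "z \<in> orbit f p" for z using that Q by (auto simp: orbit_altdef)
  have meas: "(\<lambda>x. x) \<in> measurable (uniform_count_measure (orbit f p)) borel"
    by (auto simp: measurable_def sets_uniform_count_measure space_uniform_count_measure)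
  have "AE x in orbit_measure f p. x \<in> orbit f p"
    unfolding orbit_measure_def
    using orb by (subst AE_distr_iff [OF meas]) (auto simp: space_uniform_count_measure)
  then show ?thesis by eventually_elim (rule sub)
qed

theorem theorem1p4:
  fixes f :: "'a::metric_space \<Rightarrow> 'a"
    and \<A> :: "'a \<Rightarrow> int \<Rightarrow> real^'m^'m"
    and \<mu> :: "'a measure"
    and chi :: "real list"
    and \<epsilon> :: real
  assumes "compact (UNIV :: 'a set)"
    and "\<exists>g. homeomorphism UNIV UNIV f g"
    and "closing_property f"
    and "GL_cocycle f \<A>"
    and "Holder_cocycle \<A>"
    and "ergodic_measure f \<mu>"
    and "Lyapunov_exponents f \<A> \<mu> chi"
    and "\<epsilon> > 0"
  shows "\<exists>p. periodic_point f p \<and>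
           (\<exists>chi_p. Lyapunov_exponents f \<A> (orbit_measure f p) chi_p \<and>
                 (\<forall>i<CARD('m). \<bar>chi ! i - chi_p ! i\<bar> < \<epsilon>))"
proof -
  obtain g where g: "homeomorphism UNIV UNIV f g" using assms(2) by blast
  then have gf: "g (f x) = x" "f (g x) = x" for x by (auto simp: homeomorphism_def)
  have bij: "bij f" using gf by (metis bijI' )
  have "inv f = g" using gf by (intro inv_equality)
  then have cont: "continuous_on UNIV f" "continuous_on UNIV (inv f)"
    using g by (auto simp: homeomorphism_def)
  obtain \<alpha> H where \<alpha>: "\<alpha> > 0" and H: "\<And>x y. onorm ((*v) (\<A> x 1 - \<A> y 1)) \<le> H * dist x y powr \<alpha>"
    using assms(5) unfolding Holder_cocycle_def by blast
  interpret holder_cocycle f \<A> "\<bar>H\<bar>" \<alpha>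
  proof
    fix x y v
    have "norm (\<A> x 1 *v v - \<A> y 1 *v v) = norm ((\<A> x 1 - \<A> y 1) *v v)"
      by (simp add: matrix_vector_mult_diff_rdistrib)
    also have "\<dots> \<le> onorm ((*v) (\<A> x 1 - \<A> y 1)) * norm v"
      by (rule onorm [OF matrix_vector_mul_bounded_linear])
    also have "\<dots> \<le> (\<bar>H\<bar> * dist x y powr \<alpha>) * norm v"
      by (intro mult_right_mono order_trans [OF H]) auto
    finally show "norm (\<A> x 1 *v v - \<A> y 1 *v v) \<le> \<bar>H\<bar> * dist x y powr \<alpha> * norm v" .
  qed (use assms(1,4) bij cont \<alpha> in auto)
  obtain E where chi: "sorted chi" "length chi = CARD('m)"
    and E: "AE x in \<mu>. direct_sum_decomposition (set chi) (\<lambda>c. E c x) \<and>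
        (\<forall>c\<in>set chi. dim (E c x) = count_list chi c \<and>
           (\<forall>n. (*v) (\<A> x n) ` E c x = E c (iterate f n x)) \<and>
           (\<forall>v\<in>E c x. v \<noteq> 0 \<longrightarrow>
              ((\<lambda>n. ln (norm (\<A> x n *v v)) / real_of_int n) \<longlongrightarrow> c) at_top \<and>
              ((\<lambda>n. ln (norm (\<A> x n *v v)) / real_of_int n) \<longlongrightarrow> c) at_bot))"
    using assms(7) unfolding Lyapunov_exponents_def by blast
  have O: "AE x in \<mu>. oseledets_at \<A> x chi (\<lambda>c. E c x)"
    using E by eventually_elim (unfold oseledets_at_def, blast)
  have inv: "invariant_measure f \<mu>" using assms(6) by (simp add: ergodic_measure_def)
  obtain p n chi' where p: "n > 0" "(f ^^ n) p = p" "sorted chi'" "length chi' = CARD('m)"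
    "\<And>j. oseledets_at \<A> (iterate f j p) chi' (exponent_space (iterate f j p))"
    "\<And>i. i < CARD('m) \<Longrightarrow> \<bar>chi ! i - chi' ! i\<bar> < \<epsilon>"
    using periodic_approximation [OF assms(3) inv O chi assms(8)] by metis
  have os: "oseledets_at \<A> ((f ^^ k) p) chi' (exponent_space ((f ^^ k) p))" for k
    using p(5) [of "int k"] by (simp add: iterate_of_nat)
  have "Lyapunov_exponents f \<A> (orbit_measure f p) chi'"
    unfolding Lyapunov_exponents_def
  proof (intro conjI p(3,4) exI [of _ "\<lambda>c x. exponent_space x c"] AE_orbit_measure [OF p(1,2)], goal_cases)
    case (1 k)
    show ?case using os [of k] unfolding oseledets_at_def by blast
  next
    case (2 k)
    show ?case using os [of k] exponent_space_image unfolding oseledets_at_def by blast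
  qed
  then show ?thesis using p unfolding periodic_point_def by blast
qed

end
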